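(* Let $\Phi:\mathcal{L}(\mathcal{H})\to\mathcal{L}(\mathcal{K})$ be a quantum channel whose one-shot zero-error quantum capacity satisfies $Q_0(\Phi)=0$. Then $\Phi$ has a dominating transmittable algebra $\mathscr{A}_{\mathrm{dom}}(\Phi)$, and $$\mathscr{A}_{\mathrm{dom}}(\Phi)\cong\mathbb{C}^{2^{C_0(\Phi)}}=\underbrace{\mathbb{C}\oplus\cdots\oplus\mathbb{C}}_{2^{C_0(\Phi)}\text{ times}},$$ where $C_0(\Phi)$ is the one-shot zero-error classical capacity of $\Phi$.
   Context: All Hilbert spaces are finite-dimensional and complex; all $C^*$-algebras are finite-dimensional and nonzero. $\mathcal{L}(\mathcal{H})$ is the algebra of linear operators on $\mathcal{H}$. A quantum channel is a linear, completely positive, trace-preserving map $\Phi:\mathcal{L}(\mathcal{H})\to\mathcal{L}(\mathcal{K})$; its adjoint $\Phi^*$ is defined by $\mathrm{Tr}(Y\Phi(X))=\mathrm{Tr}(\Phi^*(Y)X)$. A state is a positive semidefinite operator of trace one. $\cong$ denotes $*$-isomorphism. Logarithms are to base 2. Capacities: $C_0(\Phi)=\log\max\{M\in\mathbb{N}:\text{there are states }\rho_1,\ldots,\rho_M\text{ on }\mathcal{H}\text{ such that }\Phi(\rho_m)\text{ and }\Phi(\rho_{m'})\text{ have orthogonal supports for all }m\neq m'\}$. $Q_0(\Phi)=\log\max\{d\in\mathbb{N}:\text{there are channels }\mathcal{E}:\mathcal{L}(\mathbb{C}^d)\to\mathcal{L}(\mathcal{H}),\ \mathcal{D}:\mathcal{L}(\mathcal{K})\to\mathcal{L}(\mathbb{C}^d)\text{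 with }\mathcal{D}\circ\Phi\circ\mathcal{E}=\mathrm{id}\}$. Embedding: $\mathscr{A}\leq\mathscr{B}$ means there is an injective (not necessarily unital) $*$-homomorphism $\mathscr{A}\to\mathscr{B}$. Correctability: a $*$-subalgebra $\mathscr{A}\subseteq\mathcal{L}(\mathcal{H})$ with unit projection $P$ (possibly $P\neq 1_{\mathcal{H}}$) is correctable for $\Phi$ if, with $C=P\mathcal{H}$, $V:C\to\mathcal{H}$ the inclusion and $\Phi|_C(Y)=\Phi(VYV^* )$, there is a channel $\mathcal{D}:\mathcal{L}(\mathcal{K})\to\mathcal{L}(C)$ with $(\mathcal{D}\circ\Phi|_C)^*(X)=X$ for all $X\in V^*\mathscr{A}V$. $\mathscr{A}$ is transmittable via $\Phi$ if there is an injective $*$-homomorphism $\pi:\mathscr{A}\to\mathcal{L}(\mathcal{H})$ whose image is correctable for $\Phi$; $\mathscr{T}(\Phi)$ is the set of transmittable algebras up to $*$-isomorphism. A dominating transmittable algebra $\mathscr{A}_{\mathrm{dom}}(\Phi)$ is an element of $\mathscr{T}(\Phi)$ into which every element of $\mathscr{T}(\Phi)$ embeds. *)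

theory Defs
  imports "Jordan_Normal_Form.Schur_Decomposition" "Jordan_Normal_Form.VS_Connect" Complex_Main
begin

text \<open>
  Every finite-dimensional complex Hilbert space is identified, by a choice of orthonormal basis,
  with some \<open>\<complex>\<^sup>n\<close>, so that operators are matrices in \<^term>\<open>carrier_mat n n :: complex mat set\<close>.
  A map \<open>\<L>(\<complex>\<^sup>n) \<rightarrow> \<L>(\<complex>\<^sup>m)\<close> is a function on matrices of which only the values on
  \<^term>\<open>carrier_mat n n :: complex mat set\<close> matter.
\<close>

section \<open>Channels\<close>

definition mat_trace :: "complex mat \<Rightarrow> complex" where
  "mat_trace A = (\<Sum>i<dim_row A. A $$ (i, i))"

text \<open>In the order on \<^typ>\<open>complex\<close>, \<open>0 \<le> z\<close> means that \<open>z\<close> is real and nonnegative.\<close>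

definition psd :: "nat \<Rightarrow> complex mat \<Rightarrow> bool" where
  "psd n A \<longleftrightarrow> A \<in> carrier_mat n n \<and> (\<forall>v\<in>carrier_vec n. 0 \<le> (A *\<^sub>v v) \<bullet>c v)"

definition state :: "nat \<Rightarrow> complex mat \<Rightarrow> bool" where
  "state n \<rho> \<longleftrightarrow> psd n \<rho> \<and> mat_trace \<rho> = 1"

definition linear_op_map :: "nat \<Rightarrow> nat \<Rightarrow> (complex mat \<Rightarrow> complex mat) \<Rightarrow> bool" where
  "linear_op_map n m \<Phi> \<longleftrightarrow>
     (\<forall>X\<in>carrier_mat n n. \<Phi> X \<in> carrier_mat m m) \<and>
     (\<forall>X\<in>carrier_mat n n. \<forall>Y\<in>carrier_mat n n. \<Phi> (X + Y) = \<Phi> X + \<Phi> Y) \<and>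
     (\<forall>c. \<forall>X\<in>carrier_mat n n. \<Phi> (c \<cdot>\<^sub>m X) = c \<cdot>\<^sub>m \<Phi> X)"

text \<open>
  The map \<open>id\<^sub>k \<otimes> \<Phi>\<close>: with \<open>\<complex>\<^sup>k \<otimes> \<complex>\<^sup>n\<close> identified with \<open>\<complex>\<^sup>k\<^sup>n\<close> via
  \<open>e\<^sub>p \<otimes> e\<^sub>a \<mapsto> e\<^sub>p\<^sub>n\<^sub>+\<^sub>a\<close>, it applies \<open>\<Phi>\<close> to each of the \<open>k \<times> k\<close> blocks of size \<open>n \<times> n\<close>.
\<close>

definition mat_block :: "nat \<Rightarrow> complex mat \<Rightarrow> nat \<Rightarrow> nat \<Rightarrow> complex mat" where
  "mat_block n X p q = mat n n (\<lambda>(a, b). X $$ (p * n + a, q * n + b))"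

definition ampliation ::
  "nat \<Rightarrow> nat \<Rightarrow> nat \<Rightarrow> (complex mat \<Rightarrow> complex mat) \<Rightarrow> complex mat \<Rightarrow> complex mat" where
  "ampliation k n m \<Phi> X =
     mat (k * m) (k * m) (\<lambda>(i, j). \<Phi> (mat_block n X (i div m) (j div m)) $$ (i mod m, j mod m))"

definition completely_positive :: "nat \<Rightarrow> nat \<Rightarrow> (complex mat \<Rightarrow> complex mat) \<Rightarrow> bool" where
  "completely_positive n m \<Phi> \<longleftrightarrow>
     (\<forall>k X. psd (k * n) X \<longrightarrow> psd (k * m) (ampliation k n m \<Phi> X))"

definition trace_preserving :: "nat \<Rightarrow> (complex mat \<Rightarrow> complex mat) \<Rightarrow> bool" where
  "trace_preserving n \<Phi> \<longleftrightarrow> (\<forall>X\<in>carrier_mat n n. mat_trace (\<Phi> X) = mat_trace X)"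

definition channel :: "nat \<Rightarrow> nat \<Rightarrow> (complex mat \<Rightarrow> complex mat) \<Rightarrow> bool" where
  "channel n m \<Phi> \<longleftrightarrow>
     linear_op_map n m \<Phi> \<and> completely_positive n m \<Phi> \<and> trace_preserving n \<Phi>"

definition map_adjoint ::
  "nat \<Rightarrow> nat \<Rightarrow> (complex mat \<Rightarrow> complex mat) \<Rightarrow> complex mat \<Rightarrow> complex mat" where
  "map_adjoint n m \<Phi> Y =
     (THE Z. Z \<in> carrier_mat n n \<and>
             (\<forall>X\<in>carrier_mat n n. mat_trace (Y * \<Phi> X) = mat_trace (Z * X)))"


section \<open>One-shot zero-error capacities\<close>

text \<open>The support of a positive operator is the orthogonal complement of its kernel.\<close>

definition op_support :: "nat \<Rightarrow> complex mat \<Rightarrow> complex vec set" where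
  "op_support n A =
     {v \<in> carrier_vec n. \<forall>w\<in>carrier_vec n. A *\<^sub>v w = 0\<^sub>v n \<longrightarrow> v \<bullet>c w = 0}"

definition orthogonal_supports :: "nat \<Rightarrow> complex mat \<Rightarrow> complex mat \<Rightarrow> bool" where
  "orthogonal_supports n A B \<longleftrightarrow> (\<forall>v\<in>op_support n A. \<forall>w\<in>op_support n B. v \<bullet>c w = 0)"

definition zero_error_classical_capacity ::
  "nat \<Rightarrow> nat \<Rightarrow> (complex mat \<Rightarrow> complex mat) \<Rightarrow> real" where
  "zero_error_classical_capacity n m \<Phi> =
     log 2 (real (Max {M. \<exists>\<rho>. (\<forall>i<M. state n (\<rho> i)) \<and>
       (\<forall>i<M. \<forall>j<M. i \<noteq> j \<longrightarrow> orthogonal_supports m (\<Phi> (\<rho> i)) (\<Phi> (\<rho> j)))}))"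

definition zero_error_quantum_capacity ::
  "nat \<Rightarrow> nat \<Rightarrow> (complex mat \<Rightarrow> complex mat) \<Rightarrow> real" where
  "zero_error_quantum_capacity n m \<Phi> =
     log 2 (real (Max {d. \<exists>\<E> \<D>. channel d n \<E> \<and> channel m d \<D> \<and>
       (\<forall>X\<in>carrier_mat d d. \<D> (\<Phi> (\<E> X)) = X)}))"


section \<open>Finite-dimensional \<open>C\<^sup>*\<close>-algebras\<close>

record 'a star_algebra = "(complex, 'a) module" +
  star :: "'a \<Rightarrow> 'a"

locale star_algebra = ring A + vectorspace "class_ring :: complex ring" A
  for A :: "('a, 'b) star_algebra_scheme" (structure) +
  assumes smult_mult_left:
      "\<lbrakk>x \<in> carrier A; y \<in> carrier A\<rbrakk> \<Longrightarrow> (c \<odot>\<^bsub>A\<^esub> x) \<otimes>\<^bsub>A\<^esub> y = c \<odot>\<^bsub>A\<^esub> (x \<otimes>\<^bsub>A\<^esub> y)"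
    and smult_mult_right:
      "\<lbrakk>x \<in> carrier A; y \<in> carrier A\<rbrakk> \<Longrightarrow> x \<otimes>\<^bsub>A\<^esub> (c \<odot>\<^bsub>A\<^esub> y) = c \<odot>\<^bsub>A\<^esub> (x \<otimes>\<^bsub>A\<^esub> y)"
    and star_closed: "x \<in> carrier A \<Longrightarrow> star A x \<in> carrier A"
    and star_star: "x \<in> carrier A \<Longrightarrow> star A (star A x) = x"
    and star_add:
      "\<lbrakk>x \<in> carrier A; y \<in> carrier A\<rbrakk> \<Longrightarrow> star A (x \<oplus>\<^bsub>A\<^esub> y) = star A x \<oplus>\<^bsub>A\<^esub> star A y"
    and star_smult: "x \<in> carrier A \<Longrightarrow> star A (c \<odot>\<^bsub>A\<^esub> x) = cnj c \<odot>\<^bsub>A\<^esub> star A x"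
    and star_mult:
      "\<lbrakk>x \<in> carrier A; y \<in> carrier A\<rbrakk> \<Longrightarrow> star A (x \<otimes>\<^bsub>A\<^esub> y) = star A y \<otimes>\<^bsub>A\<^esub> star A x"

definition cstar_norm :: "('a, 'b) star_algebra_scheme \<Rightarrow> ('a \<Rightarrow> real) \<Rightarrow> bool" where
  "cstar_norm A \<nu> \<longleftrightarrow>
     (\<forall>x\<in>carrier A. 0 \<le> \<nu> x \<and> (\<nu> x = 0 \<longleftrightarrow> x = \<zero>\<^bsub>A\<^esub>)) \<and>
     (\<forall>c. \<forall>x\<in>carrier A. \<nu> (c \<odot>\<^bsub>A\<^esub> x) = cmod c * \<nu> x) \<and>
     (\<forall>x\<in>carrier A. \<forall>y\<in>carrier A. \<nu> (x \<oplus>\<^bsub>A\<^esub> y) \<le> \<nu> x + \<nu> y) \<and>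
     (\<forall>x\<in>carrier A. \<forall>y\<in>carrier A. \<nu> (x \<otimes>\<^bsub>A\<^esub> y) \<le> \<nu> x * \<nu> y) \<and>
     (\<forall>x\<in>carrier A. \<nu> (star A x \<otimes>\<^bsub>A\<^esub> x) = (\<nu> x)\<^sup>2)"

text \<open>
  The norm of a \<open>C\<^sup>*\<close>-algebra is determined by its \<open>*\<close>-algebra structure, so only its existence is
  required; completeness is automatic in finite dimension, and so is the existence of a unit,
  which is part of the record. Homomorphisms need not preserve the unit.
\<close>

locale fd_cstar_algebra = star_algebra +
  assumes finite_dimensional: "fin_dim"
    and nonzero: "\<one> \<noteq> \<zero>"
    and cstar_norm_exists: "\<exists>\<nu>. cstar_norm A \<nu>"

definition star_hom ::
  "('a, 'c) star_algebra_scheme \<Rightarrow> ('b, 'd) star_algebra_scheme \<Rightarrow> ('a \<Rightarrow> 'b) \<Rightarrow> bool" where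
  "star_hom A B \<pi> \<longleftrightarrow>
     \<pi> \<in> carrier A \<rightarrow> carrier B \<and>
     (\<forall>x\<in>carrier A. \<forall>y\<in>carrier A. \<pi> (x \<oplus>\<^bsub>A\<^esub> y) = \<pi> x \<oplus>\<^bsub>B\<^esub> \<pi> y) \<and>
     (\<forall>c. \<forall>x\<in>carrier A. \<pi> (c \<odot>\<^bsub>A\<^esub> x) = c \<odot>\<^bsub>B\<^esub> \<pi> x) \<and>
     (\<forall>x\<in>carrier A. \<forall>y\<in>carrier A. \<pi> (x \<otimes>\<^bsub>A\<^esub> y) = \<pi> x \<otimes>\<^bsub>B\<^esub> \<pi> y) \<and>
     (\<forall>x\<in>carrier A. \<pi> (star A x) = star B (\<pi> x))"

definition star_embeds ::
  "('a, 'c) star_algebra_scheme \<Rightarrow> ('b, 'd) star_algebra_scheme \<Rightarrow> bool" where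
  "star_embeds A B \<longleftrightarrow> (\<exists>\<pi>. star_hom A B \<pi> \<and> inj_on \<pi> (carrier A))"

definition star_isomorphic ::
  "('a, 'c) star_algebra_scheme \<Rightarrow> ('b, 'd) star_algebra_scheme \<Rightarrow> bool" where
  "star_isomorphic A B \<longleftrightarrow> (\<exists>\<pi>. star_hom A B \<pi> \<and> bij_betw \<pi> (carrier A) (carrier B))"

definition op_algebra :: "nat \<Rightarrow> complex mat star_algebra" where
  "op_algebra n =
     \<lparr>carrier = carrier_mat n n, monoid.mult = (*), one = 1\<^sub>m n, zero = 0\<^sub>m n n, add = (+),
      module.smult = (\<cdot>\<^sub>m), star = mat_adjoint\<rparr>"

definition classical_algebra :: "nat \<Rightarrow> complex vec star_algebra" where
  "classical_algebra N =
     \<lparr>carrier = carrier_vec N, monoid.mult = component_mult, one = vec N (\<lambda>_. 1), zero = 0\<^sub>v N,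
      add = (+), module.smult = (\<cdot>\<^sub>v), star = conjugate\<rparr>"


section \<open>Correctable and transmittable algebras\<close>

definition star_subalgebra :: "nat \<Rightarrow> complex mat set \<Rightarrow> bool" where
  "star_subalgebra n S \<longleftrightarrow>
     S \<subseteq> carrier_mat n n \<and> 0\<^sub>m n n \<in> S \<and>
     (\<forall>X\<in>S. \<forall>Y\<in>S. X + Y \<in> S \<and> X * Y \<in> S) \<and>
     (\<forall>c. \<forall>X\<in>S. c \<cdot>\<^sub>m X \<in> S) \<and>
     (\<forall>X\<in>S. mat_adjoint X \<in> S)"

text \<open>
  The subspace \<open>C = P\<H>\<close> is identified with \<open>\<complex>\<^sup>r\<close> by an orthonormal basis of \<open>C\<close>; the inclusion
  \<open>V : C \<rightarrow> \<H>\<close> then becomes the \<open>n \<times> r\<close> matrix whose columns are that basis, that is, an isometry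
  with range projection \<open>V V\<^sup>* = P\<close>. Nothing depends on the choice of basis.
\<close>

definition restrict_code ::
  "(complex mat \<Rightarrow> complex mat) \<Rightarrow> complex mat \<Rightarrow> complex mat \<Rightarrow> complex mat" where
  "restrict_code \<Phi> V Y = \<Phi> (V * Y * mat_adjoint V)"

definition correctable ::
  "nat \<Rightarrow> nat \<Rightarrow> (complex mat \<Rightarrow> complex mat) \<Rightarrow> complex mat set \<Rightarrow> bool" where
  "correctable n m \<Phi> S \<longleftrightarrow>
     star_subalgebra n S \<and>
     (\<exists>P\<in>S. (\<forall>X\<in>S. P * X = X \<and> X * P = X) \<and>
       (\<exists>r. \<exists>V\<in>carrier_mat n r. mat_adjoint V * V = 1\<^sub>m r \<and> V * mat_adjoint V = P \<and>
         (\<exists>\<D>. channel m r \<D> \<and>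
           (\<forall>X\<in>S. map_adjoint r r (\<D> \<circ> restrict_code \<Phi> V) (mat_adjoint V * X * V)
                  = mat_adjoint V * X * V))))"

definition transmittable ::
  "nat \<Rightarrow> nat \<Rightarrow> (complex mat \<Rightarrow> complex mat) \<Rightarrow> ('a, 'b) star_algebra_scheme \<Rightarrow> bool" where
  "transmittable n m \<Phi> A \<longleftrightarrow>
     (\<exists>\<pi>. star_hom A (op_algebra n) \<pi> \<and> inj_on \<pi> (carrier A) \<and>
          correctable n m \<Phi> (\<pi> ` carrier A))"

text \<open>
  As a set, \<open>\<T>(\<Phi>)\<close> needs a fixed universe of algebras. Those with elements of type
  \<^typ>\<open>complex mat\<close> represent every isomorphism class of transmittable algebras; see the lemma
  \<open>transmittable_representative\<close> below.
\<close>

definition transmittable_algebras ::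
  "nat \<Rightarrow> nat \<Rightarrow> (complex mat \<Rightarrow> complex mat) \<Rightarrow> complex mat star_algebra set" where
  "transmittable_algebras n m \<Phi> = {A. fd_cstar_algebra A \<and> transmittable n m \<Phi> A}"

definition dominating_transmittable ::
  "nat \<Rightarrow> nat \<Rightarrow> (complex mat \<Rightarrow> complex mat) \<Rightarrow> complex mat star_algebra \<Rightarrow> bool" where
  "dominating_transmittable n m \<Phi> A \<longleftrightarrow>
     A \<in> transmittable_algebras n m \<Phi> \<and>
     (\<forall>B\<in>transmittable_algebras n m \<Phi>. star_embeds B A)"

lemma transmittable_representative:
  fixes B :: "'a star_algebra"
  assumes B: "fd_cstar_algebra B" and "transmittable n m \<Phi> B"
  shows "\<exists>A\<in>transmittable_algebras n m \<Phi>. star_isomorphic B A"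
proof -
  from assms(2) obtain \<pi> where hom: "star_hom B (op_algebra n) \<pi>" and inj: "inj_on \<pi> (carrier B)"
    and corr: "correctable n m \<Phi> (\<pi> ` carrier B)"
    unfolding transmittable_def by blast
  interpret B: fd_cstar_algebra B by (rule B)
  define A where "A = (op_algebra n)\<lparr>carrier := \<pi> ` carrier B, one := \<pi> \<one>\<^bsub>B\<^esub>\<rparr>"
  have A_simps: "carrier A = \<pi> ` carrier B" "\<one>\<^bsub>A\<^esub> = \<pi> \<one>\<^bsub>B\<^esub>" "\<zero>\<^bsub>A\<^esub> = 0\<^sub>m n n"
    "monoid.mult A = (*)" "add A = (+)" "module.smult A = (\<cdot>\<^sub>m)" "star A = mat_adjoint"
    by (simp_all add: A_def op_algebra_def)
  have p_car: "\<pi> x \<in> carrier_mat n n" if "x \<in> carrier B" for x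
    using hom that unfolding star_hom_def op_algebra_def by auto
  have p_add: "\<pi> x + \<pi> y = \<pi> (x \<oplus>\<^bsub>B\<^esub> y)" if "x \<in> carrier B" "y \<in> carrier B" for x y
    using hom that unfolding star_hom_def op_algebra_def by auto
  have p_smult: "c \<cdot>\<^sub>m \<pi> x = \<pi> (c \<odot>\<^bsub>B\<^esub> x)" if "x \<in> carrier B" for x c
    using hom that unfolding star_hom_def op_algebra_def by auto
  have p_mult: "\<pi> x * \<pi> y = \<pi> (x \<otimes>\<^bsub>B\<^esub> y)" if "x \<in> carrier B" "y \<in> carrier B" for x y
    using hom that unfolding star_hom_def op_algebra_def by auto
  have p_star: "mat_adjoint (\<pi> x) = \<pi> (star B x)" if "x \<in> carrier B" for x
    using hom that unfolding star_hom_def op_algebra_def by auto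
  have p_zero: "0\<^sub>m n n = \<pi> \<zero>\<^bsub>B\<^esub>"
  proof -
    have "\<pi> (0 \<odot>\<^bsub>B\<^esub> \<zero>\<^bsub>B\<^esub>) = 0 \<cdot>\<^sub>m \<pi> \<zero>\<^bsub>B\<^esub>" by (simp add: p_smult)
    also have "\<dots> = 0\<^sub>m n n" using p_car[of "\<zero>\<^bsub>B\<^esub>"] by (intro eq_matI) auto
    also have "0 \<odot>\<^bsub>B\<^esub> \<zero>\<^bsub>B\<^esub> = \<zero>\<^bsub>B\<^esub>" using B.lmult_0[of "\<zero>\<^bsub>B\<^esub>"] by simp
    finally show ?thesis by simp
  qed
  note A_eqs = A_simps(1,2,4-7) A_simps(3)[unfolded p_zero]
  note p_eqs = p_add p_smult p_mult p_star
  have abg: "abelian_group A"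
  proof (rule abelian_groupI)
    fix x assume "x \<in> carrier A"
    then obtain u where "u \<in> carrier B" "x = \<pi> u" by (auto simp: A_eqs)
    then show "\<exists>y\<in>carrier A. y \<oplus>\<^bsub>A\<^esub> x = \<zero>\<^bsub>A\<^esub>"
      by (intro bexI[of _ "\<pi> (\<ominus>\<^bsub>B\<^esub> u)"]) (auto simp: A_eqs p_eqs B.l_neg)
  qed (auto simp: A_eqs p_eqs B.a_ac)
  have mon: "Group.monoid A"
    by (rule Group.monoid.intro) (auto simp: A_eqs p_eqs B.m_assoc)
  have rng: "ring A"
    by (rule ringI[OF abg mon]) (auto simp: A_eqs p_eqs B.l_distr B.r_distr)
  have B_smult: "(a + b) \<odot>\<^bsub>B\<^esub> x = a \<odot>\<^bsub>B\<^esub> x \<oplus>\<^bsub>B\<^esub> b \<odot>\<^bsub>B\<^esub> x"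
    "(a * b) \<odot>\<^bsub>B\<^esub> x = a \<odot>\<^bsub>B\<^esub> (b \<odot>\<^bsub>B\<^esub> x)" "1 \<odot>\<^bsub>B\<^esub> x = x" "c \<odot>\<^bsub>B\<^esub> x \<in> carrier B"
    if "x \<in> carrier B" for a b c x
    using that B.smult_l_distr[of a b x] B.smult_assoc1[of a b x] B.smult_one[of x]
      B.smult_closed[of c x] by simp_all
  have md: "Module.module (class_ring :: complex ring) A"
    by (rule Module.module.intro[OF class_cring.cring_axioms abg], unfold_locales)
       (auto simp: A_eqs p_eqs B_smult B.smult_r_distr)
  have vs: "vectorspace (class_ring :: complex ring) A"
    by (rule vectorspace.intro[OF md class_field])
  have lin: "linear_map (class_ring :: complex ring) B A \<pi>"
    by (rule linear_map.intro[OF B.vectorspace_axioms vs mod_hom.intro[OF B.module_axioms md]],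
        unfold_locales)
       (auto simp: A_eqs p_eqs LinearCombinations.module_hom_def B_smult)
  have fin: "vectorspace.fin_dim (class_ring :: complex ring) A"
    by (rule linear_map.image_fin_dim[OF lin B.finite_dimensional]) (simp add: A_eqs)
  have sta: "star_algebra A"
    by (rule star_algebra.intro[OF rng vs], unfold_locales)
       (auto simp: A_eqs p_eqs B_smult B.smult_mult_left B.smult_mult_right B.star_closed
          B.star_star B.star_add B.star_smult B.star_mult)
  have nz: "\<one>\<^bsub>A\<^esub> \<noteq> \<zero>\<^bsub>A\<^esub>"
    using B.nonzero inj by (auto simp: A_eqs dest: inj_onD)
  from B.cstar_norm_exists obtain \<nu> where nu: "cstar_norm B \<nu>" by blast
  let ?g = "the_inv_into (carrier B) \<pi>"
  have g: "?g (\<pi> x) = x" if "x \<in> carrier B" for x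
    using inj that by (rule the_inv_into_f_f)
  have norm: "cstar_norm A (\<nu> \<circ> ?g)"
    using nu unfolding cstar_norm_def
    by (simp add: A_eqs p_eqs g B_smult B.star_closed inj_on_eq_iff[OF inj])
  have "fd_cstar_algebra A"
    by (rule fd_cstar_algebra.intro[OF sta], unfold_locales) (use fin nz norm in auto)
  moreover have "transmittable n m \<Phi> A"
    unfolding transmittable_def
    by (rule exI[of _ "\<lambda>x. x"])
       (use corr p_car in \<open>auto simp: A_simps star_hom_def op_algebra_def\<close>)
  moreover have "star_isomorphic B A"
    unfolding star_isomorphic_def
    by (rule exI[of _ \<pi>]) (use inj in \<open>auto simp: A_eqs p_eqs star_hom_def bij_betw_def\<close>)
  ultimately show ?thesis
    unfolding transmittable_algebras_def by blast
qed

end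

theory Submission
  imports Defs "Jordan_Normal_Form.Spectral_Radius"
begin

text \<open>
  Let \<open>S\<close> be correctable for \<open>\<Phi>\<close>. Pulling the elements of \<open>S\<close> back through the recovery channel
  gives observables on the output of \<open>\<Phi>\<close> with the same statistics. Hence orthogonal projections
  in \<open>S\<close>, normalized to states, form a zero-error classical code, so there are at most
  \<open>N = 2\<^sup>C\<close> of them, \<open>C\<close> being the classical capacity. Take a maximal family of orthogonal projections
  \<open>p\<^sub>i\<close> in \<open>S\<close>. By maximality and the spectral theorem \<open>p\<^sub>i S p\<^sub>i = \<complex> p\<^sub>i\<close>. A nonzero \<open>p\<^sub>i x p\<^sub>j\<close> with
  \<open>i \<noteq> j\<close> would be a multiple of a partial isometry, which generates \<open>2 \<times> 2\<close> matrix units and thus a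
  perfect qubit code, contradicting the vanishing quantum capacity. So \<open>S\<close> is spanned by at most
  \<open>N\<close> orthogonal projections. Conversely, for an optimal classical code \<open>\<rho>\<^sub>i\<close>, measuring the support
  projections of \<open>\<Phi>(\<rho>\<^sub>i)\<close> recovers the algebra spanned by \<open>\<psi>\<^sub>i \<psi>\<^sub>i\<^sup>*\<close>, with unit vectors \<open>\<psi>\<^sub>i\<close> in the
  ranges of the \<open>\<rho>\<^sub>i\<close>.
\<close>

section \<open>Adjoints, traces and positive operators\<close>

text \<open>No decomposition theorem for \<open>S\<close> is invoked: a projection family of largest
  size exists because codes have at most \<open>m\<close> members, and each failure of the desired
  structure would either lengthen it or produce a qubit. The link between algebra and codes is a
  test \<open>0 \<le> G \<le> 1\<close> that accepts one state surely and another never. For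
  positive operators \<open>tr (A B) = 0\<close> forces \<open>A B = 0\<close>, so such statistics
  already yield operator identities. A test is moved through a channel by the adjoint map, which is
  positive and unital: through the recovery for the upper bound, through \<Phi> itself for the
  converse. The bound \<open>m\<close> has a second role. A perfect quantum code of dimension d
  transmits d basis states without error, so the maximum in the quantum capacity is over a finite
  set; only then does the assumption on that capacity exclude d \<ge> 2. Once every transmittable
  algebra is some \<complex>^k with k \<le> N, domination is a comparison of numbers: \<complex>^N
  is itself transmittable, so it embeds in any dominating \<complex>^k, which forces k = N.\<close>

lemma mult_carrier_square [simp]:
  "A \<in> carrier_mat n n \<Longrightarrow> B \<in> carrier_mat n n \<Longrightarrow> A * B \<in> carrier_mat n n"
  by (rule mult_carrier_mat)

lemmas assoc_mult_square = assoc_mult_mat[of _ n n _ n _ n for n]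

lemma mat_adjoint_dim [simp]:
  "dim_row (mat_adjoint A) = dim_col A" "dim_col (mat_adjoint A) = dim_row A"
  by (auto simp: mat_adjoint_def)

lemma mat_adjoint_carrier [simp]:
  "A \<in> carrier_mat n m \<Longrightarrow> mat_adjoint A \<in> carrier_mat m n"
  by (intro carrier_matI) simp_all

lemma mat_adjoint_index [simp]:
  "i < dim_col A \<Longrightarrow> j < dim_row A \<Longrightarrow> mat_adjoint A $$ (i, j) = conjugate (A $$ (j, i))"
  by (simp add: mat_adjoint_def mat_of_rows_def)

lemma mat_adjoint_adjoint [simp]: "mat_adjoint (mat_adjoint A) = A"
  by (rule eq_matI) auto

lemma mat_adjoint_one [simp]: "mat_adjoint (1\<^sub>m n) = (1\<^sub>m n :: complex mat)"
  by (rule eq_matI) auto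

lemma mat_adjoint_zero [simp]: "mat_adjoint (0\<^sub>m n m) = (0\<^sub>m m n :: complex mat)"
  by (rule eq_matI) auto

lemma mat_adjoint_mult:
  fixes A B :: "complex mat"
  assumes "A \<in> carrier_mat n m" "B \<in> carrier_mat m k"
  shows "mat_adjoint (A * B) = mat_adjoint B * mat_adjoint A"
  by (rule eq_matI) (use assms in \<open>auto simp: scalar_prod_def intro!: sum.cong\<close>)

lemma mat_adjoint_add:
  fixes A B :: "complex mat"
  assumes "A \<in> carrier_mat n m" "B \<in> carrier_mat n m"
  shows "mat_adjoint (A + B) = mat_adjoint A + mat_adjoint B"
  by (rule eq_matI) (use assms in auto)

lemma mat_adjoint_minus:
  fixes A B :: "complex mat"
  assumes "A \<in> carrier_mat n m" "B \<in> carrier_mat n m"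
  shows "mat_adjoint (A - B) = mat_adjoint A - mat_adjoint B"
  by (rule eq_matI) (use assms in auto)

lemma mat_adjoint_smult [simp]:
  fixes A :: "complex mat"
  shows "mat_adjoint (c \<cdot>\<^sub>m A) = cnj c \<cdot>\<^sub>m mat_adjoint A"
  by (rule eq_matI) auto

lemma mat_adjoint_diag: "mat_adjoint (mat_diag n f) = mat_diag n (\<lambda>i. cnj (f i))"
  by (rule eq_matI) (auto simp: mat_diag_def)

text \<open>The general rules leave inner dimensions to be guessed when their carrier premises are
  discharged. With every dimension equal to one \<open>n\<close>, instantiated at each use,
  simplification can expand products of square matrices by itself.\<close>

lemmas square_simps =
  assoc_mult_mat[of _ n n _ n _ n]
  mult_minus_distrib_mat[of _ n n _ n] minus_mult_distrib_mat[of _ n n _ _ n]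
  mult_add_distrib_mat[of _ n n _ n] add_mult_distrib_mat[of _ n n _ _ n]
  mult_smult_distrib[of _ n n _ n] mult_smult_assoc_mat[of _ n n _ n]
  left_mult_one_mat[of _ n n] right_mult_one_mat[of _ n n]
  left_mult_zero_mat[of _ n n n] right_mult_zero_mat[of _ n n n]
  mat_adjoint_mult[of _ n n _ n] mat_adjoint_add[of _ n n] mat_adjoint_minus[of _ n n]
  for n

lemma mat_trace_add:
  assumes "A \<in> carrier_mat n n" "B \<in> carrier_mat n n"
  shows "mat_trace (A + B) = mat_trace A + mat_trace B"
  using assms by (auto simp: mat_trace_def sum.distrib)

lemma mat_trace_minus:
  assumes "A \<in> carrier_mat n n" "B \<in> carrier_mat n n"
  shows "mat_trace (A - B) = mat_trace A - mat_trace B"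
  using assms by (auto simp: mat_trace_def sum_subtractf)

lemma mat_trace_smult:
  assumes "A \<in> carrier_mat n n"
  shows "mat_trace (c \<cdot>\<^sub>m A) = c * mat_trace A"
  using assms by (auto simp: mat_trace_def sum_distrib_left)

lemma mat_trace_zero [simp]: "mat_trace (0\<^sub>m n n) = 0"
  by (simp add: mat_trace_def)

lemma mat_trace_one [simp]: "mat_trace (1\<^sub>m n) = of_nat n"
  by (simp add: mat_trace_def)

lemma mat_trace_mult:
  assumes "A \<in> carrier_mat n m" "B \<in> carrier_mat m n"
  shows "mat_trace (A * B) = (\<Sum>i<n. \<Sum>j<m. A $$ (i, j) * B $$ (j, i))"
  using assms by (auto simp: mat_trace_def scalar_prod_def atLeast0LessThan intro!: sum.cong)

lemma mat_trace_comm: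
  assumes "A \<in> carrier_mat n m" "B \<in> carrier_mat m n"
  shows "mat_trace (A * B) = mat_trace (B * A)"
  unfolding mat_trace_mult[OF assms] mat_trace_mult[OF assms(2,1)]
  by (subst sum.swap) (simp add: mult.commute)

text \<open>The squared Hilbert-Schmidt norm. Its definiteness is the source of every later argument
  that a matrix vanishes because a trace does.\<close>

lemma mat_trace_mult_adjoint:
  assumes "A \<in> carrier_mat n m"
  shows "mat_trace (A * mat_adjoint A) = of_real (\<Sum>i<n. \<Sum>j<m. (cmod (A $$ (i, j)))\<^sup>2)"
  using assms by (subst mat_trace_mult[OF assms, of "mat_adjoint A"])
    (auto simp: complex_norm_square simp del: of_real_power intro!: sum.cong)

lemma mat_trace_mult_adjoint_nonneg:
  assumes "A \<in> carrier_mat n m"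
  shows "0 \<le> mat_trace (A * mat_adjoint A)"
  unfolding mat_trace_mult_adjoint[OF assms] by (auto intro!: sum_nonneg simp: less_eq_complex_def)

lemma mat_trace_mult_adjoint_eq_0:
  assumes A: "A \<in> carrier_mat n m" and "mat_trace (A * mat_adjoint A) = 0"
  shows "A = 0\<^sub>m n m"
proof -
  have "(\<Sum>i<n. \<Sum>j<m. (cmod (A $$ (i, j)))\<^sup>2) = 0"
    using assms(2) unfolding mat_trace_mult_adjoint[OF A] by (simp only: of_real_eq_0_iff)
  then have "\<forall>i<n. \<forall>j<m. A $$ (i, j) = 0"
    by (subst (asm) sum_nonneg_eq_0_iff; (simp add: sum_nonneg)?)
       (subst (asm) sum_nonneg_eq_0_iff; simp)
  then show ?thesis using A by (intro eq_matI) auto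
qed

lemma mult_adjoint_eq_0:
  assumes A: "(A :: complex mat) \<in> carrier_mat n m" and "A * mat_adjoint A = 0\<^sub>m n n"
  shows "A = 0\<^sub>m n m"
  by (rule mat_trace_mult_adjoint_eq_0[OF A]) (simp add: assms(2))

lemma adjoint_mult_eq_0:
  assumes A: "(A :: complex mat) \<in> carrier_mat n m" and "mat_adjoint A * A = 0\<^sub>m m m"
  shows "A = 0\<^sub>m n m"
  using mult_adjoint_eq_0[of "mat_adjoint A" m n] assms
  by (metis mat_adjoint_adjoint mat_adjoint_carrier mat_adjoint_zero)

section \<open>Quadratic forms and positive operators\<close>

lemma cscalar_prod_sum:
  assumes "v \<in> carrier_vec n" "w \<in> carrier_vec n"
  shows "(v :: complex vec) \<bullet>c w = (\<Sum>i<n. v $ i * cnj (w $ i))"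
  using assms by (auto simp: scalar_prod_def atLeast0LessThan intro!: sum.cong)

lemma mult_mat_vec_sum:
  assumes "A \<in> carrier_mat n m" "v \<in> carrier_vec m" "i < n"
  shows "(A *\<^sub>v v) $ i = (\<Sum>j<m. A $$ (i, j) * v $ j)"
  using assms by (auto simp: scalar_prod_def atLeast0LessThan intro!: sum.cong)

lemma quadratic_form_sum:
  fixes A :: "complex mat"
  assumes "A \<in> carrier_mat n n" "v \<in> carrier_vec n"
  shows "(A *\<^sub>v v) \<bullet>c v = (\<Sum>i<n. \<Sum>j<n. cnj (v $ i) * A $$ (i, j) * v $ j)"
proof -
  have "(A *\<^sub>v v) \<bullet>c v = (\<Sum>i<n. (A *\<^sub>v v) $ i * cnj (v $ i))"
    using assms by (intro cscalar_prod_sum) auto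
  also have "\<dots> = (\<Sum>i<n. \<Sum>j<n. cnj (v $ i) * A $$ (i, j) * v $ j)"
    using assms by (auto simp del: index_mult_mat_vec
      simp: mult_mat_vec_sum[OF assms] sum_distrib_right sum_distrib_left mult_ac intro!: sum.cong)
  finally show ?thesis .
qed

lemma mult_mat_vec_adjoint:
  fixes A :: "complex mat"
  assumes A: "A \<in> carrier_mat n m" and v: "v \<in> carrier_vec m" and w: "w \<in> carrier_vec n"
  shows "(A *\<^sub>v v) \<bullet>c w = v \<bullet>c (mat_adjoint A *\<^sub>v w)"
proof -
  have "(A *\<^sub>v v) \<bullet>c w = (\<Sum>i<n. \<Sum>j<m. A $$ (i, j) * v $ j * cnj (w $ i))"
    using assms by (subst cscalar_prod_sum[of _ n])
      (auto simp del: index_mult_mat_vec simp: mult_mat_vec_sum[OF A v] sum_distrib_right)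
  also have "\<dots> = (\<Sum>j<m. \<Sum>i<n. A $$ (i, j) * v $ j * cnj (w $ i))"
    by (rule sum.swap)
  also have "\<dots> = v \<bullet>c (mat_adjoint A *\<^sub>v w)"
    using assms by (subst cscalar_prod_sum[of _ m])
      (auto simp del: index_mult_mat_vec
        simp: mult_mat_vec_sum[OF mat_adjoint_carrier[OF A] w] sum_distrib_left mult_ac
        intro!: sum.cong mult_mat_vec_carrier[of _ m n])
  finally show ?thesis .
qed

lemma psd_carrier: "psd n A \<Longrightarrow> A \<in> carrier_mat n n"
  by (simp add: psd_def)

lemma psd_mult_adjoint:
  assumes A: "A \<in> carrier_mat n m"
  shows "psd n (A * mat_adjoint A)"
  unfolding psd_def
proof (intro conjI ballI)
  show "A * mat_adjoint A \<in> carrier_mat n n" using A by simp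
  fix v :: "complex vec" assume v: "v \<in> carrier_vec n"
  have "(A * mat_adjoint A *\<^sub>v v) \<bullet>c v = (A *\<^sub>v (mat_adjoint A *\<^sub>v v)) \<bullet>c v"
    using A v by (subst assoc_mult_mat_vec[of _ n m _ n]) auto
  also have "\<dots> = (mat_adjoint A *\<^sub>v v) \<bullet>c (mat_adjoint A *\<^sub>v v)"
    using A v by (subst mult_mat_vec_adjoint[OF A]) (auto intro!: mult_mat_vec_carrier[of _ _ n])
  also have "0 \<le> \<dots>" by (rule conjugate_square_ge_0_vec)
  finally show "0 \<le> (A * mat_adjoint A *\<^sub>v v) \<bullet>c v" .
qed

lemma psd_add:
  assumes "psd n A" "psd n B"
  shows "psd n (A + B)"
  unfolding psd_def
proof (intro conjI ballI)
  have A: "A \<in> carrier_mat n n" and B: "B \<in> carrier_mat n n" using assms by (auto simp: psd_def)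
  show "A + B \<in> carrier_mat n n" using A B by simp
  fix v :: "complex vec" assume v: "v \<in> carrier_vec n"
  have "((A + B) *\<^sub>v v) \<bullet>c v = (A *\<^sub>v v) \<bullet>c v + (B *\<^sub>v v) \<bullet>c v"
    using A B v by (subst add_mult_distrib_mat_vec[of _ n n], simp_all,
      subst add_scalar_prod_distrib[of _ n]) (auto intro!: mult_mat_vec_carrier[of _ n n])
  also have "0 \<le> \<dots>" using assms v by (auto simp: psd_def)
  finally show "0 \<le> ((A + B) *\<^sub>v v) \<bullet>c v" .
qed

lemma psd_projection:
  assumes "A \<in> carrier_mat n n" "mat_adjoint A = A" "A * A = A"
  shows "psd n A"
  using psd_mult_adjoint[OF assms(1)] assms by simp

lemma quadratic_form_unit_vec:
  fixes A :: "complex mat"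
  assumes A: "A \<in> carrier_mat n n" and a: "a < n"
  shows "(A *\<^sub>v unit_vec n a) \<bullet>c unit_vec n a = A $$ (a, a)"
proof -
  have s: "(\<Sum>j<n. f j * unit_vec n a $ j) = f a" for f :: "nat \<Rightarrow> complex"
  proof -
    have "(\<Sum>j<n. f j * unit_vec n a $ j) = (\<Sum>j\<in>{a}. f j * unit_vec n a $ j)"
      using a by (intro sum.mono_neutral_right) auto
    then show ?thesis using a by simp
  qed
  have "(A *\<^sub>v unit_vec n a) \<bullet>c unit_vec n a = (A *\<^sub>v unit_vec n a) $ a"
    using a A by (subst cscalar_prod_sum[of _ n])
      (auto simp del: index_mult_mat_vec simp: s sum.remove[of _ a])
  also have "\<dots> = A $$ (a, a)"
    unfolding mult_mat_vec_sum[OF A unit_vec_carrier a] s ..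
  finally show ?thesis .
qed

lemma psd_diag_nonneg:
  assumes "psd n A" "a < n"
  shows "0 \<le> A $$ (a, a)"
  using assms quadratic_form_unit_vec[of A n a] by (metis psd_def unit_vec_carrier)

text \<open>The quadratic form of the conjugated matrix at \<open>v\<close> is that of
  \<open>A\<close> at \<open>V v\<close>.\<close>

lemma psd_conjugation:
  assumes psd: "psd n A" and V: "V \<in> carrier_mat n r"
  shows "psd r (mat_adjoint V * A * V)"
  unfolding psd_def
proof (intro conjI ballI)
  have A: "A \<in> carrier_mat n n" using psd by (rule psd_carrier)
  show "mat_adjoint V * A * V \<in> carrier_mat r r"
    using A V by (intro mult_carrier_mat[of _ r n] mult_carrier_mat[of "mat_adjoint V" r n]) auto
  fix v :: "complex vec" assume v: "v \<in> carrier_vec r"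
  have Vv: "V *\<^sub>v v \<in> carrier_vec n" using V v by (rule mult_mat_vec_carrier)
  have "(mat_adjoint V * A * V *\<^sub>v v) = mat_adjoint V *\<^sub>v (A *\<^sub>v (V *\<^sub>v v))"
    using A V v Vv by (subst assoc_mult_mat_vec[of _ r n _ r], (auto)[3])
      (subst assoc_mult_mat_vec[of _ r n _ n]; auto)
  then have "(mat_adjoint V * A * V *\<^sub>v v) \<bullet>c v = (A *\<^sub>v (V *\<^sub>v v)) \<bullet>c (V *\<^sub>v v)"
    using mult_mat_vec_adjoint[of "mat_adjoint V" r n "A *\<^sub>v (V *\<^sub>v v)" v] A V v Vv
    by (metis mat_adjoint_adjoint mat_adjoint_carrier mult_mat_vec_carrier)
  then show "0 \<le> (mat_adjoint V * A * V *\<^sub>v v) \<bullet>c v" using psd Vv by (simp add: psd_def)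
qed

text \<open>Polarization: the quadratic form is real on \<open>e\<^sub>a\<close>, \<open>e\<^sub>a + e\<^sub>b\<close> and \<open>e\<^sub>a + \<i> e\<^sub>b\<close>.\<close>

lemma psd_hermitian:
  assumes psd: "psd n A"
  shows "mat_adjoint A = A"
proof -
  have A: "A \<in> carrier_mat n n" using psd by (simp add: psd_def)
  have diag: "Im (A $$ (a, a)) = 0" if a: "a < n" for a
    using psd_diag_nonneg[OF psd a] by (simp add: less_eq_complex_def)
  have off: "Im (cnj c * A $$ (b, a) + c * A $$ (a, b)) = 0" if ab: "a < n" "b < n" "a \<noteq> b" for a b c
  proof -
    define v where "v = vec n (\<lambda>i. if i = a then 1 else if i = b then c else 0)"
    have v: "v \<in> carrier_vec n" by (simp add: v_def)
    have s: "(\<Sum>j<n. f j * v $ j) = f a + c * f b" for f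
    proof -
      have "(\<Sum>j<n. f j * v $ j) = (\<Sum>j\<in>{a, b}. f j * v $ j)"
        using ab by (intro sum.mono_neutral_right) (auto simp: v_def)
      then show ?thesis using ab by (simp add: v_def)
    qed
    have s': "(\<Sum>j<n. cnj (v $ j) * f j) = f a + cnj c * f b" for f
    proof -
      have "(\<Sum>j<n. cnj (v $ j) * f j) = (\<Sum>j\<in>{a, b}. cnj (v $ j) * f j)"
        using ab by (intro sum.mono_neutral_right) (auto simp: v_def)
      then show ?thesis using ab by (simp add: v_def)
    qed
    have "(A *\<^sub>v v) \<bullet>c v = (\<Sum>i<n. cnj (v $ i) * (\<Sum>j<n. A $$ (i, j) * v $ j))"
      unfolding quadratic_form_sum[OF A v] by (simp add: sum_distrib_left mult.assoc)
    also have "\<dots> = A $$ (a, a) + c * A $$ (a, b) + cnj c * (A $$ (b, a) + c * A $$ (b, b))"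
      by (simp add: s s')
    finally have "Im (A $$ (a, a) + c * A $$ (a, b) + cnj c * (A $$ (b, a) + c * A $$ (b, b))) = 0"
      using psd v unfolding psd_def by (metis less_eq_complex_def zero_complex.simps(2))
    then show ?thesis using diag[OF ab(1)] diag[OF ab(2)] by (simp add: algebra_simps)
  qed
  have "cnj (A $$ (b, a)) = A $$ (a, b)" if ab: "a < n" "b < n" for a b
  proof (cases "a = b")
    case True then show ?thesis using diag ab by (simp add: complex_eq_iff)
  next
    case False
    \<comment> \<open>The value 1 for \<open>c\<close> makes the imaginary parts of the two entries
      opposite, the value \<i> makes their real parts equal.\<close>
    show ?thesis using off[OF ab False, of 1] off[OF ab False, of \<i>]
      by (simp add: complex_eq_iff)
  qed
  then show ?thesis using A by (intro eq_matI) auto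
qed

section \<open>The spectral theorem\<close>

lemma adjoint_mult_cols:
  fixes A B :: "complex mat"
  assumes "A \<in> carrier_mat n k" "B \<in> carrier_mat n l" "i < k" "j < l"
  shows "(mat_adjoint A * B) $$ (i, j) = col B j \<bullet>c col A i"
  using assms by (simp add: scalar_prod_def mult.commute)

text \<open>Deflation in the spectral theorem needs a unitary whose first column spans a given line.
  Gram-Schmidt keeps the first vector of its input, so only normalization changes \<open>v\<close>,
  by the factor \<open>c\<close>.\<close>

lemma unitary_completion:
  fixes v :: "complex vec"
  assumes v: "v \<in> carrier_vec n" and v0: "v \<noteq> 0\<^sub>v n"
  shows "\<exists>U c. U \<in> carrier_mat n n \<and> mat_adjoint U * U = 1\<^sub>m n \<and> col U 0 = c \<cdot>\<^sub>v v"
proof -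
  interpret cof_vec_space n "TYPE(complex)" .
  define ws where "ws = gram_schmidt n (basis_completion v)"
  note b = basis_completion[OF v v0]
  have ws: "corthogonal ws" "set ws \<subseteq> carrier_vec n" "length ws = n"
    using gram_schmidt_result[OF b(2,4,5) ws_def] b(6) by auto
  have n: "0 < n"
    using v v0 by (cases n) auto
  then obtain vs where "basis_completion v = v # vs"
    using b(6,7) by (cases "basis_completion v") auto
  then have hd: "ws ! 0 = v"
    using gram_schmidt_hd[OF v, of vs] n ws(3) by (metis hd_conv_nth list.size(3) nat_less_le ws_def)
  have wsc: "ws ! i \<in> carrier_vec n" if "i < n" for i
    using ws(2,3) that by auto
  \<comment> \<open>The vectors \<open>ws\<close> are orthogonal but not normalized;
    \<open>r i\<close> is the norm of the i-th one.\<close>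
  define r where "r i = sqrt (Re (ws ! i \<bullet>c ws ! i))" for i
  have r: "of_real (r i) * of_real (r i) = ws ! i \<bullet>c ws ! i" "r i \<noteq> 0" if i: "i < n" for i
  proof -
    have "0 \<le> ws ! i \<bullet>c ws ! i" by (rule conjugate_square_ge_0_vec)
    moreover have "ws ! i \<bullet>c ws ! i \<noteq> 0" using corthogonalD[OF ws(1), of i i] i ws(3) by auto
    ultimately have *: "0 < Re (ws ! i \<bullet>c ws ! i)" "Im (ws ! i \<bullet>c ws ! i) = 0"
      by (auto simp: less_eq_complex_def complex_eq_iff)
    then show "of_real (r i) * of_real (r i) = ws ! i \<bullet>c ws ! i" "r i \<noteq> 0"
      by (auto simp: r_def complex_eq_iff simp flip: of_real_mult)
  qed
  define U where "U = mat_of_cols n (map (\<lambda>i. of_real (1 / r i) \<cdot>\<^sub>v ws ! i) [0..<n])"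
  have U: "U \<in> carrier_mat n n" by (intro carrier_matI) (simp_all add: U_def)
  have colU: "col U i = of_real (1 / r i) \<cdot>\<^sub>v ws ! i" if "i < n" for i
    using that wsc[of i] by (simp add: U_def)
  have "(mat_adjoint U * U) $$ (i, j) = 1\<^sub>m n $$ (i, j)" if ij: "i < n" "j < n" for i j
  proof -
    have "(mat_adjoint U * U) $$ (i, j) = of_real (1 / r j) * of_real (1 / r i) * (ws ! j \<bullet>c ws ! i)"
      unfolding adjoint_mult_cols[OF U U ij] colU[OF ij(1)] colU[OF ij(2)]
      using wsc[OF ij(1)] wsc[OF ij(2)]
      by (simp add: conjugate_smult_vec smult_scalar_prod_distrib[of _ n] scalar_prod_smult_distrib[of _ n])
    also have "\<dots> = 1\<^sub>m n $$ (i, j)"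
      using corthogonalD[OF ws(1), of j i] ij ws(3) r[OF ij(1)] by (auto simp: field_simps)
    finally show ?thesis .
  qed
  then have "mat_adjoint U * U = 1\<^sub>m n" using U by (intro eq_matI) auto
  then show ?thesis using U colU[OF n] hd by blast
qed

lemma unitary_right:
  fixes U :: "complex mat"
  assumes "U \<in> carrier_mat n n" "mat_adjoint U * U = 1\<^sub>m n"
  shows "U * mat_adjoint U = 1\<^sub>m n"
  using assms mat_mult_left_right_inverse[of "mat_adjoint U" n U] by simp

lemma four_block_adjoint:
  fixes A D :: "complex mat"
  assumes "A \<in> carrier_mat a a" "D \<in> carrier_mat d d"
  shows "mat_adjoint (four_block_mat A (0\<^sub>m a d) (0\<^sub>m d a) D) =
    four_block_mat (mat_adjoint A) (0\<^sub>m a d) (0\<^sub>m d a) (mat_adjoint D)"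
  by (rule eq_matI) (use assms in \<open>auto simp: four_block_mat_def Let_def\<close>)

lemma four_block_diag_mult:
  fixes A D :: "complex mat"
  assumes "A \<in> carrier_mat a a" "D \<in> carrier_mat d d" "A' \<in> carrier_mat a a" "D' \<in> carrier_mat d d"
  shows "four_block_mat A (0\<^sub>m a d) (0\<^sub>m d a) D * four_block_mat A' (0\<^sub>m a d) (0\<^sub>m d a) D' =
    four_block_mat (A * A') (0\<^sub>m a d) (0\<^sub>m d a) (D * D')"
  using assms by (subst mult_four_block_mat[of _ a a _ d _ d _ _ a _ d]) auto

text \<open>Deflation by one eigenvector. In a basis starting with it, the first column of the
  matrix is \<open>e\<close> followed by zeros, and self-adjointness clears the first row as well.
  What remains is a self-adjoint block of size \<open>k\<close>, and the unitary that diagonalizes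
  it is extended by a 1.\<close>

theorem spectral_theorem:
  fixes A :: "complex mat"
  assumes "A \<in> carrier_mat n n" "mat_adjoint A = A"
  shows "\<exists>U d. U \<in> carrier_mat n n \<and> mat_adjoint U * U = 1\<^sub>m n \<and> A = U * mat_diag n d * mat_adjoint U"
  using assms
proof (induction n arbitrary: A)
  case 0
  then show ?case by (intro exI[of _ "1\<^sub>m 0"] exI[of _ "\<lambda>_. 0"]) auto
next
  case (Suc k)
  let ?n = "Suc k"
  note A = Suc.prems(1)
  from spectrum_non_empty[OF A] obtain e where "eigenvalue A e" by (auto simp: spectrum_def)
  then obtain v where v: "v \<in> carrier_vec ?n" "v \<noteq> 0\<^sub>v ?n" "A *\<^sub>v v = e \<cdot>\<^sub>v v"
    using A unfolding eigenvalue_def eigenvector_def by auto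
  from unitary_completion[OF v(1,2)] obtain U c where U: "U \<in> carrier_mat ?n ?n"
    and UU: "mat_adjoint U * U = 1\<^sub>m ?n" and col0: "col U 0 = c \<cdot>\<^sub>v v" by blast
  note UU' = unitary_right[OF U UU]
  define B where "B = mat_adjoint U * A * U"
  have B: "B \<in> carrier_mat ?n ?n" using U A by (simp add: B_def)
  have B_adj: "mat_adjoint B = B"
    using U A Suc.prems(2)
    by (simp add: B_def mat_adjoint_mult[of _ ?n ?n _ ?n] assoc_mult_mat[of _ ?n ?n _ ?n _ ?n])
  have c0: "col U 0 \<in> carrier_vec ?n" using U by (metis carrier_matD(1) col_dim)
  have "col B 0 = mat_adjoint U *\<^sub>v (A *\<^sub>v col U 0)"
    using U A c0 unfolding B_def
    by (subst col_mult2[of _ ?n ?n _ ?n]) (auto simp: assoc_mult_mat_vec[of _ ?n ?n _ ?n])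
  also have "A *\<^sub>v col U 0 = e \<cdot>\<^sub>v col U 0"
    using v A by (auto simp: col0 mult_mat_vec[of _ ?n ?n] smult_smult_assoc mult.commute)
  also have "mat_adjoint U *\<^sub>v (e \<cdot>\<^sub>v col U 0) = e \<cdot>\<^sub>v col (mat_adjoint U * U) 0"
    using U c0 by (subst col_mult2[of _ ?n ?n _ ?n]) (auto simp: mult_mat_vec[of _ ?n ?n])
  finally have colB: "col B 0 = e \<cdot>\<^sub>v unit_vec ?n 0" by (simp add: UU)
  have B0: "B $$ (i, 0) = (if i = 0 then e else 0)" if "i < ?n" for i
    using arg_cong[OF colB, of "\<lambda>v. v $ i"] that B by auto
  have B0': "B $$ (0, i) = (if i = 0 then e else 0)" if "i < ?n" for i
  proof (cases "i = 0")
    case False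
    have "B $$ (0, i) = mat_adjoint B $$ (0, i)" by (simp add: B_adj)
    also have "\<dots> = cnj (B $$ (i, 0))" using that B by (subst mat_adjoint_index) auto
    finally show ?thesis using False B0[OF that] by simp
  qed (use B0[of 0] in simp)
  define C where "C = mat k k (\<lambda>(i, j). B $$ (Suc i, Suc j))"
  define E where "E = mat 1 1 (\<lambda>_. e)"
  have C: "C \<in> carrier_mat k k" and E: "E \<in> carrier_mat 1 1" by (simp_all add: C_def E_def)
  have "mat_adjoint C = C"
  proof (rule eq_matI)
    fix i j assume ij: "i < dim_row C" "j < dim_col C"
    have "B $$ (Suc i, Suc j) = mat_adjoint B $$ (Suc i, Suc j)" by (simp add: B_adj)
    also have "\<dots> = cnj (B $$ (Suc j, Suc i))"
      using ij C B by (subst mat_adjoint_index) auto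
    finally show "mat_adjoint C $$ (i, j) = C $$ (i, j)" using ij by (simp add: C_def)
  qed (simp_all add: C_def)
  from Suc.IH[OF C this] obtain W d where W: "W \<in> carrier_mat k k"
    and WW: "mat_adjoint W * W = 1\<^sub>m k" and CW: "C = W * mat_diag k d * mat_adjoint W" by blast
  define X where "X = four_block_mat (1\<^sub>m 1) (0\<^sub>m 1 k) (0\<^sub>m k 1) W"
  have X: "X \<in> carrier_mat ?n ?n" using W four_block_carrier_mat[of "1\<^sub>m 1" 1 1 W k k] by (simp add: X_def)
  have X_adj: "mat_adjoint X = four_block_mat (1\<^sub>m 1) (0\<^sub>m 1 k) (0\<^sub>m k 1) (mat_adjoint W)"
    using four_block_adjoint[of "1\<^sub>m 1" 1 W k] W by (simp add: X_def)
  have one: "four_block_mat (1\<^sub>m 1) (0\<^sub>m 1 k) (0\<^sub>m k 1) (1\<^sub>m k) = (1\<^sub>m ?n :: complex mat)"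
    by (rule eq_matI) (auto simp: four_block_mat_def Let_def)
  have XX: "mat_adjoint X * X = 1\<^sub>m ?n"
    unfolding X_adj unfolding X_def using W WW one by (subst four_block_diag_mult) auto
  define f where "f i = (case i of 0 \<Rightarrow> e | Suc j \<Rightarrow> d j)" for i
  have diag: "mat_diag ?n f = four_block_mat E (0\<^sub>m 1 k) (0\<^sub>m k 1) (mat_diag k d)"
    by (rule eq_matI) (auto simp: four_block_mat_def Let_def mat_diag_def E_def f_def split: nat.split)
  have "B = four_block_mat E (0\<^sub>m 1 k) (0\<^sub>m k 1) C"
  proof (rule eq_matI)
    fix i j assume "i < dim_row (four_block_mat E (0\<^sub>m 1 k) (0\<^sub>m k 1) C)"
      "j < dim_col (four_block_mat E (0\<^sub>m 1 k) (0\<^sub>m k 1) C)"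
    then have "i < ?n" "j < ?n" by (auto simp: E_def C_def four_block_mat_def Let_def)
    then show "B $$ (i, j) = four_block_mat E (0\<^sub>m 1 k) (0\<^sub>m k 1) C $$ (i, j)"
      using B0 B0' by (auto simp: E_def C_def four_block_mat_def Let_def)
  qed (use B in \<open>auto simp: E_def C_def four_block_mat_def Let_def\<close>)
  also have "\<dots> = X * mat_diag ?n f * mat_adjoint X"
    unfolding X_adj unfolding X_def diag CW
    using W E by (simp add: four_block_diag_mult)
  finally have BX: "B = X * mat_diag ?n f * mat_adjoint X" .
  have "A = U * mat_adjoint U * A * (U * mat_adjoint U)"
    using A by (simp add: UU')
  also have "\<dots> = U * B * mat_adjoint U"
    unfolding B_def using A U by (simp add: assoc_mult_mat[of _ ?n ?n _ ?n _ ?n])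
  also have "\<dots> = (U * X) * mat_diag ?n f * mat_adjoint (U * X)"
    unfolding BX using U X by (simp add: assoc_mult_mat[of _ ?n ?n _ ?n _ ?n] mat_adjoint_mult[of _ ?n ?n _ ?n])
  finally have "A = (U * X) * mat_diag ?n f * mat_adjoint (U * X)" .
  moreover have "mat_adjoint (U * X) * (U * X) = mat_adjoint X * (mat_adjoint U * U) * X"
    using U X by (simp add: assoc_mult_mat[of _ ?n ?n _ ?n _ ?n] mat_adjoint_mult[of _ ?n ?n _ ?n])
  moreover have "\<dots> = 1\<^sub>m ?n" using X by (simp add: UU XX)
  ultimately show ?case using U X by (metis mult_carrier_mat)
qed

section \<open>Consequences of the spectral theorem\<close>

text \<open>For fixed \<open>U\<close>, conjugation turns functions on the index set into matrices,
  respecting products and, by the next lemma, adjoints. This functional calculus provides square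
  roots, support projections and polynomials.\<close>

lemma unitary_diag_mult:
  fixes U :: "complex mat"
  assumes U: "U \<in> carrier_mat n n" and UU: "mat_adjoint U * U = 1\<^sub>m n"
  shows "(U * mat_diag n f * mat_adjoint U) * (U * mat_diag n g * mat_adjoint U) =
    U * mat_diag n (\<lambda>i. f i * g i) * mat_adjoint U"
proof -
  have "(U * mat_diag n f * mat_adjoint U) * (U * mat_diag n g * mat_adjoint U) =
      U * (mat_diag n f * ((mat_adjoint U * U) * (mat_diag n g * mat_adjoint U)))"
    using U by (simp add: assoc_mult_square[of _ n])
  also have "\<dots> = U * ((mat_diag n f * mat_diag n g) * mat_adjoint U)"
    using U unfolding UU by (simp add: square_simps[where n = n] del: mat_diag_diag)
  finally show ?thesis using U by (simp add: assoc_mult_square[of _ n])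
qed

lemma unitary_diag_adjoint:
  fixes U :: "complex mat"
  assumes U: "U \<in> carrier_mat n n"
  shows "mat_adjoint (U * mat_diag n f * mat_adjoint U) = U * mat_diag n (\<lambda>i. cnj (f i)) * mat_adjoint U"
  using U by (simp add: mat_adjoint_mult[of _ n n _ n] mat_adjoint_diag assoc_mult_square[of _ n])

lemma mat_diag_cong: "(\<And>i. i < n \<Longrightarrow> f i = g i) \<Longrightarrow> mat_diag n f = mat_diag n g"
  by (rule eq_matI) (auto simp: mat_diag_def)

text \<open>\<open>R\<close> is the positive square root. The eigenvalues have real roots because
  they are the diagonal entries of a conjugate of \<open>A\<close>, which is again positive.\<close>

lemma psd_factor:
  assumes psd: "psd n A"
  shows "\<exists>R\<in>carrier_mat n n. A = R * mat_adjoint R"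
proof -
  have A: "A \<in> carrier_mat n n" using psd by (rule psd_carrier)
  obtain U d where U: "U \<in> carrier_mat n n" and UU: "mat_adjoint U * U = 1\<^sub>m n"
    and AU: "A = U * mat_diag n d * mat_adjoint U"
    using spectral_theorem[OF A psd_hermitian[OF psd]] by blast
  have "mat_adjoint U * A * U = (mat_adjoint U * U) * mat_diag n d * (mat_adjoint U * U)"
    unfolding AU using U by (simp add: assoc_mult_square[of _ n])
  then have "mat_adjoint U * A * U = mat_diag n d" by (simp add: UU square_simps[where n = n])
  then have "psd n (mat_diag n d)" using psd_conjugation[OF psd U] by simp
  then have d: "0 \<le> d i" if "i < n" for i
    using psd_diag_nonneg[of n "mat_diag n d" i] that by (simp add: mat_diag_def)
  define s where "s i = complex_of_real (sqrt (Re (d i)))" for i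
  define R where "R = U * mat_diag n s * mat_adjoint U"
  have "R * mat_adjoint R = U * mat_diag n (\<lambda>i. s i * cnj (s i)) * mat_adjoint U"
    unfolding R_def unitary_diag_adjoint[OF U] unitary_diag_mult[OF U UU] ..
  also have "mat_diag n (\<lambda>i. s i * cnj (s i)) = mat_diag n d"
    using d by (intro mat_diag_cong)
      (simp add: s_def less_eq_complex_def complex_eq_iff flip: of_real_mult)
  finally have "A = R * mat_adjoint R" by (simp add: AU)
  moreover have "R \<in> carrier_mat n n" using U by (simp add: R_def)
  ultimately show ?thesis by blast
qed

text \<open>By cyclicity the trace of a product of two positive operators is a squared
  Hilbert-Schmidt norm. Its nonnegativity and its definiteness give the next two lemmas.\<close>

lemma mat_trace_psd_factors:
  fixes R Q :: "complex mat"
  assumes R: "R \<in> carrier_mat n n" and Q: "Q \<in> carrier_mat n n"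
  shows "mat_trace ((R * mat_adjoint R) * (Q * mat_adjoint Q)) =
    mat_trace ((mat_adjoint R * Q) * mat_adjoint (mat_adjoint R * Q))"
  using R Q mat_trace_comm[of R n n "mat_adjoint R * (Q * mat_adjoint Q)"]
  by (simp add: mat_adjoint_mult[of _ n n _ n] assoc_mult_square[of _ n])

lemma psd_trace_mult_nonneg:
  assumes "psd n A" "psd n B"
  shows "0 \<le> mat_trace (A * B)"
proof -
  obtain R Q where "R \<in> carrier_mat n n" "Q \<in> carrier_mat n n"
    "A = R * mat_adjoint R" "B = Q * mat_adjoint Q"
    using psd_factor assms by metis
  then show ?thesis
    by (simp add: mat_trace_psd_factors mat_trace_mult_adjoint_nonneg[of "mat_adjoint R * Q" n n])
qed

lemma psd_trace_mult_eq_0: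
  assumes "psd n A" "psd n B" and tr: "mat_trace (A * B) = 0"
  shows "A * B = 0\<^sub>m n n"
proof -
  obtain R Q where R: "R \<in> carrier_mat n n" and Q: "Q \<in> carrier_mat n n"
    and AB: "A = R * mat_adjoint R" "B = Q * mat_adjoint Q"
    using psd_factor assms by metis
  have "mat_adjoint R * Q = 0\<^sub>m n n"
    using tr R Q unfolding AB mat_trace_psd_factors[OF R Q]
    by (intro mat_trace_mult_adjoint_eq_0) simp_all
  moreover have "A * B = R * ((mat_adjoint R * Q) * mat_adjoint Q)"
    unfolding AB using R Q by (simp add: assoc_mult_square[of _ n])
  ultimately show ?thesis using R Q by simp
qed

text \<open>The matrix \<open>g\<close> is the pseudo-inverse of \<open>A\<close>. The two
  factorizations of \<open>q\<close> through \<open>A\<close> transfer vanishing products from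
  \<open>A\<close> to its support projection, on either side.\<close>

lemma support_projection:
  fixes A :: "complex mat"
  assumes A: "A \<in> carrier_mat n n" and A_adj: "mat_adjoint A = A"
  shows "\<exists>q g. q \<in> carrier_mat n n \<and> g \<in> carrier_mat n n \<and> mat_adjoint q = q \<and> q * q = q \<and>
    q = A * g \<and> q = g * A \<and> q * A = A"
proof -
  obtain U d where U: "U \<in> carrier_mat n n" and UU: "mat_adjoint U * U = 1\<^sub>m n"
    and AU: "A = U * mat_diag n d * mat_adjoint U"
    using spectral_theorem[OF A A_adj] by blast
  let ?q = "\<lambda>i. if d i = 0 then 0 else 1 :: complex"
  \<comment> \<open>The convention \<open>inverse 0 = 0\<close> makes the entrywise inverse a
    pseudo-inverse.\<close>
  have eqs: "(\<lambda>i. cnj (?q i)) = ?q" "(\<lambda>i. ?q i * ?q i) = ?q" "(\<lambda>i. d i * inverse (d i)) = ?q"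
    "(\<lambda>i. inverse (d i) * d i) = ?q" "(\<lambda>i. ?q i * d i) = d" by auto
  show ?thesis
    apply (rule exI[of _ "U * mat_diag n ?q * mat_adjoint U"])
    apply (rule exI[of _ "U * mat_diag n (\<lambda>i. inverse (d i)) * mat_adjoint U"])
    unfolding AU unitary_diag_mult[OF U UU] unitary_diag_adjoint[OF U] eqs
    using U by simp
qed

text \<open>The product of the factors \<open>h - a\<close> applied to \<open>p\<close>. Starting
  from \<open>p\<close> instead of the identity matrix keeps the result in a subalgebra whose unit
  may be smaller.\<close>

definition linear_factors :: "complex mat \<Rightarrow> complex list \<Rightarrow> complex mat \<Rightarrow> complex mat" where
  "linear_factors h as p = foldr (\<lambda>a W. h * W - a \<cdot>\<^sub>m W) as p"

lemma linear_factors_simps [simp]: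
  "linear_factors h [] p = p"
  "linear_factors h (a # as) p = h * linear_factors h as p - a \<cdot>\<^sub>m linear_factors h as p"
  by (simp_all add: linear_factors_def)

lemma linear_factors_carrier:
  "h \<in> carrier_mat n n \<Longrightarrow> p \<in> carrier_mat n n \<Longrightarrow> linear_factors h as p \<in> carrier_mat n n"
  by (induction as) auto

lemma linear_factors_one:
  assumes h: "h \<in> carrier_mat n n" and p: "p \<in> carrier_mat n n"
  shows "linear_factors h as p = linear_factors h as (1\<^sub>m n) * p"
proof (induction as)
  case (Cons a as)
  have c: "linear_factors h as (1\<^sub>m n) \<in> carrier_mat n n" by (rule linear_factors_carrier[OF h]) simp
  show ?case using h p c
    by (simp add: Cons minus_mult_distrib_mat[of _ n n] assoc_mult_square[of _ n] mult_smult_assoc_mat[of _ n n])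
qed (use p in simp)

text \<open>The full list of eigenvalues works: after diagonalization each diagonal entry of the
  product contains a zero factor.\<close>

lemma linear_factors_vanish:
  assumes h: "h \<in> carrier_mat n n" and h_adj: "mat_adjoint h = h" and p: "p \<in> carrier_mat n n"
  shows "\<exists>as. linear_factors h as p = 0\<^sub>m n n"
proof -
  obtain U d where U: "U \<in> carrier_mat n n" and UU: "mat_adjoint U * U = 1\<^sub>m n"
    and hU: "h = U * mat_diag n d * mat_adjoint U"
    using spectral_theorem[OF h h_adj] by blast
  have lf: "linear_factors h as (1\<^sub>m n) = U * mat_diag n (\<lambda>i. \<Prod>a\<leftarrow>as. d i - a) * mat_adjoint U" for as
  proof (induction as)
    case Nil
    then show ?case using unitary_right[OF U UU] U by simp
  next
    case (Cons a as)
    let ?g = "\<lambda>i. \<Prod>a\<leftarrow>as. d i - a"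
    have "a \<cdot>\<^sub>m (U * mat_diag n ?g * mat_adjoint U) = U * (a \<cdot>\<^sub>m mat_diag n ?g) * mat_adjoint U"
      using U by (simp add: square_simps[where n = n])
    moreover have "h * (U * mat_diag n ?g * mat_adjoint U) = U * mat_diag n (\<lambda>i. d i * ?g i) * mat_adjoint U"
      unfolding hU unitary_diag_mult[OF U UU] ..
    moreover have "U * X * mat_adjoint U - U * Y * mat_adjoint U = U * (X - Y) * mat_adjoint U"
      if "X \<in> carrier_mat n n" "Y \<in> carrier_mat n n" for X Y
      using U that by (simp add: square_simps[where n = n])
    moreover have "mat_diag n (\<lambda>i. d i * ?g i) - a \<cdot>\<^sub>m mat_diag n ?g = mat_diag n (\<lambda>i. (d i - a) * ?g i)"
      by (rule eq_matI) (auto simp: mat_diag_def algebra_simps)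
    ultimately show ?case by (simp add: Cons)
  qed
  have "(\<Prod>a\<leftarrow>map d [0..<n]. d i - a) = 0" if "i < n" for i
    using that by (auto simp: prod_list_zero_iff)
  then have "mat_diag n (\<lambda>i. \<Prod>a\<leftarrow>map d [0..<n]. d i - a) = mat_diag n (\<lambda>_. 0)"
    by (intro mat_diag_cong)
  also have "\<dots> = 0\<^sub>m n n" by (rule eq_matI) (auto simp: mat_diag_def)
  finally have "linear_factors h (map d [0..<n]) (1\<^sub>m n) = 0\<^sub>m n n"
    unfolding lf using U by simp
  then show ?thesis using linear_factors_one[OF h p] p by (metis left_mult_zero_mat)
qed

section \<open>Spectral projections inside a star-subalgebra\<close>

lemma
  assumes "star_subalgebra n S"
  shows star_subalgebra_carrier: "X \<in> S \<Longrightarrow> X \<in> carrier_mat n n"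
    and star_subalgebra_zero: "0\<^sub>m n n \<in> S"
    and star_subalgebra_add: "X \<in> S \<Longrightarrow> Y \<in> S \<Longrightarrow> X + Y \<in> S"
    and star_subalgebra_mult: "X \<in> S \<Longrightarrow> Y \<in> S \<Longrightarrow> X * Y \<in> S"
    and star_subalgebra_smult: "X \<in> S \<Longrightarrow> c \<cdot>\<^sub>m X \<in> S"
    and star_subalgebra_adjoint: "X \<in> S \<Longrightarrow> mat_adjoint X \<in> S"
  using assms by (auto simp: star_subalgebra_def)

lemma star_subalgebra_minus:
  assumes S: "star_subalgebra n S" and "X \<in> S" "Y \<in> S"
  shows "X - Y \<in> S"
proof -
  have "X - Y = X + (-1) \<cdot>\<^sub>m Y"
    using star_subalgebra_carrier[OF S] assms(2,3) by (intro eq_matI) auto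
  then show ?thesis using S assms by (simp add: star_subalgebra_add star_subalgebra_smult)
qed

lemma smult_zero_mat [simp]: "(c :: complex) \<cdot>\<^sub>m 0\<^sub>m n m = 0\<^sub>m n m"
  by (rule eq_matI) auto

lemma zero_smult_mat: "A \<in> carrier_mat n m \<Longrightarrow> (0 :: complex) \<cdot>\<^sub>m A = 0\<^sub>m n m"
  by (rule eq_matI) auto

lemma smult_smult_times: "a \<cdot>\<^sub>m (b \<cdot>\<^sub>m A) = (a * b :: complex) \<cdot>\<^sub>m A"
  by (rule eq_matI) auto

lemma smult_eq_zero_mat:
  assumes "A \<in> carrier_mat n m" "c \<cdot>\<^sub>m A = 0\<^sub>m n m"
  shows "(c :: complex) = 0 \<or> A = 0\<^sub>m n m"
proof (rule disjCI)
  assume "A \<noteq> 0\<^sub>m n m"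
  then obtain i j where ij: "i < n" "j < m" "A $$ (i, j) \<noteq> 0" using assms(1) by (metis carrier_matD eq_matI index_zero_mat)
  have "(c \<cdot>\<^sub>m A) $$ (i, j) = 0" using ij unfolding assms(2) by simp
  then show "c = 0" using ij assms(1) by simp
qed

lemma smult_right_cancel_mat:
  assumes A: "A \<in> carrier_mat n m" "A \<noteq> 0\<^sub>m n m" and eq: "c \<cdot>\<^sub>m A = (d :: complex) \<cdot>\<^sub>m A"
  shows "c = d"
proof -
  have "(c - d) \<cdot>\<^sub>m A = c \<cdot>\<^sub>m A - d \<cdot>\<^sub>m A" using A by (intro eq_matI) (auto simp: algebra_simps)
  then have "(c - d) \<cdot>\<^sub>m A = 0\<^sub>m n m" unfolding eq using A by (intro eq_matI) auto
  then show ?thesis using smult_eq_zero_mat[OF A(1), of "c - d"] A(2) by auto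
qed

text \<open>
  A non-vanishing product \<open>W\<close> of linear factors in \<open>h\<close> with \<open>(h - e) W = 0\<close> yields, up to a scalar,
  the spectral projection \<open>W\<^sup>* W\<close> of \<open>h\<close>, which lies in \<open>S\<close> since \<open>W\<close> is a polynomial in \<open>h\<close>.
\<close>

lemma split_projection:
  assumes S: "star_subalgebra n S" and p: "p \<in> S" "p \<noteq> 0\<^sub>m n n"
    and h: "h \<in> S" "mat_adjoint h = h" "h * p = h" "p * h = h"
    and ns: "\<nexists>c. h = c \<cdot>\<^sub>m p" and pp: "p * p = p" and p_adj: "mat_adjoint p = p"
  shows "\<exists>q\<in>S. q * q = q \<and> mat_adjoint q = q \<and> q \<noteq> 0\<^sub>m n n \<and> q \<noteq> p \<and> p * q = q"
proof -
  note [simp] = star_subalgebra_carrier[OF S]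
  let ?W = "\<lambda>as. linear_factors h as p"
  have W: "?W as \<in> S" for as
    using p h by (induction as) (auto intro!: star_subalgebra_minus star_subalgebra_mult star_subalgebra_smult S)
  have Wh: "h * ?W as = ?W as * h" for as
  proof (induction as)
    case (Cons a as)
    then show ?case using h(1) W[of as]
      by (simp add: square_simps[where n = n] Cons[symmetric])
  qed (use h in simp)
  have Wp: "?W as * p = ?W as" for as
  proof (induction as)
    case (Cons a as)
    then show ?case using h p W[of as] by (simp add: square_simps[where n = n])
  qed (use pp in simp)
  have comb: "e \<cdot>\<^sub>m (c \<cdot>\<^sub>m y) - a \<cdot>\<^sub>m (c \<cdot>\<^sub>m y) = ((e - a) * c) \<cdot>\<^sub>m y" for a c e :: complex and y
    by (rule eq_matI) (auto simp: algebra_simps)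
  \<comment> \<open>On an element \<open>y\<close> with \<open>h * y = e y\<close>, every polynomial
    in \<open>h\<close> acts as a scalar. The fact after this one treats the adjoint polynomial,
    whose coefficients are conjugated.\<close>
  have Wy: "\<exists>c. ?W as * y = c \<cdot>\<^sub>m y" if y: "y \<in> S" "h * y = e \<cdot>\<^sub>m y" "p * y = y" for as y e
  proof (induction as)
    case Nil
    have "p * y = 1 \<cdot>\<^sub>m y" using y by (intro eq_matI) auto
    then show ?case by auto
  next
    case (Cons a as)
    then obtain c where c: "?W as * y = c \<cdot>\<^sub>m y" by blast
    have "?W (a # as) * y = e \<cdot>\<^sub>m (c \<cdot>\<^sub>m y) - a \<cdot>\<^sub>m (c \<cdot>\<^sub>m y)"
      using h y W[of as]
      by (simp add: square_simps[where n = n] c smult_smult_times mult.commute)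
    then show ?case unfolding comb by blast
  qed
  have W'y: "\<exists>c. mat_adjoint (?W as) * y = c \<cdot>\<^sub>m y" if y: "y \<in> S" "h * y = e \<cdot>\<^sub>m y" "p * y = y" for as y e
  proof (induction as)
    case Nil
    have "p * y = 1 \<cdot>\<^sub>m y" using y by (intro eq_matI) auto
    then show ?case by (auto simp: p_adj)
  next
    case (Cons a as)
    then obtain c where c: "mat_adjoint (?W as) * y = c \<cdot>\<^sub>m y" by blast
    have "mat_adjoint (?W (a # as)) * y = e \<cdot>\<^sub>m (c \<cdot>\<^sub>m y) - cnj a \<cdot>\<^sub>m (c \<cdot>\<^sub>m y)"
      using h y W[of as]
      by (simp add: square_simps[where n = n] c smult_smult_times mult.commute)
    then show ?case unfolding comb by blast
  qed
  obtain as where "?W as = 0\<^sub>m n n"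
    using linear_factors_vanish[of h n p] h p by auto
  \<comment> \<open>The empty product is \<open>p\<close>, which is nonzero, and some product
    vanishes; so along the list there is a last nonzero product, and the factor that kills it is an
    eigenvalue \<open>e\<close> of \<open>h\<close>.\<close>
  then have "\<exists>as e. ?W as \<noteq> 0\<^sub>m n n \<and> ?W (e # as) = 0\<^sub>m n n"
    by (induction as) (use p in auto)
  then obtain as e where W0: "?W as \<noteq> 0\<^sub>m n n" and We: "?W (e # as) = 0\<^sub>m n n" by blast
  let ?w = "?W as"
  have w [simp]: "?w \<in> carrier_mat n n" using W by simp
  have hw: "h * ?w = e \<cdot>\<^sub>m ?w"
  proof -
    have "h * ?w = ?W (e # as) + e \<cdot>\<^sub>m ?w" using carrier_matD[OF w] carrier_matD[of h n n] h(1) by (intro eq_matI) auto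
    then show ?thesis unfolding We by (simp add: left_add_zero_mat[of _ n n])
  qed
  \<comment> \<open>This replaces \<open>?w\<close> by a self-adjoint element. It is nonzero by
    definiteness, and still \<open>h * y = e y\<close>, because the self-adjoint \<open>h\<close>
    commutes with \<open>?w\<close> and hence with its adjoint.\<close>
  define y where "y = mat_adjoint ?w * ?w"
  have y: "y \<in> S" unfolding y_def by (intro star_subalgebra_mult[OF S] star_subalgebra_adjoint[OF S] W)
  have y_adj: "mat_adjoint y = y" by (simp add: y_def square_simps[where n = n])
  have y0: "y \<noteq> 0\<^sub>m n n" unfolding y_def using adjoint_mult_eq_0[OF w] W0 by blast
  have "h * mat_adjoint ?w = mat_adjoint (?w * h)"
    using h by (simp add: square_simps[where n = n])
  also have "\<dots> = mat_adjoint ?w * h"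
    unfolding Wh[symmetric] using h(1) by (simp add: square_simps[where n = n] h(2))
  finally have "h * y = mat_adjoint ?w * (h * ?w)"
    using h(1) unfolding y_def by (simp add: square_simps[where n = n] flip: assoc_mult_square[of h n "mat_adjoint ?w" ?w])
  also have "\<dots> = e \<cdot>\<^sub>m y" unfolding hw by (simp add: y_def square_simps[where n = n])
  finally have hy: "h * y = e \<cdot>\<^sub>m y" .
  have "p * mat_adjoint ?w = mat_adjoint ?w"
    using arg_cong[OF Wp[of as], of mat_adjoint] p by (simp add: square_simps[where n = n] p_adj)
  then have py: "p * y = y"
    using p unfolding y_def by (simp flip: assoc_mult_square[of p n "mat_adjoint ?w" ?w])
  obtain c where c: "?w * y = c \<cdot>\<^sub>m y" using Wy[OF y hy py] by blast
  obtain c' where c': "mat_adjoint ?w * y = c' \<cdot>\<^sub>m y" using W'y[OF y hy py] by blast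
  have yy: "y * y = (c * c') \<cdot>\<^sub>m y"
  proof -
    have "y * y = mat_adjoint ?w * (?w * y)" using y by (simp add: y_def square_simps[where n = n])
    also have "\<dots> = c \<cdot>\<^sub>m (mat_adjoint ?w * y)" unfolding c using y by (simp add: square_simps[where n = n])
    finally show ?thesis unfolding c' by (simp add: smult_smult_times)
  qed
  define k where "k = c * c'"
  have "y * y \<noteq> 0\<^sub>m n n" using adjoint_mult_eq_0[of y n n] y0 y y_adj by auto
  then have k0: "k \<noteq> 0" using zero_smult_mat[of y n n] y unfolding yy k_def by auto
  have "k \<cdot>\<^sub>m y = cnj k \<cdot>\<^sub>m y"
  proof -
    have "mat_adjoint (y * y) = y * y" using y by (simp add: square_simps[where n = n] y_adj)
    then show ?thesis unfolding yy k_def by (simp add: y_adj)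
  qed
  then have k_cnj: "cnj k = k" using smult_right_cancel_mat[OF star_subalgebra_carrier[OF S y] y0, of k "cnj k"] by simp
  \<comment> \<open>Since \<open>y * y = k y\<close> with \<open>k\<close> real and nonzero, this
    scaling is a projection.\<close>
  define q where "q = inverse k \<cdot>\<^sub>m y"
  have "q \<in> S" unfolding q_def by (rule star_subalgebra_smult[OF S y])
  moreover have "q * q = q"
    using y k0 by (simp add: q_def square_simps[where n = n] yy k_def[symmetric] smult_smult_times)
  moreover have "mat_adjoint q = q" by (simp add: q_def mat_adjoint_smult y_adj k_cnj)
  moreover have q0: "q \<noteq> 0\<^sub>m n n" using smult_eq_zero_mat[of y n n "inverse k"] y y0 k0 by (auto simp: q_def)
  moreover have pq: "p * q = q" using p y by (simp add: q_def square_simps[where n = n] py)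
  moreover have "q \<noteq> p"
  proof
    assume qp: "q = p"
    have "h = h * q" using h(3) by (simp add: qp)
    also have "\<dots> = e \<cdot>\<^sub>m q" using h y
      by (simp add: q_def square_simps[where n = n] hy smult_smult_times mult.commute)
    finally show False using ns by (auto simp: qp)
  qed
  ultimately show ?thesis by blast
qed

section \<open>Channels\<close>

definition unit_mat :: "nat \<Rightarrow> nat \<Rightarrow> nat \<Rightarrow> complex mat" where
  "unit_mat n i j = mat n n (\<lambda>(a, b). if a = i \<and> b = j then 1 else 0)"

lemma unit_mat_carrier [simp]: "unit_mat n i j \<in> carrier_mat n n"
  by (simp add: unit_mat_def)

lemma linear_functional_expansion:
  fixes f :: "complex mat \<Rightarrow> complex"
  assumes add: "\<And>X Y. X \<in> carrier_mat n n \<Longrightarrow> Y \<in> carrier_mat n n \<Longrightarrow> f (X + Y) = f X + f Y"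
    and smult: "\<And>c X. X \<in> carrier_mat n n \<Longrightarrow> f (c \<cdot>\<^sub>m X) = c * f X"
    and X: "X \<in> carrier_mat n n"
  shows "f X = (\<Sum>i<n. \<Sum>j<n. X $$ (i, j) * f (unit_mat n i j))"
proof -
  \<comment> \<open>\<open>g K\<close> keeps the entries of \<open>X\<close> at the positions in
    \<open>K\<close>, so that induction on \<open>K\<close> can add one entry at a time.\<close>
  define g where "g K = mat n n (\<lambda>ij. if ij \<in> K then X $$ ij else 0)" for K
  have g: "g K \<in> carrier_mat n n" for K by (simp add: g_def)
  have "f (g K) = (\<Sum>(i, j)\<in>K. X $$ (i, j) * f (unit_mat n i j))" if "finite K" for K
    using that
  proof induction
    case empty
    have "0 \<cdot>\<^sub>m g {} = g {}" by (rule eq_matI) (auto simp: g_def)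
    then show ?case using smult[OF g, of 0 "{}"] by simp
  next
    case (insert ij K)
    obtain i j where ij: "ij = (i, j)" by (cases ij)
    have "g (insert ij K) = g K + X $$ (i, j) \<cdot>\<^sub>m unit_mat n i j"
      using insert.hyps by (intro eq_matI) (auto simp: g_def unit_mat_def ij)
    then show ?case using insert by (simp add: add smult g ij)
  qed
  from this[of "{..<n} \<times> {..<n}"] have "f (g ({..<n} \<times> {..<n})) =
    (\<Sum>i<n. \<Sum>j<n. X $$ (i, j) * f (unit_mat n i j))"
    by (simp add: sum.cartesian_product)
  moreover have "g ({..<n} \<times> {..<n}) = X" using X by (intro eq_matI) (auto simp: g_def)
  ultimately show ?thesis by simp
qed

text \<open>Testing with the adjoint of the difference produces the squared norm of that difference.
  This is the uniqueness behind the \<open>THE\<close> in \<open>map_adjoint\<close>.\<close>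

lemma mat_trace_nondegenerate:
  assumes Z: "Z \<in> carrier_mat n n" "Z' \<in> carrier_mat n n"
    and eq: "\<And>X. X \<in> carrier_mat n n \<Longrightarrow> mat_trace (Z * X) = mat_trace (Z' * X)"
  shows "Z = Z'"
proof -
  define D where "D = Z - Z'"
  have D: "D \<in> carrier_mat n n" using Z by (auto simp: D_def intro!: minus_carrier_mat)
  have "D * mat_adjoint D = Z * mat_adjoint D - Z' * mat_adjoint D"
    using minus_mult_distrib_mat[OF Z mat_adjoint_carrier[OF D]] by (simp add: D_def)
  then have "mat_trace (D * mat_adjoint D) = 0"
    using Z D eq[of "mat_adjoint D"] by (simp add: mat_trace_minus[of _ n])
  then have "D = 0\<^sub>m n n" by (rule mat_trace_mult_adjoint_eq_0[OF D])
  then have *: "D $$ (i, j) = 0" if "i < n" "j < n" for i j using that by simp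
  show ?thesis
  proof (rule eq_matI)
    fix i j assume "i < dim_row Z'" "j < dim_col Z'"
    then show "Z $$ (i, j) = Z' $$ (i, j)" using *[of i j] Z by (simp add: D_def)
  qed (use Z in auto)
qed

lemma
  assumes "linear_op_map n m \<Phi>"
  shows linear_op_map_carrier: "X \<in> carrier_mat n n \<Longrightarrow> \<Phi> X \<in> carrier_mat m m"
    and linear_op_map_add:
      "X \<in> carrier_mat n n \<Longrightarrow> Y \<in> carrier_mat n n \<Longrightarrow> \<Phi> (X + Y) = \<Phi> X + \<Phi> Y"
    and linear_op_map_smult: "X \<in> carrier_mat n n \<Longrightarrow> \<Phi> (c \<cdot>\<^sub>m X) = c \<cdot>\<^sub>m \<Phi> X"
  using assms by (auto simp: linear_op_map_def)

lemma map_adjoint_eqI: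
  assumes Z: "Z \<in> carrier_mat n n"
    and eq: "\<And>X. X \<in> carrier_mat n n \<Longrightarrow> mat_trace (Y * \<Phi> X) = mat_trace (Z * X)"
  shows "map_adjoint n m \<Phi> Y = Z"
  unfolding map_adjoint_def
proof (rule the_equality)
  fix Z' assume "Z' \<in> carrier_mat n n \<and> (\<forall>X\<in>carrier_mat n n. mat_trace (Y * \<Phi> X) = mat_trace (Z' * X))"
  then show "Z' = Z" using Z eq by (intro mat_trace_nondegenerate[of _ n]) auto
qed (use assms in auto)

lemma map_adjoint_spec:
  assumes \<Phi>: "linear_op_map n m \<Phi>" and Y: "Y \<in> carrier_mat m m"
  shows map_adjoint_carrier: "map_adjoint n m \<Phi> Y \<in> carrier_mat n n"
    and map_adjoint_trace: "X \<in> carrier_mat n n \<Longrightarrow>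
      mat_trace (map_adjoint n m \<Phi> Y * X) = mat_trace (Y * \<Phi> X)"
proof -
  let ?f = "\<lambda>X. mat_trace (Y * \<Phi> X)"
  \<comment> \<open>The indices are transposed because the trace of \<open>Z * X\<close> pairs the
    entry (j, i) of \<open>Z\<close> with the entry (i, j) of \<open>X\<close>.\<close>
  define Z where "Z = mat n n (\<lambda>(j, i). ?f (unit_mat n i j))"
  have Z: "Z \<in> carrier_mat n n" by (simp add: Z_def)
  have tr: "?f X = mat_trace (Z * X)" if X: "X \<in> carrier_mat n n" for X
  proof -
    have "?f X = (\<Sum>i<n. \<Sum>j<n. X $$ (i, j) * ?f (unit_mat n i j))"
      using X Y linear_op_map_carrier[OF \<Phi>]
      by (intro linear_functional_expansion)
        (auto simp: linear_op_map_add[OF \<Phi>] linear_op_map_smult[OF \<Phi>] square_simps[where n = m]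
          mat_trace_add[of _ m] mat_trace_smult[of _ m])
    also have "\<dots> = (\<Sum>i<n. \<Sum>j<n. Z $$ (j, i) * X $$ (i, j))"
      by (intro sum.cong) (auto simp: Z_def)
    also have "\<dots> = mat_trace (Z * X)"
      unfolding mat_trace_mult[OF Z X] by (rule sum.swap)
    finally show ?thesis .
  qed
  have "map_adjoint n m \<Phi> Y = Z" by (rule map_adjoint_eqI[OF Z tr])
  then show "map_adjoint n m \<Phi> Y \<in> carrier_mat n n"
    "X \<in> carrier_mat n n \<Longrightarrow> mat_trace (map_adjoint n m \<Phi> Y * X) = mat_trace (Y * \<Phi> X)"
    using Z tr by auto
qed

lemma
  assumes "channel n m \<Phi>"
  shows channel_linear: "linear_op_map n m \<Phi>"
    and channel_trace: "X \<in> carrier_mat n n \<Longrightarrow> mat_trace (\<Phi> X) = mat_trace X"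
    and channel_carrier: "X \<in> carrier_mat n n \<Longrightarrow> \<Phi> X \<in> carrier_mat m m"
  using assms by (auto simp: channel_def trace_preserving_def linear_op_map_def)

text \<open>The case \<open>k = 1\<close> of complete positivity, where the only block is
  \<open>X\<close> itself.\<close>

lemma channel_psd:
  assumes ch: "channel n m \<Phi>" and X: "psd n X"
  shows "psd m (\<Phi> X)"
proof -
  have "psd (1 * m) (ampliation 1 n m \<Phi> X)"
    using ch X unfolding channel_def completely_positive_def by (metis mult_1)
  moreover have "mat_block n X 0 0 = X"
    using psd_carrier[OF X] by (intro eq_matI) (auto simp: mat_block_def)
  then have "ampliation 1 n m \<Phi> X = \<Phi> X"
    using channel_carrier[OF ch psd_carrier[OF X]] by (intro eq_matI) (auto simp: ampliation_def)
  ultimately show ?thesis by simp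
qed

lemma channel_state: "channel n m \<Phi> \<Longrightarrow> state n \<rho> \<Longrightarrow> state m (\<Phi> \<rho>)"
  unfolding state_def using channel_psd channel_trace psd_carrier by metis

lemma psd_quadratic_trace:
  fixes A :: "complex mat"
  assumes A: "A \<in> carrier_mat n n" and v: "v \<in> carrier_vec n"
  shows "(A *\<^sub>v v) \<bullet>c v = mat_trace (A * (mat_of_cols n [v] * mat_adjoint (mat_of_cols n [v])))"
proof -
  have V: "mat_of_cols n [v] \<in> carrier_mat n 1" by (intro carrier_matI) auto
  have "mat_trace (A * (mat_of_cols n [v] * mat_adjoint (mat_of_cols n [v]))) =
    (\<Sum>i<n. \<Sum>j<n. A $$ (i, j) * (mat_of_cols n [v] * mat_adjoint (mat_of_cols n [v])) $$ (j, i))"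
    using A V by (intro mat_trace_mult) auto
  also have "\<dots> = (\<Sum>i<n. \<Sum>j<n. cnj (v $ i) * A $$ (i, j) * v $ j)"
    using v V by (intro sum.cong) (auto simp: scalar_prod_def mat_of_cols_index)
  finally show ?thesis unfolding quadratic_form_sum[OF A v] ..
qed

text \<open>Self-duality of the positive cone: a rank-one \<open>X\<close> turns the trace into the
  quadratic form. Positivity of a map thereby passes to its adjoint.\<close>

lemma psdI_trace:
  assumes A: "A \<in> carrier_mat n n" and tr: "\<And>X. psd n X \<Longrightarrow> 0 \<le> mat_trace (A * X)"
  shows "psd n A"
  unfolding psd_def
proof (intro conjI ballI)
  fix v :: "complex vec" assume v: "v \<in> carrier_vec n"
  show "0 \<le> (A *\<^sub>v v) \<bullet>c v"
    unfolding psd_quadratic_trace[OF A v]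
    by (rule tr[OF psd_mult_adjoint[of _ n 1]]) (intro carrier_matI; simp)
qed (rule A)

lemma map_adjoint_psd:
  assumes ch: "channel n m \<Phi>" and Y: "psd m Y"
  shows "psd n (map_adjoint n m \<Phi> Y)"
  using map_adjoint_spec[OF channel_linear[OF ch] psd_carrier[OF Y]]
  by (intro psdI_trace)
    (auto intro!: psd_trace_mult_nonneg[OF Y] channel_psd[OF ch] simp: psd_carrier)

text \<open>Dual form of trace preservation.\<close>

lemma map_adjoint_one:
  assumes ch: "channel n m \<Phi>"
  shows "map_adjoint n m \<Phi> (1\<^sub>m m) = 1\<^sub>m n"
  using channel_carrier[OF ch] channel_trace[OF ch]
  by (intro map_adjoint_eqI) (auto simp: square_simps[where n = n] square_simps[where n = m])

lemma map_adjoint_minus: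
  assumes \<Phi>: "linear_op_map n m \<Phi>" and Y: "Y \<in> carrier_mat m m" "Y' \<in> carrier_mat m m"
  shows "map_adjoint n m \<Phi> (Y - Y') = map_adjoint n m \<Phi> Y - map_adjoint n m \<Phi> Y'"
proof (rule map_adjoint_eqI)
  note Z = map_adjoint_carrier[OF \<Phi> Y(1)] map_adjoint_carrier[OF \<Phi> Y(2)]
  show "map_adjoint n m \<Phi> Y - map_adjoint n m \<Phi> Y' \<in> carrier_mat n n" using Z(2) by (rule minus_carrier_mat)
  fix X :: "complex mat" assume X: "X \<in> carrier_mat n n"
  note \<Phi>X = linear_op_map_carrier[OF \<Phi> X]
  have "mat_trace ((Y - Y') * \<Phi> X) = mat_trace (Y * \<Phi> X) - mat_trace (Y' * \<Phi> X)"
    unfolding minus_mult_distrib_mat[OF Y \<Phi>X] by (rule mat_trace_minus[OF mult_carrier_mat[OF Y(1) \<Phi>X] mult_carrier_mat[OF Y(2) \<Phi>X]])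
  also have "\<dots> = mat_trace (map_adjoint n m \<Phi> Y * X) - mat_trace (map_adjoint n m \<Phi> Y' * X)"
    by (simp only: map_adjoint_trace[OF \<Phi> Y(1) X] map_adjoint_trace[OF \<Phi> Y(2) X])
  also have "\<dots> = mat_trace ((map_adjoint n m \<Phi> Y - map_adjoint n m \<Phi> Y') * X)"
    unfolding minus_mult_distrib_mat[OF Z X] by (rule mat_trace_minus[OF mult_carrier_mat[OF Z(1) X] mult_carrier_mat[OF Z(2) X], symmetric])
  finally show "mat_trace ((Y - Y') * \<Phi> X) = mat_trace ((map_adjoint n m \<Phi> Y - map_adjoint n m \<Phi> Y') * X)" .
qed

section \<open>Ampliations and criteria for complete positivity\<close>

lemma mat_block_carrier [simp]: "mat_block n X p q \<in> carrier_mat n n"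
  by (simp add: mat_block_def)

lemma block_index_less:
  fixes p k a m :: nat
  assumes "p < k" "a < m"
  shows "p * m + a < k * m"
proof -
  have "p * m + a < (p + 1) * m" using assms by simp
  also have "\<dots> \<le> k * m" using assms by (intro mult_right_mono) auto
  finally show ?thesis .
qed

lemma block_index_div: "i < k * m \<Longrightarrow> i div m < (k :: nat)"
  by (metis div_less_iff_less_mult gr_zeroI mult_0_right not_less_zero)

lemma block_index_mod: "i < k * m \<Longrightarrow> i mod m < (m :: nat)"
  by (metis gr_zeroI mod_less_divisor mult_0_right not_less_zero)

lemma mat_block_ampliation:
  assumes "p < k" "q < k" "\<Phi> (mat_block n X p q) \<in> carrier_mat m m"
  shows "mat_block m (ampliation k n m \<Phi> X) p q = \<Phi> (mat_block n X p q)"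
  by (rule eq_matI) (use assms in \<open>auto simp: mat_block_def ampliation_def block_index_less\<close>)

lemma ampliation_comp:
  assumes "linear_op_map n m \<Phi>"
  shows "ampliation k m l \<Psi> (ampliation k n m \<Phi> X) = ampliation k n l (\<Psi> \<circ> \<Phi>) X"
  by (rule eq_matI)
    (auto simp: ampliation_def[of k m l] ampliation_def[of k n l] mat_block_ampliation
      linear_op_map_carrier[OF assms] block_index_div)

lemma channel_comp:
  assumes "channel n m \<Phi>" "channel m l \<Psi>"
  shows "channel n l (\<Psi> \<circ> \<Phi>)"
  using assms ampliation_comp[of n m \<Phi>]
  by (auto simp: channel_def linear_op_map_def trace_preserving_def completely_positive_def)
     metis

lemma psd_zero: "psd n (0\<^sub>m n n)"
  using psd_projection[of "0\<^sub>m n n" n] by simp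

lemma psd_sum:
  fixes s :: nat
  assumes "\<And>l. l < s \<Longrightarrow> psd N (F l)"
  shows "psd N (mat N N (\<lambda>ij. \<Sum>l<s. F l $$ ij))"
  using assms
proof (induction s)
  case 0
  have "mat N N (\<lambda>ij. \<Sum>l<(0::nat). F l $$ ij) = 0\<^sub>m N N" by (rule eq_matI) auto
  then show ?case by (simp add: psd_zero)
next
  case (Suc s)
  have "mat N N (\<lambda>ij. \<Sum>l<Suc s. F l $$ ij) = mat N N (\<lambda>ij. \<Sum>l<s. F l $$ ij) + F s"
    using psd_carrier[OF Suc.prems[of s]] by (intro eq_matI) auto
  then show ?case using Suc by (auto intro: psd_add)
qed

lemma sum_blocks: "(\<Sum>u<k * r. f u) = (\<Sum>p<k. \<Sum>a<r. f (p * r + a))"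
  for f :: "nat \<Rightarrow> complex"
proof -
  have "(\<Sum>u<k * r. f u) = (\<Sum>p<k. sum f {p * r..<p * r + r})" by (rule sum.nat_group[symmetric])
  also have "\<dots> = (\<Sum>p<k. \<Sum>a<r. f (p * r + a))"
  proof (rule sum.cong[OF refl])
    fix p
    show "sum f {p * r..<p * r + r} = (\<Sum>a<r. f (p * r + a))"
      using sum.shift_bounds_nat_ivl[of f 0 "p * r" r] by (simp add: atLeast0LessThan add.commute)
  qed
  finally show ?thesis .
qed

text \<open>
  The blocks of the ampliation are \<open>tr (R\<^sub>i\<^sup>* X\<^sub>p\<^sub>q R\<^sub>j)\<close>; writing the trace as a sum over the columns
  of the \<open>R\<^sub>j\<close> exhibits the ampliation as \<open>\<Sum>\<^sub>l T\<^sub>l\<^sup>* X T\<^sub>l\<close>.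
\<close>

lemma completely_positive_gram:
  assumes R: "\<And>i. i < d \<Longrightarrow> R i \<in> carrier_mat r s"
    and \<Phi>: "\<And>X. X \<in> carrier_mat r r \<Longrightarrow>
      \<Phi> X = mat d d (\<lambda>(i, j). mat_trace (mat_adjoint (R i) * X * R j))"
  shows "completely_positive r d \<Phi>"
  unfolding completely_positive_def
proof (intro allI impI)
  fix k X assume X: "psd (k * r) X"
  have Xc: "X \<in> carrier_mat (k * r) (k * r)" by (rule psd_carrier[OF X])
  \<comment> \<open>\<open>T l\<close> is the tensor product of the \<open>k\<close>-dimensional
    identity with the r by d matrix whose i-th column is the l-th column of
    \<open>R i\<close>.\<close>
  define T where "T l = mat (k * r) (k * d)
    (\<lambda>(u, w). if u div r = w div d then R (w mod d) $$ (u mod r, l) else 0)" for l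
  have T: "T l \<in> carrier_mat (k * r) (k * d)" for l by (simp add: T_def)
  define F where "F l = mat_adjoint (T l) * X * T l" for l
  have F: "psd (k * d) (F l)" for l unfolding F_def by (rule psd_conjugation[OF X T])
  \<comment> \<open>Block diagonality of \<open>T l\<close>: of all blocks of the row index only the
    one numbered \<open>w div d\<close> contributes.\<close>
  have delta: "(\<Sum>u<k * r. T l $$ (u, w) * f u) = (\<Sum>a<r. R (w mod d) $$ (a, l) * f ((w div d) * r + a))"
    if w: "w < k * d" for w l and f :: "nat \<Rightarrow> complex"
  proof -
    have "(\<Sum>u<k * r. T l $$ (u, w) * f u) =
        (\<Sum>p<k. \<Sum>a<r. (if p = w div d then R (w mod d) $$ (a, l) else 0) * f (p * r + a))"
      unfolding sum_blocks using w by (intro sum.cong) (auto simp: T_def block_index_less)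
    also have "\<dots> = (\<Sum>p<k. if p = w div d then \<Sum>a<r. R (w mod d) $$ (a, l) * f (p * r + a) else 0)"
      by (intro sum.cong) auto
    also have "\<dots> = (\<Sum>a<r. R (w mod d) $$ (a, l) * f ((w div d) * r + a))"
      using block_index_div[OF w] by simp
    finally show ?thesis .
  qed
  have "ampliation k r d \<Phi> X = mat (k * d) (k * d) (\<lambda>ij. \<Sum>l<s. F l $$ ij)"
  proof (rule eq_matI)
    fix i j assume "i < dim_row (mat (k * d) (k * d) (\<lambda>ij. \<Sum>l<s. F l $$ ij))"
      "j < dim_col (mat (k * d) (k * d) (\<lambda>ij. \<Sum>l<s. F l $$ ij))"
    then have ij: "i < k * d" "j < k * d" by auto
    note dm = block_index_div[OF ij(1)] block_index_div[OF ij(2)]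
      block_index_mod[OF ij(1)] block_index_mod[OF ij(2)]
    let ?i = "i mod d" and ?j = "j mod d" and ?p = "i div d" and ?q = "j div d"
    let ?x = "\<lambda>a b. X $$ (?p * r + a, ?q * r + b)"
    have Fl: "F l $$ (i, j) =
      (\<Sum>b<r. R ?j $$ (b, l) * (\<Sum>a<r. cnj (R ?i $$ (a, l)) * ?x a b))" for l
    proof -
      have c: "mat_adjoint (T l) * X \<in> carrier_mat (k * d) (k * r)" using T Xc by (metis mat_adjoint_carrier mult_carrier_mat)
      have "F l $$ (i, j) = (\<Sum>w<k * r. (mat_adjoint (T l) * X) $$ (i, w) * T l $$ (w, j))"
        using ij T[of l] c unfolding F_def by (auto simp: scalar_prod_def atLeast0LessThan intro!: sum.cong)
      \<comment> \<open>The conjugation is moved outside the inner sum, so that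
        \<open>delta\<close>, stated for \<open>T l\<close> itself, evaluates both sums.\<close>
      also have "\<dots> = (\<Sum>w<k * r. T l $$ (w, j) * cnj (\<Sum>u<k * r. T l $$ (u, i) * cnj (X $$ (u, w))))"
        using ij T[of l] Xc by (auto simp: scalar_prod_def atLeast0LessThan mult.commute intro!: sum.cong)
      finally show ?thesis using ij by (simp add: delta)
    qed
    have "ampliation k r d \<Phi> X $$ (i, j) =
        mat_trace (mat_adjoint (R ?i) * (mat_block r X ?p ?q * R ?j))"
      using ij dm R[of ?i] R[of ?j] by (simp add: ampliation_def \<Phi> assoc_mult_mat[of _ s r _ r _ s])
    also have "\<dots> = (\<Sum>l<s. \<Sum>a<r. cnj (R ?i $$ (a, l)) * (\<Sum>b<r. ?x a b * R ?j $$ (b, l)))"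
      using R[of ?i] R[of ?j] dm
      by (subst mat_trace_mult[of _ s r], (auto intro!: mult_carrier_mat[of _ r r])[2], intro sum.cong)
        (auto simp: scalar_prod_def atLeast0LessThan mat_block_def intro!: sum.cong)
    also have "\<dots> = (\<Sum>l<s. F l $$ (i, j))"
      unfolding Fl sum_distrib_left by (subst (2) sum.swap) (simp add: mult_ac)
    finally show "ampliation k r d \<Phi> X $$ (i, j) = mat (k * d) (k * d) (\<lambda>ij. \<Sum>l<s. F l $$ ij) $$ (i, j)"
      using ij by simp
  qed (simp_all add: ampliation_def)
  then show "psd (k * d) (ampliation k r d \<Phi> X)" using psd_sum[of s "k * d" F] F by simp
qed

lemma completely_positive_add:
  assumes \<Phi>: "completely_positive n m \<Phi>" "\<And>X. X \<in> carrier_mat n n \<Longrightarrow> \<Phi> X \<in> carrier_mat m m"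
    and \<Psi>: "completely_positive n m \<Psi>" "\<And>X. X \<in> carrier_mat n n \<Longrightarrow> \<Psi> X \<in> carrier_mat m m"
  shows "completely_positive n m (\<lambda>X. \<Phi> X + \<Psi> X)"
  unfolding completely_positive_def
proof (intro allI impI)
  fix k X assume X: "psd (k * n) X"
  have "ampliation k n m (\<lambda>X. \<Phi> X + \<Psi> X) X = ampliation k n m \<Phi> X + ampliation k n m \<Psi> X"
    using carrier_matD[OF \<Phi>(2)[OF mat_block_carrier]] carrier_matD[OF \<Psi>(2)[OF mat_block_carrier]]
    by (intro eq_matI) (auto simp: ampliation_def block_index_mod)
  then show "psd (k * m) (ampliation k n m (\<lambda>X. \<Phi> X + \<Psi> X) X)"
    using \<Phi>(1) \<Psi>(1) X by (auto simp: completely_positive_def intro: psd_add)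
qed

text \<open>The summand with \<open>G\<close> collects the trace that the \<open>R\<^sub>i\<close> do not account for.\<close>

definition recovery_map ::
  "nat \<Rightarrow> (nat \<Rightarrow> complex mat) \<Rightarrow> complex mat \<Rightarrow> complex mat \<Rightarrow> complex mat" where
  "recovery_map d R G X = mat d d (\<lambda>(i, j). mat_trace (mat_adjoint (R i) * X * R j) +
     (if i = 0 \<and> j = 0 then mat_trace (mat_adjoint G * X * G) else 0))"

lemma mult_three_carrier:
  "A \<in> carrier_mat a b \<Longrightarrow> B \<in> carrier_mat b c \<Longrightarrow> C \<in> carrier_mat c d \<Longrightarrow> A * B * C \<in> carrier_mat a d"
  by (metis mult_carrier_mat)

text \<open>The Gram criterion is applied to each summand separately. The condition
  \<open>0 < d\<close> provides the entry (0, 0) that receives the remaining trace.\<close>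

lemma channel_recovery_map:
  assumes d: "0 < d" and R: "\<And>i. i < d \<Longrightarrow> R i \<in> carrier_mat r s" and G: "G \<in> carrier_mat r t"
    and tr: "\<And>X. X \<in> carrier_mat r r \<Longrightarrow>
      (\<Sum>i<d. mat_trace (mat_adjoint (R i) * X * R i)) + mat_trace (mat_adjoint G * X * G) = mat_trace X"
  shows "channel r d (recovery_map d R G)"
  unfolding channel_def
proof (intro conjI)
  have lin_add: "mat_trace (mat_adjoint A * (X + Y) * B) =
      mat_trace (mat_adjoint A * X * B) + mat_trace (mat_adjoint A * Y * B)"
    and lin_smult: "mat_trace (mat_adjoint A * (c \<cdot>\<^sub>m X) * B) = c * mat_trace (mat_adjoint A * X * B)"
    if "A \<in> carrier_mat r u" "B \<in> carrier_mat r u" "X \<in> carrier_mat r r" "Y \<in> carrier_mat r r"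
    for A B X Y c u
  proof -
    have A: "mat_adjoint A \<in> carrier_mat u r" using that by simp
    have AX: "mat_adjoint A * X \<in> carrier_mat u r" "mat_adjoint A * Y \<in> carrier_mat u r"
      using A that by (auto intro: mult_carrier_mat)
    show "mat_trace (mat_adjoint A * (X + Y) * B) =
      mat_trace (mat_adjoint A * X * B) + mat_trace (mat_adjoint A * Y * B)"
      using mult_add_distrib_mat[OF A that(3,4)] add_mult_distrib_mat[OF AX that(2)]
        mat_trace_add[OF mult_carrier_mat[OF AX(1) that(2)] mult_carrier_mat[OF AX(2) that(2)]] by simp
    show "mat_trace (mat_adjoint A * (c \<cdot>\<^sub>m X) * B) = c * mat_trace (mat_adjoint A * X * B)"
      using mult_smult_distrib[OF A that(3)] mult_smult_assoc_mat[OF AX(1) that(2)]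
        mat_trace_smult[OF mult_carrier_mat[OF AX(1) that(2)]] by simp
  qed
  show "linear_op_map r d (recovery_map d R G)"
    unfolding linear_op_map_def recovery_map_def
    by (auto intro!: eq_matI simp: lin_add[OF R R] lin_smult[OF R R] lin_add[OF G G] lin_smult[OF G G]
        algebra_simps)
  show "trace_preserving r (recovery_map d R G)"
    unfolding trace_preserving_def
  proof
    fix X :: "complex mat" assume X: "X \<in> carrier_mat r r"
    have "mat_trace (recovery_map d R G X) =
        (\<Sum>i<d. mat_trace (mat_adjoint (R i) * X * R i)) +
        (\<Sum>i<d. if i = 0 then mat_trace (mat_adjoint G * X * G) else 0)"
      by (simp add: recovery_map_def mat_trace_def[of "mat d d _"] sum.distrib)
    also have "\<dots> = mat_trace X" using d tr[OF X] by simp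
    finally show "mat_trace (recovery_map d R G X) = mat_trace X" .
  qed
  \<comment> \<open>The correction term in Gram form: all operators but the one with index 0 are
    zero.\<close>
  define G' where "G' i = (if i = 0 then G else 0\<^sub>m r t)" for i :: nat
  have G': "G' i \<in> carrier_mat r t" for i using G by (simp add: G'_def)
  let ?g = "\<lambda>R X. mat d d (\<lambda>(i, j). mat_trace (mat_adjoint (R i) * X * R j))"
  have "completely_positive r d (\<lambda>X. ?g R X + ?g G' X)"
    by (intro completely_positive_add completely_positive_gram[of d R r s] completely_positive_gram[of d G' r t])
      (auto simp: R G')
  moreover have "ampliation k r d (\<lambda>X. ?g R X + ?g G' X) X = ampliation k r d (recovery_map d R G) X" for k X
  proof -
    have "?g R X + ?g G' X = recovery_map d R G X" if X: "X \<in> carrier_mat r r" for X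
    proof -
      have "mat_trace (mat_adjoint (G' i) * X * G' j) =
          (if i = 0 \<and> j = 0 then mat_trace (mat_adjoint G * X * G) else 0)" for i j
      proof -
        have "mat_adjoint G * X \<in> carrier_mat t r" using G X by (metis mat_adjoint_carrier mult_carrier_mat)
        then show ?thesis using G X
          by (auto simp: G'_def right_mult_zero_mat[of _ t r t] left_mult_zero_mat[of _ r r t] left_mult_zero_mat[of _ r t t])
      qed
      then show ?thesis by (intro eq_matI) (auto simp: recovery_map_def)
    qed
    then show ?thesis by (auto simp: ampliation_def)
  qed
  ultimately show "completely_positive r d (recovery_map d R G)"
    by (simp add: completely_positive_def)
qed

lemma channel_isometry:
  assumes d: "0 < n" and W: "W \<in> carrier_mat n d" and WW: "mat_adjoint W * W = 1\<^sub>m d"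
  shows "channel d n (\<lambda>X. W * X * mat_adjoint W)"
  unfolding channel_def
proof (intro conjI)
  note W' = mat_adjoint_carrier[OF W]
  show "linear_op_map d n (\<lambda>X. W * X * mat_adjoint W)"
    unfolding linear_op_map_def
  proof (intro conjI ballI allI)
    fix X Y :: "complex mat" and c assume X: "X \<in> carrier_mat d d" and Y: "Y \<in> carrier_mat d d"
    note WX = mult_carrier_mat[OF W X] mult_carrier_mat[OF W Y]
    show "W * (X + Y) * mat_adjoint W = W * X * mat_adjoint W + W * Y * mat_adjoint W"
      by (simp add: mult_add_distrib_mat[OF W X Y] add_mult_distrib_mat[OF WX W'])
  next
    fix X :: "complex mat" and c assume X: "X \<in> carrier_mat d d"
    note WX = mult_carrier_mat[OF W X]
    show "W * X * mat_adjoint W \<in> carrier_mat n n" using mult_carrier_mat[OF WX W'] .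
    show "W * (c \<cdot>\<^sub>m X) * mat_adjoint W = c \<cdot>\<^sub>m (W * X * mat_adjoint W)"
      by (simp add: mult_smult_distrib[OF W X] mult_smult_assoc_mat[OF WX W'])
  qed
  show "trace_preserving d (\<lambda>X. W * X * mat_adjoint W)"
    unfolding trace_preserving_def
  proof
    fix X :: "complex mat" assume X: "X \<in> carrier_mat d d"
    show "mat_trace (W * X * mat_adjoint W) = mat_trace X"
      using mat_trace_comm[OF mult_carrier_mat[OF W X] W'] assoc_mult_mat[OF W' W X] WW X by simp
  qed
  \<comment> \<open>\<open>R j\<close> is the j-th column of \<open>mat_adjoint W\<close>, so the
    entry (i, j) of the conjugated matrix is the trace of a 1 by 1 matrix of Gram type.\<close>
  define R where "R j = mat d 1 (\<lambda>(a, _). cnj (W $$ (j, a)))" for j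
  have R: "R j \<in> carrier_mat d 1" for j by (simp add: R_def)
  show "completely_positive d n (\<lambda>X. W * X * mat_adjoint W)"
  proof (rule completely_positive_gram[of n R d 1])
    fix X :: "complex mat" assume X: "X \<in> carrier_mat d d"
    show "W * X * mat_adjoint W = mat n n (\<lambda>(i, j). mat_trace (mat_adjoint (R i) * X * R j))"
    proof (rule eq_matI)
      fix i j assume "i < dim_row (mat n n (\<lambda>(i, j). mat_trace (mat_adjoint (R i) * X * R j)))"
        "j < dim_col (mat n n (\<lambda>(i, j). mat_trace (mat_adjoint (R i) * X * R j)))"
      then show "(W * X * mat_adjoint W) $$ (i, j) =
          mat n n (\<lambda>(i, j). mat_trace (mat_adjoint (R i) * X * R j)) $$ (i, j)"
        using W X by (auto simp: scalar_prod_def mat_trace_def R_def intro!: sum.cong)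
    qed (use W in auto)
  qed (rule R)
qed

section \<open>Zero-error codes\<close>

lemma mult_unit_vec:
  fixes A :: "complex mat"
  assumes "A \<in> carrier_mat n m" "j < m"
  shows "A *\<^sub>v unit_vec m j = col A j"
  by (rule eq_vecI) (use assms in auto)

lemma zero_mult_vec: "v \<in> carrier_vec m \<Longrightarrow> 0\<^sub>m n m *\<^sub>v v = (0\<^sub>v n :: complex vec)"
  by (rule eq_vecI) auto

lemma cscalar_prod_commute_zero:
  fixes v w :: "complex vec"
  assumes "v \<in> carrier_vec n" "w \<in> carrier_vec n" "v \<bullet>c w = 0"
  shows "w \<bullet>c v = 0"
  using assms conjugate_conjugate_sprod[of v n w] conjugate_vec_sprod_comm[of w n v] by simp

text \<open>A self-adjoint matrix has its range in its support, and the entries of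
  \<open>B * A\<close> are inner products of columns of \<open>A\<close> and \<open>B\<close>.
  Conversely, for \<open>v\<close> in the support of \<open>A\<close> put \<open>x = B v\<close>.
  Then \<open>B x\<close> lies in the kernel of \<open>A\<close>, so \<open>v\<close> is orthogonal
  to it, which says that \<open>x\<close> is orthogonal to itself. Hence \<open>v\<close> lies in
  the kernel of \<open>B\<close>.\<close>

lemma orthogonal_supports_iff:
  assumes A: "A \<in> carrier_mat m m" "mat_adjoint A = A" and B: "B \<in> carrier_mat m m" "mat_adjoint B = B"
  shows "orthogonal_supports m A B \<longleftrightarrow> A * B = 0\<^sub>m m m"
proof
  assume orth: "orthogonal_supports m A B"
  have supp: "X *\<^sub>v x \<in> op_support m X"
    if X: "X \<in> carrier_mat m m" "mat_adjoint X = X" and x: "x \<in> carrier_vec m" for X x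
    using X x by (auto simp: op_support_def mult_mat_vec_adjoint[OF X(1)])
  have "B * A = 0\<^sub>m m m"
  proof (rule eq_matI)
    fix i j assume "i < dim_row (0\<^sub>m m m :: complex mat)" "j < dim_col (0\<^sub>m m m :: complex mat)"
    then have ij: "i < m" "j < m" by auto
    have "(A *\<^sub>v unit_vec m j) \<bullet>c (B *\<^sub>v unit_vec m i) = 0"
      using orth supp[OF A, of "unit_vec m j"] supp[OF B, of "unit_vec m i"] by (simp add: orthogonal_supports_def)
    then show "(B * A) $$ (i, j) = 0\<^sub>m m m $$ (i, j)"
      using adjoint_mult_cols[OF B(1) A(1) ij] ij unfolding B(2) mult_unit_vec[OF A(1) ij(2)] mult_unit_vec[OF B(1) ij(1)]
      by simp
  qed (use A B in auto)
  then have "mat_adjoint (B * A) = 0\<^sub>m m m" by simp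
  then show "A * B = 0\<^sub>m m m" using A B by (simp add: square_simps[where n = m])
next
  assume AB: "A * B = 0\<^sub>m m m"
  show "orthogonal_supports m A B"
    unfolding orthogonal_supports_def
  proof (intro ballI)
    fix v w assume vA: "v \<in> op_support m A" and wB: "w \<in> op_support m B"
    then have v: "v \<in> carrier_vec m" and w: "w \<in> carrier_vec m" by (auto simp: op_support_def)
    define x where "x = B *\<^sub>v v"
    have x: "x \<in> carrier_vec m" using B v by (auto simp: x_def)
    have "A *\<^sub>v (B *\<^sub>v x) = 0\<^sub>v m"
      using x assoc_mult_mat_vec[OF A(1) B(1) x] by (simp add: AB zero_mult_vec)
    then have "v \<bullet>c (B *\<^sub>v x) = 0"
      using vA B x by (auto simp: op_support_def)
    then have "x \<bullet>c x = 0"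
      using mult_mat_vec_adjoint[OF B(1) v x] by (simp add: B(2) x_def)
    then have "B *\<^sub>v v = 0\<^sub>v m" using x by (simp add: x_def)
    then have "w \<bullet>c v = 0" using wB v by (auto simp: op_support_def)
    then show "v \<bullet>c w = 0" by (rule cscalar_prod_commute_zero[OF w v])
  qed
qed

text \<open>The condition under the \<open>Max\<close> in the classical capacity.\<close>

definition zero_error_code :: "nat \<Rightarrow> nat \<Rightarrow> (complex mat \<Rightarrow> complex mat) \<Rightarrow> nat \<Rightarrow> bool" where
  "zero_error_code n m \<Phi> M \<longleftrightarrow> (\<exists>\<rho>. (\<forall>i<M. state n (\<rho> i)) \<and>
     (\<forall>i<M. \<forall>j<M. i \<noteq> j \<longrightarrow> orthogonal_supports m (\<Phi> (\<rho> i)) (\<Phi> (\<rho> j))))"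

text \<open>The test \<open>G\<close> accepts \<sigma> surely and \<tau> never. Hence
  \<open>1 - G\<close> against \<sigma> and \<open>G\<close> against \<tau> are pairs of positive
  operators with trace zero, whose products vanish. Inserting \<open>G\<close> between \<tau> and
  \<sigma> then gives the last claim.\<close>

lemma test_operators_orthogonal:
  assumes G: "psd n G" "psd n (1\<^sub>m n - G)" and \<sigma>: "state n \<sigma>" and \<tau>: "psd n \<tau>"
    and tr: "mat_trace (G * \<sigma>) = 1" "mat_trace (G * \<tau>) = 0"
  shows "G * \<sigma> = \<sigma>" "G * \<tau> = 0\<^sub>m n n" "\<tau> * \<sigma> = 0\<^sub>m n n"
proof -
  have c [simp]: "G \<in> carrier_mat n n" "\<sigma> \<in> carrier_mat n n" "\<tau> \<in> carrier_mat n n"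
    using G \<sigma> \<tau> by (auto simp: state_def psd_carrier)
  have \<sigma>': "psd n \<sigma>" "mat_trace \<sigma> = 1" using \<sigma> by (auto simp: state_def)
  have eq: "(1\<^sub>m n - G) * \<sigma> = \<sigma> - G * \<sigma>" by (simp add: square_simps[where n = n])
  have "(1\<^sub>m n - G) * \<sigma> = 0\<^sub>m n n"
    by (rule psd_trace_mult_eq_0[OF G(2) \<sigma>'(1)])
      (simp add: eq mat_trace_minus[of _ n] \<sigma>'(2) tr)
  then have *: "\<sigma> - G * \<sigma> = 0\<^sub>m n n" by (simp add: eq)
  show G\<sigma>: "G * \<sigma> = \<sigma>"
  proof (rule eq_matI)
    fix i j assume "i < dim_row \<sigma>" "j < dim_col \<sigma>"
    then have ij: "i < n" "j < n" using c(2) by auto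
    have "(\<sigma> - G * \<sigma>) $$ (i, j) = 0" unfolding * using ij by simp
    then show "(G * \<sigma>) $$ (i, j) = \<sigma> $$ (i, j)" using ij carrier_matD[OF c(1)] carrier_matD[OF c(2)] by simp
  qed (use carrier_matD[OF c(1)] carrier_matD[OF c(2)] in auto)
  show G\<tau>: "G * \<tau> = 0\<^sub>m n n" by (rule psd_trace_mult_eq_0[OF G(1) \<tau> tr(2)])
  have "\<tau> * \<sigma> = \<tau> * (G * \<sigma>)" by (simp add: G\<sigma>)
  also have "\<dots> = (\<tau> * G) * \<sigma>" by (simp add: assoc_mult_square[of _ n])
  also have "\<tau> * G = mat_adjoint (G * \<tau>)"
    using psd_hermitian[OF G(1)] psd_hermitian[OF \<tau>] by (simp add: square_simps[where n = n])
  finally show "\<tau> * \<sigma> = 0\<^sub>m n n" by (simp add: G\<tau> square_simps[where n = n])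
qed

text \<open>A code is certified by outcome statistics alone. The tests are not assumed to form one
  joint measurement, since each pair of outputs is separated by a single test.\<close>

lemma zero_error_codeI:
  assumes ch: "channel n m \<Phi>" and \<rho>: "\<And>i. i < M \<Longrightarrow> state n (\<rho> i)"
    and G: "\<And>i. i < M \<Longrightarrow> psd m (G i)" "\<And>i. i < M \<Longrightarrow> psd m (1\<^sub>m m - G i)"
    and tr: "\<And>i j. i < M \<Longrightarrow> j < M \<Longrightarrow> mat_trace (G i * \<Phi> (\<rho> j)) = (if i = j then 1 else 0)"
  shows "zero_error_code n m \<Phi> M"
  unfolding zero_error_code_def
proof (intro exI[of _ \<rho>] conjI allI impI)
  fix i j assume ij: "i < M" "j < M" "i \<noteq> j"
  note \<sigma> = channel_state[OF ch \<rho>]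
  have psd: "psd m (\<Phi> (\<rho> i))" "psd m (\<Phi> (\<rho> j))" using \<sigma>[OF ij(1)] \<sigma>[OF ij(2)] by (auto simp: state_def)
  have "\<Phi> (\<rho> i) * \<Phi> (\<rho> j) = 0\<^sub>m m m"
    by (rule test_operators_orthogonal(3)[OF G(1)[OF ij(2)] G(2)[OF ij(2)] \<sigma>[OF ij(2)] psd(1)])
      (use ij tr in auto)
  then show "orthogonal_supports m (\<Phi> (\<rho> i)) (\<Phi> (\<rho> j))"
    using psd by (subst orthogonal_supports_iff) (auto simp: psd_carrier psd_hermitian)
qed (use \<rho> in auto)

lemma zero_error_codeE:
  assumes ch: "channel n m \<Phi>" and code: "zero_error_code n m \<Phi> M"
  obtains \<rho> where "\<forall>i<M. state n (\<rho> i)" "\<forall>i<M. state m (\<Phi> (\<rho> i))"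
    "\<forall>i<M. \<forall>j<M. i \<noteq> j \<longrightarrow> \<Phi> (\<rho> i) * \<Phi> (\<rho> j) = 0\<^sub>m m m"
proof -
  obtain \<rho> where \<rho>: "\<And>i. i < M \<Longrightarrow> state n (\<rho> i)"
    and o: "\<And>i j. i < M \<Longrightarrow> j < M \<Longrightarrow> i \<noteq> j \<Longrightarrow> orthogonal_supports m (\<Phi> (\<rho> i)) (\<Phi> (\<rho> j))"
    using code unfolding zero_error_code_def by blast
  have \<sigma>: "state m (\<Phi> (\<rho> i))" if "i < M" for i by (rule channel_state[OF ch \<rho>[OF that]])
  have "\<Phi> (\<rho> i) * \<Phi> (\<rho> j) = 0\<^sub>m m m" if "i < M" "j < M" "i \<noteq> j" for i j
    using o[OF that] \<sigma>[OF that(1)] \<sigma>[OF that(2)]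
    by (subst (asm) orthogonal_supports_iff) (auto simp: psd_carrier psd_hermitian state_def)
  then show ?thesis using \<rho> \<sigma> by (intro that[of \<rho>]) auto
qed

section \<open>Isometries and the size of codes\<close>

lemma complement_projection:
  fixes q :: "complex mat"
  assumes q: "q \<in> carrier_mat n n" and qq: "q * q = q"
  shows "(1\<^sub>m n - q) * (1\<^sub>m n - q) = 1\<^sub>m n - q"
proof -
  have "(1\<^sub>m n - q) * (1\<^sub>m n - q) = (1\<^sub>m n - q) - (q - q)"
    using q by (simp add: square_simps[where n = n] minus_carrier_mat qq)
  also have "\<dots> = 1\<^sub>m n - q" using q by (intro eq_matI) auto
  finally show ?thesis .
qed

lemma psd_one_minus_projection:
  assumes "q \<in> carrier_mat n n" "mat_adjoint q = q" "q * q = q"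
  shows "psd n (1\<^sub>m n - q)"
  by (rule psd_projection[OF minus_carrier_mat[OF assms(1)] _ complement_projection[OF assms(1,3)]])
    (use assms in \<open>simp add: square_simps[where n = n]\<close>)

text \<open>The range projection has trace \<open>k\<close> by cyclicity, and its complement is
  positive, so \<open>k\<close> is at most the trace of the identity.\<close>

lemma isometry_le:
  fixes V :: "complex mat"
  assumes V: "V \<in> carrier_mat n k" and VV: "mat_adjoint V * V = 1\<^sub>m k"
  shows "k \<le> n"
proof -
  let ?P = "V * mat_adjoint V"
  note V' = mat_adjoint_carrier[OF V]
  have P: "?P \<in> carrier_mat n n" by (rule mult_carrier_mat[OF V V'])
  have PP: "?P * ?P = ?P"
    using assoc_mult_mat[OF V V' P] assoc_mult_mat[OF V' V V'] by (simp add: VV left_mult_one_mat[OF V'])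
  have P_adj: "mat_adjoint ?P = ?P" using mat_adjoint_mult[OF V V'] by simp
  have "psd n (1\<^sub>m n - ?P)"
    by (rule psd_one_minus_projection[OF P P_adj PP])
  then have "0 \<le> mat_trace (1\<^sub>m n - ?P)"
    using psd_diag_nonneg[of n "1\<^sub>m n - ?P"] P unfolding mat_trace_def by (auto intro!: sum_nonneg)
  also have "mat_trace (1\<^sub>m n - ?P) = of_nat n - of_nat k"
    using mat_trace_comm[OF V V'] P by (simp add: mat_trace_minus[of _ n] VV)
  finally show ?thesis by (simp add: less_eq_complex_def)
qed

text \<open>Each \<open>X i\<close> has a nonzero column, which can be normalized, and vanishing
  products of self-adjoint matrices mean orthogonal ranges. The lemma bounds the size of codes,
  supplies the initial vector of the qubit code, and selects the vectors that carry the classical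
  algebra.\<close>

lemma orthonormal_range_vectors:
  fixes X :: "nat \<Rightarrow> complex mat"
  assumes X: "\<And>i. i < M \<Longrightarrow> X i \<in> carrier_mat n n" "\<And>i. i < M \<Longrightarrow> mat_adjoint (X i) = X i"
    "\<And>i. i < M \<Longrightarrow> X i \<noteq> 0\<^sub>m n n"
    and orth: "\<And>i j. i < M \<Longrightarrow> j < M \<Longrightarrow> i \<noteq> j \<Longrightarrow> X i * X j = 0\<^sub>m n n"
  shows "\<exists>V\<in>carrier_mat n M. mat_adjoint V * V = 1\<^sub>m M \<and>
    (\<forall>i<M. \<exists>x\<in>carrier_vec n. col V i = X i *\<^sub>v x)"
proof -
  have "\<exists>x\<in>carrier_vec n. (X i *\<^sub>v x) \<bullet>c (X i *\<^sub>v x) = 1" if i: "i < M" for i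
  proof -
    obtain a b where ab: "a < n" "b < n" "X i $$ (a, b) \<noteq> 0"
      using X(1,3)[OF i] by (metis carrier_matD eq_matI index_zero_mat)
    define u where "u = X i *\<^sub>v unit_vec n b"
    have u: "u \<in> carrier_vec n" using X(1)[OF i] by (auto simp: u_def)
    have "u $ a = X i $$ (a, b)" using X(1)[OF i] ab by (simp add: u_def mult_unit_vec)
    then have "u \<noteq> 0\<^sub>v n" using ab by auto
    then have "0 < u \<bullet>c u" using u by simp
    then obtain t where t: "0 < t" "u \<bullet>c u = of_real t"
      by (metis less_complex_def complex_eq_iff Re_complex_of_real Im_complex_of_real zero_complex.simps)
    define c where "c = complex_of_real (1 / sqrt t)"
    have "X i *\<^sub>v (c \<cdot>\<^sub>v unit_vec n b) = c \<cdot>\<^sub>v u"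
      using X(1)[OF i] by (simp add: u_def mult_mat_vec[of _ n n])
    moreover have "(c \<cdot>\<^sub>v u) \<bullet>c (c \<cdot>\<^sub>v u) = c * cnj c * (u \<bullet>c u)"
      using u by (simp add: conjugate_smult_vec smult_scalar_prod_distrib[of _ n] scalar_prod_smult_distrib[of _ n])
    moreover have "c * cnj c * (u \<bullet>c u) = 1"
      using t by (simp add: c_def t(2) flip: of_real_mult)
    ultimately show ?thesis by (intro bexI[of _ "c \<cdot>\<^sub>v unit_vec n b"]) auto
  qed
  then obtain x where x: "\<And>i. i < M \<Longrightarrow> x i \<in> carrier_vec n"
    "\<And>i. i < M \<Longrightarrow> (X i *\<^sub>v x i) \<bullet>c (X i *\<^sub>v x i) = 1" by metis
  define V where "V = mat_of_cols n (map (\<lambda>i. X i *\<^sub>v x i) [0..<M])"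
  have V: "V \<in> carrier_mat n M" by (intro carrier_matI) (simp_all add: V_def)
  have Xx: "X i *\<^sub>v x i \<in> carrier_vec n" if "i < M" for i
    using X(1) x(1) that by (metis mult_mat_vec_carrier)
  have col: "col V i = X i *\<^sub>v x i" if "i < M" for i
    using that Xx[OF that] by (simp add: V_def)
  have "mat_adjoint V * V = 1\<^sub>m M"
  proof (rule eq_matI)
    fix i j assume "i < dim_row (1\<^sub>m M :: complex mat)" "j < dim_col (1\<^sub>m M :: complex mat)"
    then have ij: "i < M" "j < M" by auto
    have e: "(mat_adjoint V * V) $$ (i, j) = (X j *\<^sub>v x j) \<bullet>c (X i *\<^sub>v x i)"
      using adjoint_mult_cols[OF V V ij] col ij by simp
    show "(mat_adjoint V * V) $$ (i, j) = 1\<^sub>m M $$ (i, j)"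
    proof (cases "i = j")
      case True then show ?thesis using e x(2) ij by simp
    next
      case False
      have "(X j *\<^sub>v x j) \<bullet>c (X i *\<^sub>v x i) = x j \<bullet>c (X j *\<^sub>v (X i *\<^sub>v x i))"
        using mult_mat_vec_adjoint[OF X(1)[OF ij(2)] x(1)[OF ij(2)] Xx[OF ij(1)]] X(2)[OF ij(2)] by simp
      also have "X j *\<^sub>v (X i *\<^sub>v x i) = (X j * X i) *\<^sub>v x i"
        using X(1) x(1) ij by (simp add: assoc_mult_mat_vec[of _ n n _ n])
      also have "\<dots> = 0\<^sub>v n" using orth ij False x(1)[OF ij(1)] by auto
      finally show ?thesis using e False ij x(1) by simp
    qed
  qed (use V in auto)
  then show ?thesis using V col x(1) by blast
qed

lemma state_nonzero: "state n \<rho> \<Longrightarrow> \<rho> \<noteq> 0\<^sub>m n n"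
  by (auto simp: state_def)

lemma zero_error_code_le:
  assumes ch: "channel n m \<Phi>" and code: "zero_error_code n m \<Phi> M"
  shows "M \<le> m"
proof -
  obtain \<rho> where states: "\<forall>i<M. state n (\<rho> i)" "\<forall>i<M. state m (\<Phi> (\<rho> i))"
    "\<forall>i<M. \<forall>j<M. i \<noteq> j \<longrightarrow> \<Phi> (\<rho> i) * \<Phi> (\<rho> j) = 0\<^sub>m m m"
    by (rule zero_error_codeE[OF ch code])
  note \<sigma> = states(2,3)[rule_format]
  have psd: "psd m (\<Phi> (\<rho> i))" if "i < M" for i using \<sigma>(1)[OF that] by (simp add: state_def)
  have "\<exists>V\<in>carrier_mat m M. mat_adjoint V * V = 1\<^sub>m M \<and>
      (\<forall>i<M. \<exists>x\<in>carrier_vec m. col V i = \<Phi> (\<rho> i) *\<^sub>v x)"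
    by (rule orthonormal_range_vectors;
      rule psd_carrier[OF psd] psd_hermitian[OF psd] state_nonzero[OF \<sigma>(1)] \<sigma>(2))
  then show ?thesis using isometry_le by (elim bexE conjE)
qed

lemma unit_mat_projection:
  assumes "i < d"
  shows "mat_adjoint (unit_mat d i i) = unit_mat d i i"
    "unit_mat d i i * unit_mat d i i = unit_mat d i i"
    "mat_trace (unit_mat d i i) = 1"
    "j < d \<Longrightarrow> i \<noteq> j \<Longrightarrow> unit_mat d i i * unit_mat d j j = 0\<^sub>m d d"
proof -
  have u: "unit_mat d i i = mat_diag d (\<lambda>a. if a = i then 1 else 0)" for i
    by (rule eq_matI) (auto simp: unit_mat_def mat_diag_def)
  show "mat_adjoint (unit_mat d i i) = unit_mat d i i"
    by (rule eq_matI) (auto simp: unit_mat_def)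
  show "unit_mat d i i * unit_mat d i i = unit_mat d i i"
    by (simp add: u if_distrib cong: if_cong)
  show "mat_trace (unit_mat d i i) = 1"
    using assms by (simp add: u mat_trace_def mat_diag_def)
  show "unit_mat d i i * unit_mat d j j = 0\<^sub>m d d" if "j < d" "i \<noteq> j"
    using that unfolding u mat_diag_diag by (auto simp: mat_diag_def intro!: eq_matI)
qed

lemma state_unit_mat: "i < d \<Longrightarrow> state d (unit_mat d i i)"
  by (simp add: state_def unit_mat_projection psd_projection)

text \<open>The adjoint of a channel is positive and unital, so a projection becomes a test between
  0 and 1, in general no longer a projection.\<close>

lemma map_adjoint_test_operator:
  assumes ch: "channel m r \<D>" and q: "q \<in> carrier_mat r r" "mat_adjoint q = q" "q * q = q"
  shows "psd m (map_adjoint m r \<D> q)" "psd m (1\<^sub>m m - map_adjoint m r \<D> q)"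
proof -
  show "psd m (map_adjoint m r \<D> q)" by (rule map_adjoint_psd[OF ch psd_projection[OF q]])
  have "1\<^sub>m m - map_adjoint m r \<D> q = map_adjoint m r \<D> (1\<^sub>m r - q)"
    using map_adjoint_minus[OF channel_linear[OF ch], of "1\<^sub>m r" q] q by (simp add: map_adjoint_one[OF ch])
  then show "psd m (1\<^sub>m m - map_adjoint m r \<D> q)"
    using map_adjoint_psd[OF ch psd_one_minus_projection[OF q]] by simp
qed

text \<open>Basis states are encoded, and the projections onto them, pulled back through the
  decoder, tell the outputs apart. This bounds the dimension of quantum codes by that of classical
  ones.\<close>

lemma quantum_code_zero_error_code:
  assumes ch: "channel n m \<Phi>" "channel d n \<E>" "channel m d \<D>"
    and id: "\<And>X. X \<in> carrier_mat d d \<Longrightarrow> \<D> (\<Phi> (\<E> X)) = X"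
  shows "zero_error_code n m \<Phi> d"
proof (rule zero_error_codeI[OF ch(1)])
  let ?G = "\<lambda>i. map_adjoint m d \<D> (unit_mat d i i)"
  fix i assume i: "i < d"
  show "state n (\<E> (unit_mat d i i))" by (rule channel_state[OF ch(2) state_unit_mat[OF i]])
  show "psd m (?G i)" "psd m (1\<^sub>m m - ?G i)"
    using map_adjoint_test_operator[OF ch(3)] unit_mat_projection[OF i] by auto
  fix j assume j: "j < d"
  have "mat_trace (?G i * \<Phi> (\<E> (unit_mat d j j))) = mat_trace (unit_mat d i i * \<D> (\<Phi> (\<E> (unit_mat d j j))))"
    by (intro map_adjoint_trace channel_linear ch channel_carrier[OF ch(1)] channel_carrier[OF ch(2)]) auto
  then show "mat_trace (?G i * \<Phi> (\<E> (unit_mat d j j))) = (if i = j then 1 else 0)"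
    using i j by (simp add: id unit_mat_projection)
qed

lemma no_quantum_code:
  assumes ch: "channel n m \<Phi>" and Q: "zero_error_quantum_capacity n m \<Phi> = 0"
    and d: "2 \<le> d" and \<E>: "channel d n \<E>" and \<D>: "channel m d \<D>"
    and id: "\<And>X. X \<in> carrier_mat d d \<Longrightarrow> \<D> (\<Phi> (\<E> X)) = X"
  shows False
proof -
  define K where "K = {d. \<exists>\<E> \<D>. channel d n \<E> \<and> channel m d \<D> \<and> (\<forall>X\<in>carrier_mat d d. \<D> (\<Phi> (\<E> X)) = X)}"
  \<comment> \<open>\<open>Max\<close> bounds the members of \<open>K\<close> only if
    \<open>K\<close> is finite.\<close>
  have "K \<subseteq> {..m}"
    using quantum_code_zero_error_code[OF ch] zero_error_code_le[OF ch] unfolding K_def by blast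
  then have "finite K" by (rule finite_subset) simp
  moreover have "d \<in> K" using \<E> \<D> id unfolding K_def by blast
  ultimately have "2 \<le> Max K" using d by (meson Max_ge le_trans)
  then have "0 < log 2 (real (Max K))" by (subst zero_less_log_cancel_iff) auto
  then show False using Q unfolding zero_error_quantum_capacity_def K_def by simp
qed

lemma zero_error_code_max:
  assumes ch: "channel n m \<Phi>" and n: "0 < n"
  obtains N where "0 < N" "zero_error_code n m \<Phi> N" "\<And>M. zero_error_code n m \<Phi> M \<Longrightarrow> M \<le> N"
    "real N = 2 powr zero_error_classical_capacity n m \<Phi>"
proof -
  define K where "K = {M. zero_error_code n m \<Phi> M}"
  have "K \<subseteq> {..m}" using zero_error_code_le[OF ch] unfolding K_def by blast
  then have fin: "finite K" by (rule finite_subset) simp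
  \<comment> \<open>A single state is vacuously a code. Hence the maximum is positive and
    \<open>2 powr\<close> undoes the logarithm.\<close>
  have one: "1 \<in> K" using state_unit_mat[OF n] by (auto simp: K_def zero_error_code_def)
  then have "Max K \<in> K" "1 \<le> Max K" using fin Max_in Max_ge by auto
  moreover have "real (Max K) = 2 powr zero_error_classical_capacity n m \<Phi>"
    using \<open>1 \<le> Max K\<close> by (simp add: zero_error_classical_capacity_def K_def zero_error_code_def)
  ultimately show ?thesis using that[of "Max K"] Max_ge[OF fin] by (auto simp: K_def)
qed

section \<open>Correctable algebras\<close>

lemma mat_trace_sandwich:
  assumes A: "A \<in> carrier_mat r s" and B: "B \<in> carrier_mat r s" and X: "X \<in> carrier_mat r r"
  shows "mat_trace (mat_adjoint A * X * B) = mat_trace (B * mat_adjoint A * X)"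
proof -
  note A' = mat_adjoint_carrier[OF A]
  have "mat_trace (mat_adjoint A * X * B) = mat_trace (B * (mat_adjoint A * X))"
    by (rule mat_trace_comm[OF mult_carrier_mat[OF A' X] B])
  then show ?thesis by (simp add: assoc_mult_mat[OF B A' X])
qed

lemma psd_smult:
  assumes psd: "psd n A" and c: "0 \<le> c"
  shows "psd n (c \<cdot>\<^sub>m A)"
  unfolding psd_def
proof (intro conjI ballI)
  have A: "A \<in> carrier_mat n n" using psd by (rule psd_carrier)
  then show "c \<cdot>\<^sub>m A \<in> carrier_mat n n" by simp
  fix v :: "complex vec" assume v: "v \<in> carrier_vec n"
  have Av: "A *\<^sub>v v \<in> carrier_vec n" using A v by (rule mult_mat_vec_carrier)
  have "(c \<cdot>\<^sub>m A) *\<^sub>v v = c \<cdot>\<^sub>v (A *\<^sub>v v)" using A v by (intro eq_vecI) auto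
  then have "((c \<cdot>\<^sub>m A) *\<^sub>v v) \<bullet>c v = c * ((A *\<^sub>v v) \<bullet>c v)"
    using Av v by (simp add: smult_scalar_prod_distrib[of _ n])
  then show "0 \<le> ((c \<cdot>\<^sub>m A) *\<^sub>v v) \<bullet>c v" using psd v c by (simp add: psd_def)
qed

lemma mat_trace_projection_pos:
  assumes p: "p \<in> carrier_mat n n" "mat_adjoint p = p" "p * p = p" "p \<noteq> 0\<^sub>m n n"
  shows "0 < mat_trace p"
  using mat_trace_mult_adjoint_nonneg[OF p(1)] mat_trace_mult_adjoint_eq_0[OF p(1)] p
  by (auto simp: order_less_le)

lemma state_normalized_projection:
  assumes p: "p \<in> carrier_mat n n" "mat_adjoint p = p" "p * p = p" "p \<noteq> 0\<^sub>m n n"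
  shows "state n (inverse (mat_trace p) \<cdot>\<^sub>m p)"
proof -
  have t: "0 < mat_trace p" by (rule mat_trace_projection_pos[OF p])
  then have "0 \<le> inverse (mat_trace p)"
    by (auto simp: less_complex_def less_eq_complex_def complex_eq_iff)
  then show ?thesis using p t
    by (auto simp: state_def mat_trace_smult[of _ n] intro!: psd_smult psd_projection)
qed

text \<open>From the Heisenberg to the Schroedinger picture: the fixed-point condition on
  observables becomes equality of expectations before and after transmission and recovery. A matrix
  \<rho> with \<open>P * \<rho> * P = \<rho>\<close> is the image under \<open>V\<close> of its own
  compression, so the condition on the code space applies to it.\<close>

lemma correctableE:
  assumes n: "0 < n" and ch: "channel n m \<Phi>" and corr: "correctable n m \<Phi> S"
  obtains P r V \<D> where "star_subalgebra n S" "P \<in> S" "\<forall>X\<in>S. P * X = X \<and> X * P = X"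
    "V \<in> carrier_mat n r" "V * mat_adjoint V = P" "channel m r \<D>"
    "\<forall>X\<in>S. \<forall>\<rho>\<in>carrier_mat n n. P * \<rho> * P = \<rho> \<longrightarrow>
      mat_trace ((mat_adjoint V * X * V) * \<D> (\<Phi> \<rho>)) = mat_trace (X * \<rho>)"
proof -
  from corr obtain P r V \<D> where S: "star_subalgebra n S" and P: "P \<in> S"
    and unit: "\<And>X. X \<in> S \<Longrightarrow> P * X = X" "\<And>X. X \<in> S \<Longrightarrow> X * P = X"
    and V: "V \<in> carrier_mat n r" and VV: "mat_adjoint V * V = 1\<^sub>m r" and VP: "V * mat_adjoint V = P"
    and \<D>: "channel m r \<D>"
    and adj: "\<And>X. X \<in> S \<Longrightarrow> map_adjoint r r (\<D> \<circ> restrict_code \<Phi> V) (mat_adjoint V * X * V) = mat_adjoint V * X * V"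
    unfolding correctable_def by metis
  note V' = mat_adjoint_carrier[OF V]
  have "channel r n (\<lambda>X. V * X * mat_adjoint V)" by (rule channel_isometry[OF n V VV])
  from channel_comp[OF channel_comp[OF this ch] \<D>]
  have "channel r r (\<D> \<circ> restrict_code \<Phi> V)" by (simp add: comp_def restrict_code_def)
  note lin = channel_linear[OF this]
  have "mat_trace ((mat_adjoint V * X * V) * \<D> (\<Phi> \<rho>)) = mat_trace (X * \<rho>)"
    if X: "X \<in> S" and \<rho>: "\<rho> \<in> carrier_mat n n" "P * \<rho> * P = \<rho>" for X \<rho>
  proof -
    have Pc: "P \<in> carrier_mat n n" and Xc: "X \<in> carrier_mat n n"
      using P X by (auto intro: star_subalgebra_carrier[OF S])
    note V'X = mult_carrier_mat[OF V' Xc] and V'\<rho> = mult_carrier_mat[OF V' \<rho>(1)]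
    let ?Y = "mat_adjoint V * \<rho> * V" and ?X = "mat_adjoint V * X * V"
    have Y: "?Y \<in> carrier_mat r r" by (rule mult_carrier_mat[OF V'\<rho> V])
    have Xr: "?X \<in> carrier_mat r r" by (rule mult_carrier_mat[OF V'X V])
    have "V * ?Y * mat_adjoint V = P * \<rho> * P"
      using assoc_mult_mat[OF V V'\<rho> V] assoc_mult_mat[OF mult_carrier_mat[OF V V'\<rho>] V V']
        assoc_mult_mat[OF V V' \<rho>(1)] VP by simp
    then have VY: "V * ?Y * mat_adjoint V = \<rho>" using \<rho> by simp
    have "mat_trace (?X * ?Y) = mat_trace (?X * \<D> (\<Phi> \<rho>))"
      using map_adjoint_trace[OF lin Xr Y] by (simp add: adj[OF X] restrict_code_def VY)
    moreover have "mat_trace (?X * ?Y) = mat_trace (X * \<rho>)"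
    proof -
      have "?X * ?Y = mat_adjoint V * X * (V * ?Y)" by (rule assoc_mult_mat[OF V'X V Y])
      also have "V * ?Y = P * \<rho> * V"
        using assoc_mult_mat[OF V V'\<rho> V] assoc_mult_mat[OF V V' \<rho>(1)] VP by simp
      also have "mat_adjoint V * X * (P * \<rho> * V) = mat_adjoint V * (X * (P * \<rho>)) * V"
        using V' Xc Pc \<rho>(1) V
        by (simp add: assoc_mult_mat[of _ r n _ n _ n] assoc_mult_mat[of _ r n _ n _ r] assoc_mult_mat[of _ n n _ n _ r])
      also have "mat_trace \<dots> = mat_trace (V * mat_adjoint V * (X * (P * \<rho>)))"
        using Xc Pc \<rho>(1) by (intro mat_trace_sandwich[OF V V]) auto
      also have "V * mat_adjoint V * (X * (P * \<rho>)) = P * (X * P) * \<rho>"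
        using Xc Pc \<rho>(1) by (simp add: VP assoc_mult_square[of _ n])
      finally show ?thesis by (simp add: unit X)
    qed
    ultimately show ?thesis by simp
  qed
  then show ?thesis using S P unit V VP \<D> by (intro that[of P V r \<D>]) auto
qed

definition projection_family :: "nat \<Rightarrow> complex mat set \<Rightarrow> nat \<Rightarrow> (nat \<Rightarrow> complex mat) \<Rightarrow> bool" where
  "projection_family n S k p \<longleftrightarrow>
     (\<forall>i<k. p i \<in> S \<and> mat_adjoint (p i) = p i \<and> p i * p i = p i \<and> p i \<noteq> 0\<^sub>m n n) \<and>
     (\<forall>i<k. \<forall>j<k. i \<noteq> j \<longrightarrow> p i * p j = 0\<^sub>m n n)"

text \<open>The range of \<open>q\<close> lies in that of \<open>V\<close>, so compression by
  \<open>V\<close> only expresses \<open>q\<close> in coordinates of the code space.\<close>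

lemma compression_projection:
  fixes P V q :: "complex mat"
  assumes V: "V \<in> carrier_mat n r" and VP: "V * mat_adjoint V = P"
    and q: "q \<in> carrier_mat n n" "mat_adjoint q = q" "q * q = q" "P * q = q"
  shows "mat_adjoint V * q * V \<in> carrier_mat r r"
    "mat_adjoint (mat_adjoint V * q * V) = mat_adjoint V * q * V"
    "(mat_adjoint V * q * V) * (mat_adjoint V * q * V) = mat_adjoint V * q * V"
proof -
  note V' = mat_adjoint_carrier[OF V]
  note V'q = mult_carrier_mat[OF V' q(1)]
  note c = mult_carrier_mat[OF V'q V]
  show "mat_adjoint V * q * V \<in> carrier_mat r r" by (rule c)
  show "mat_adjoint (mat_adjoint V * q * V) = mat_adjoint V * q * V"
    using mat_adjoint_mult[OF V'q V] mat_adjoint_mult[OF V' q(1)] assoc_mult_mat[OF V' q(1) V] by (simp add: q)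
  have "(mat_adjoint V * q * V) * (mat_adjoint V * q * V) = mat_adjoint V * q * (V * (mat_adjoint V * q * V))"
    by (rule assoc_mult_mat[OF V'q V c])
  also have "V * (mat_adjoint V * q * V) = q * V"
    using assoc_mult_mat[OF V V'q V] assoc_mult_mat[OF V V' q(1)] by (simp add: VP q)
  also have "mat_adjoint V * q * (q * V) = mat_adjoint V * q * V"
    using assoc_mult_mat[OF V'q q(1) V] assoc_mult_mat[OF V' q(1) q(1)] by (simp add: q)
  finally show "(mat_adjoint V * q * V) * (mat_adjoint V * q * V) = mat_adjoint V * q * V" .
qed

lemma correctable_projections_code:
  assumes n: "0 < n" and ch: "channel n m \<Phi>" and corr: "correctable n m \<Phi> S"
    and p: "projection_family n S k p"
  shows "zero_error_code n m \<Phi> k"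
proof -
  obtain P r V \<D> where S: "star_subalgebra n S" and P: "P \<in> S"
    and unit': "\<forall>X\<in>S. P * X = X \<and> X * P = X"
    and V: "V \<in> carrier_mat n r" and VP: "V * mat_adjoint V = P" and \<D>: "channel m r \<D>"
    and tr': "\<forall>X\<in>S. \<forall>\<rho>\<in>carrier_mat n n. P * \<rho> * P = \<rho> \<longrightarrow>
      mat_trace ((mat_adjoint V * X * V) * \<D> (\<Phi> \<rho>)) = mat_trace (X * \<rho>)"
    by (rule correctableE[OF n ch corr])
  have unit: "P * X = X" "X * P = X" if "X \<in> S" for X using unit' that by auto
  note tr = tr'[rule_format]
  have p': "p i \<in> S" "p i \<in> carrier_mat n n" "mat_adjoint (p i) = p i" "p i * p i = p i" "p i \<noteq> 0\<^sub>m n n"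
    if "i < k" for i using p that star_subalgebra_carrier[OF S] by (auto simp: projection_family_def)
  let ?\<rho> = "\<lambda>i. inverse (mat_trace (p i)) \<cdot>\<^sub>m p i"
  let ?q = "\<lambda>i. mat_adjoint V * p i * V"
  let ?G = "\<lambda>i. map_adjoint m r \<D> (?q i)"
  show ?thesis
  proof (rule zero_error_codeI[OF ch])
    fix i assume i: "i < k"
    note q = compression_projection[OF V VP p'(2)[OF i] p'(3)[OF i] p'(4)[OF i] unit(1)[OF p'(1)[OF i]]]
    show "state n (?\<rho> i)" by (rule state_normalized_projection[OF p'(2-5)[OF i]])
    show "psd m (?G i)" "psd m (1\<^sub>m m - ?G i)" using map_adjoint_test_operator[OF \<D> q] by auto
    fix j assume j: "j < k"
    have \<rho>: "?\<rho> j \<in> carrier_mat n n" "?\<rho> j \<in> S"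
      using p'[OF j] by (auto intro: star_subalgebra_smult[OF S])
    have "mat_trace (?G i * \<Phi> (?\<rho> j)) = mat_trace (?q i * \<D> (\<Phi> (?\<rho> j)))"
      by (rule map_adjoint_trace[OF channel_linear[OF \<D>] q(1) channel_carrier[OF ch \<rho>(1)]])
    also have "\<dots> = mat_trace (p i * ?\<rho> j)"
      by (rule tr[OF p'(1)[OF i] \<rho>(1)]) (simp add: unit \<rho>(2))
    also have "p i * ?\<rho> j = inverse (mat_trace (p j)) \<cdot>\<^sub>m (p i * p j)"
      by (rule mult_smult_distrib[OF p'(2)[OF i] p'(2)[OF j]])
    also have "mat_trace \<dots> = (if i = j then 1 else 0)"
      using p i j p'(2,4)[OF i] mat_trace_projection_pos[OF p'(2-5)[OF i]]
      by (auto simp: projection_family_def mat_trace_smult[of _ n])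
    finally show "mat_trace (?G i * \<Phi> (?\<rho> j)) = (if i = j then 1 else 0)" .
  qed
qed

section \<open>Qubit codes from partial isometries\<close>

lemma mat_of_cols_2_isometry:
  fixes v w :: "complex vec"
  assumes v: "v \<in> carrier_vec n" and w: "w \<in> carrier_vec n"
    and "v \<bullet>c v = 1" "w \<bullet>c w = 1" "w \<bullet>c v = 0"
  shows "mat_of_cols n [v, w] \<in> carrier_mat n 2"
    "mat_adjoint (mat_of_cols n [v, w]) * mat_of_cols n [v, w] = 1\<^sub>m 2"
proof -
  let ?W = "mat_of_cols n [v, w]"
  show W: "?W \<in> carrier_mat n 2" by (intro carrier_matI) auto
  have c: "col ?W 0 = v" "col ?W (Suc 0) = w" using v w by (simp_all add: col_mat_of_cols)
  have "v \<bullet>c w = 0" using cscalar_prod_commute_zero[OF w v] assms by simp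
  then show "mat_adjoint ?W * ?W = 1\<^sub>m 2"
    using assms W adjoint_mult_cols[OF W W] by (intro eq_matI) (auto simp: less_2_cases_iff c)
qed

text \<open>
  The matrix units \<open>u\<^sub>j u\<^sub>i\<^sup>*\<close> with \<open>u\<^sub>0 = u\<^sup>* u\<close> and \<open>u\<^sub>1 = u\<close> span a copy of the \<open>2 \<times> 2\<close> matrices,
  and the qubit is encoded in the span of \<open>v\<close> and \<open>u v\<close> for a unit vector \<open>v\<close> in the initial
  space of \<open>u\<close>.
\<close>

lemma correctable_partial_isometry_code:
  assumes n: "0 < n" and ch: "channel n m \<Phi>" and corr: "correctable n m \<Phi> S"
    and u: "u \<in> S" and p: "p = mat_adjoint u * u" "p \<noteq> 0\<^sub>m n n" "p * p = p" "u * p = u" "p * u = 0\<^sub>m n n"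
  shows "\<exists>\<E> \<D>. channel 2 n \<E> \<and> channel m 2 \<D> \<and> (\<forall>X\<in>carrier_mat 2 2. \<D> (\<Phi> (\<E> X)) = X)"
proof -
  obtain P r V \<D> where S: "star_subalgebra n S" and P: "P \<in> S"
    and unit': "\<forall>X\<in>S. P * X = X \<and> X * P = X"
    and V: "V \<in> carrier_mat n r" and VP: "V * mat_adjoint V = P" and \<D>: "channel m r \<D>"
    and tr': "\<forall>X\<in>S. \<forall>\<rho>\<in>carrier_mat n n. P * \<rho> * P = \<rho> \<longrightarrow>
      mat_trace ((mat_adjoint V * X * V) * \<D> (\<Phi> \<rho>)) = mat_trace (X * \<rho>)"
    by (rule correctableE[OF n ch corr])
  have unit: "P * X = X" "X * P = X" if "X \<in> S" for X using unit' that by auto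
  note tr = tr'[rule_format]
  note [simp] = star_subalgebra_carrier[OF S u] star_subalgebra_carrier[OF S P]
  note V' = mat_adjoint_carrier[OF V]
  have pS: "p \<in> S" unfolding p(1) by (intro star_subalgebra_mult[OF S] star_subalgebra_adjoint[OF S] u)
  note [simp] = star_subalgebra_carrier[OF S pS]
  have p_adj: "mat_adjoint p = p" by (simp add: p(1) square_simps[where n = n])
  have P_adj: "mat_adjoint P = P" using mat_adjoint_mult[OF V V'] VP by simp
  \<comment> \<open>The final space of \<open>u\<close> is orthogonal to its initial space. This
    makes \<open>v\<close> and \<open>u v\<close> orthogonal and the two range projections
    disjoint.\<close>
  have up: "mat_adjoint u * p = 0\<^sub>m n n"
    using arg_cong[OF p(5), of mat_adjoint] by (simp add: square_simps[where n = n] p_adj)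
  have pu: "p * mat_adjoint u = mat_adjoint u"
    using arg_cong[OF p(4), of mat_adjoint] by (simp add: square_simps[where n = n] p_adj)

  have "\<exists>Y\<in>carrier_mat n 1. mat_adjoint Y * Y = 1\<^sub>m 1 \<and> (\<forall>i<1. \<exists>x\<in>carrier_vec n. col Y i = p *\<^sub>v x)"
    by (rule orthonormal_range_vectors[of 1 "\<lambda>_. p"]) (auto simp: p_adj p(2))
  then obtain Y x where Y: "Y \<in> carrier_mat n 1" "mat_adjoint Y * Y = 1\<^sub>m 1"
    and x: "x \<in> carrier_vec n" "col Y 0 = p *\<^sub>v x" by auto
  define v where "v = p *\<^sub>v x"
  have v: "v \<in> carrier_vec n" using mult_mat_vec_carrier[of p n n x] x(1) by (simp add: v_def)
  have vv: "v \<bullet>c v = 1" using adjoint_mult_cols[OF Y(1) Y(1), of 0 0] Y(2) x(2) by (simp add: v_def)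
  have pv: "p *\<^sub>v v = v"
    unfolding v_def using x(1) by (simp flip: assoc_mult_mat_vec[of p n n p n x] add: p(3))
  define w where "w = u *\<^sub>v v"
  have w: "w \<in> carrier_vec n" using mult_mat_vec_carrier[of u n n v] v by (simp add: w_def)
  have pw: "p *\<^sub>v w = 0\<^sub>v n"
    unfolding w_def using v by (simp flip: assoc_mult_mat_vec[of p n n u n v] add: p(5) zero_mult_vec)
  have uw: "mat_adjoint u *\<^sub>v w = v"
    unfolding w_def using v by (simp flip: assoc_mult_mat_vec[of "mat_adjoint u" n n u n v] p(1) add: pv)
  have uv: "mat_adjoint u *\<^sub>v v = 0\<^sub>v n"
    using v assoc_mult_mat_vec[of "mat_adjoint u" n n p n v] by (simp add: up pv zero_mult_vec)
  have ww: "w \<bullet>c w = 1"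
    using mult_mat_vec_adjoint[of u n n v w] v w by (simp add: uw vv flip: w_def)
  have wv: "w \<bullet>c v = 0"
    using mult_mat_vec_adjoint[of u n n v v] v by (simp add: uv flip: w_def)
  define W where "W = mat_of_cols n [v, w]"
  note W = mat_of_cols_2_isometry[OF v w vv ww wv, folded W_def]
  note W' = mat_adjoint_carrier[OF W(1)]
  define \<E> where "\<E> X = W * X * mat_adjoint W" for X
  have \<E>: "channel 2 n \<E>" unfolding \<E>_def by (rule channel_isometry[OF n W])

  define U where "U i = (if i = 0 then p else u)" for i :: nat
  have US: "U i \<in> S" for i by (simp add: U_def u pS)
  have Uc [simp]: "U i \<in> carrier_mat n n" for i by (simp add: U_def)
  \<comment> \<open>The adjoint of \<open>U i\<close> sends the i-th code vector to \<open>v\<close>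
    and the other one to 0.\<close>
  have UW: "mat_adjoint (U i) * W = mat n 2 (\<lambda>(a, b). if b = i then v $ a else 0)" if "i < 2" for i
  proof -
    have "col (mat_adjoint (U i) * W) b = (if b = i then v else 0\<^sub>v n)" if b: "b < 2" for b
    proof -
      have "col (mat_adjoint (U i) * W) b = mat_adjoint (U i) *\<^sub>v col W b"
        using W(1) b by (intro col_mult2[of _ n n _ 2]) auto
      moreover have c: "col W 0 = v" "col W (Suc 0) = w" using v w by (simp_all add: W_def col_mat_of_cols)
      ultimately show ?thesis using \<open>i < 2\<close> b unfolding less_2_cases_iff
        by (elim disjE; simp only: c U_def p_adj pv pw uv uw if_True if_False simp_thms nat.distinct)
    qed
    note colUW = this
    have dims: "dim_row (mat_adjoint (U i) * W) = n" "dim_col (mat_adjoint (U i) * W) = 2"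
      using carrier_matD[OF W(1)] carrier_matD[OF Uc] by simp_all
    have *: "(mat_adjoint (U i) * W) $$ (a, b) = (if b = i then v else 0\<^sub>v n) $ a" if "a < n" "b < 2" for a b
      using index_col[of a "mat_adjoint (U i) * W" b] that unfolding dims colUW[OF that(2)] by simp
    show ?thesis by (rule eq_matI) (auto simp: * dims simp del: index_mult_mat)
  qed
  \<comment> \<open>So the matrix entries of the encoded qubit are expectations of elements of
    \<open>S\<close>, exactly what the recovery preserves.\<close>
  have UWX: "mat_trace ((U j * mat_adjoint (U i)) * \<E> X) = X $$ (i, j)"
    if X: "X \<in> carrier_mat 2 2" and ij: "i < 2" "j < 2" for X i j
  proof -
    let ?A = "\<lambda>i. mat_adjoint (U i) * W"
    have A: "?A i \<in> carrier_mat n 2" for i by (rule mult_carrier_mat[OF _ W(1)]) simp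
    note WX = mult_carrier_mat[OF W(1) X]
    have "(U j * mat_adjoint (U i)) * \<E> X = U j * (?A i * X * mat_adjoint W)"
      unfolding \<E>_def
      using assoc_mult_mat[of "mat_adjoint (U i)" n n "W * X" 2 "mat_adjoint W" n]
        assoc_mult_mat[of "mat_adjoint (U i)" n n W 2 X 2] W(1) X WX mult_carrier_mat[OF WX W']
      by (simp add: assoc_mult_square[of _ n])
    also have "mat_trace \<dots> = mat_trace (?A i * X * mat_adjoint W * U j)"
      using mult_carrier_mat[OF mult_carrier_mat[OF A X] W'] by (intro mat_trace_comm[of _ n n]) auto
    also have "?A i * X * mat_adjoint W * U j = ?A i * X * mat_adjoint (?A j)"
      using assoc_mult_mat[OF mult_carrier_mat[OF A X] W' Uc] mat_adjoint_mult[OF mat_adjoint_carrier[OF Uc] W(1)] by simp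
    also have "mat_trace \<dots> = (\<Sum>a<n. v $ a * X $$ (i, j) * cnj (v $ a))"
      unfolding UW[OF ij(1)] UW[OF ij(2)] mat_trace_def using X ij[unfolded less_2_cases_iff]
      by (elim disjE) (simp_all add: scalar_prod_def atLeast0LessThan numeral_2_eq_2)
    also have "\<dots> = X $$ (i, j) * (v \<bullet>c v)"
      using v by (simp add: cscalar_prod_sum[of _ n] sum_distrib_left mult_ac)
    finally show ?thesis by (simp add: vv)
  qed
  define q where "q = u * mat_adjoint u"
  have qS: "q \<in> S" unfolding q_def by (intro star_subalgebra_mult[OF S] star_subalgebra_adjoint[OF S] u)
  note [simp] = star_subalgebra_carrier[OF S qS]
  have q: "mat_adjoint q = q" "q * q = q" "p * q = 0\<^sub>m n n" "q * p = 0\<^sub>m n n"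
  proof -
    show "mat_adjoint q = q" by (simp add: q_def square_simps[where n = n])
    have "q * q = u * (mat_adjoint u * u) * mat_adjoint u" by (simp add: q_def square_simps[where n = n])
    then show "q * q = q" by (simp flip: p(1) add: q_def p(4))
    have "p * q = (p * u) * mat_adjoint u" by (simp add: q_def square_simps[where n = n])
    then show "p * q = 0\<^sub>m n n" by (simp add: p(5) square_simps[where n = n])
    show "q * p = 0\<^sub>m n n" by (simp add: q_def square_simps[where n = n] up)
  qed
  define e where "e = p + q"
  have eS: "e \<in> S" unfolding e_def by (rule star_subalgebra_add[OF S pS qS])
  have e: "e \<in> carrier_mat n n" "mat_adjoint e = e" "e * e = e"
    by (simp_all add: e_def square_simps[where n = n] p_adj q p(3))
  \<comment> \<open>The complement, within the code space, of the unit \<open>e\<close> of the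
    matrix-unit algebra; it completes the readout to a trace-preserving map.\<close>
  define G where "G = 1\<^sub>m r - mat_adjoint V * e * V"
  note Ve = compression_projection[OF V VP e unit(1)[OF eS]]
  have G: "G \<in> carrier_mat r r" "mat_adjoint G = G" "G * G = G"
    unfolding G_def using Ve complement_projection[OF Ve(1,3)]
    by (simp_all add: minus_carrier_mat square_simps[where n = r])
  \<comment> \<open>Chosen so that \<open>R j\<close> times the adjoint of \<open>R i\<close> is the
    compression of the matrix unit used in \<open>UWX\<close>.\<close>
  define R where "R i = mat_adjoint V * U i" for i
  have R: "R i \<in> carrier_mat r n" for i unfolding R_def by (rule mult_carrier_mat[OF V' Uc])
  have RR: "R j * mat_adjoint (R i) = mat_adjoint V * (U j * mat_adjoint (U i)) * V" for i j
    using mat_adjoint_mult[OF V' Uc[of i]] V V' Uc[of i] Uc[of j]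
      mult_carrier_mat[OF mat_adjoint_carrier[OF Uc[of i]] V]
    by (simp add: R_def assoc_mult_mat[of _ r n _ n _ r] assoc_mult_mat[of _ n n _ n _ r])
  have sumR: "mat_trace (R 0 * mat_adjoint (R 0) * Z) + mat_trace (R 1 * mat_adjoint (R 1) * Z) + mat_trace (G * Z) = mat_trace Z"
    if Z: "Z \<in> carrier_mat r r" for Z
  proof -
    have c: "mat_adjoint V * p * V \<in> carrier_mat r r" "mat_adjoint V * q * V \<in> carrier_mat r r"
      by (auto intro!: mult_three_carrier[OF V' _ V])
    have "mat_adjoint V * e * V = mat_adjoint V * p * V + mat_adjoint V * q * V"
      using mult_add_distrib_mat[OF V', of p n q] V
        add_mult_distrib_mat[OF mult_carrier_mat[OF V', of p n] mult_carrier_mat[OF V', of q n], of V r]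
      by (simp add: e_def)
    then have "G * Z = Z - (mat_adjoint V * p * V * Z + mat_adjoint V * q * V * Z)"
      unfolding G_def using c Z by (simp add: square_simps[where n = r])
    moreover have "R 0 * mat_adjoint (R 0) = mat_adjoint V * p * V" "R 1 * mat_adjoint (R 1) = mat_adjoint V * q * V"
      by (simp_all add: RR) (simp_all add: U_def p_adj p(3) q_def)
    ultimately show ?thesis using c Z by (simp add: mat_trace_minus[of _ r] mat_trace_add[of _ r])
  qed
  define T where "T = recovery_map 2 R G"
  have T: "channel r 2 T"
    unfolding T_def
  proof (rule channel_recovery_map)
    fix Z :: "complex mat" assume Z: "Z \<in> carrier_mat r r"
    show "(\<Sum>i<2. mat_trace (mat_adjoint (R i) * Z * R i)) + mat_trace (mat_adjoint G * Z * G) = mat_trace Z"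
      using sumR[OF Z] mat_trace_sandwich[OF R R Z] mat_trace_sandwich[OF G(1) G(1) Z]
      by (simp add: numeral_2_eq_2 G)
  qed (use R G in auto)
  have "(T \<circ> \<D>) (\<Phi> (\<E> X)) = X" if X: "X \<in> carrier_mat 2 2" for X
  proof -
    let ?Z = "\<D> (\<Phi> (\<E> X))"
    have \<E>X: "\<E> X \<in> carrier_mat n n" by (rule channel_carrier[OF \<E> X])
    have Z: "?Z \<in> carrier_mat r r" by (rule channel_carrier[OF \<D> channel_carrier[OF ch \<E>X]])
    have PW: "P * W = W"
    proof -
      have Pv: "P *\<^sub>v v = v" unfolding v_def using x(1) assoc_mult_mat_vec[of P n n p n x] unit(1)[OF pS] by simp
      have Pw: "P *\<^sub>v w = w" unfolding w_def using v assoc_mult_mat_vec[of P n n u n v] unit(1)[OF u] by simp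
      have "col (P * W) b = col W b" if "b < 2" for b
        using that W(1) col_mult2[of P n n W 2 b] Pv Pw v w
        by (auto simp: W_def col_mat_of_cols less_2_cases_iff)
      then show ?thesis using W(1) carrier_matD(1)[OF star_subalgebra_carrier[OF S P]]
        by (intro mat_col_eqI) auto
    qed
    have WP: "mat_adjoint W * P = mat_adjoint W"
      using mat_adjoint_mult[of P n n W 2] W(1) by (simp add: PW P_adj)
    have "P * \<E> X * P = \<E> X"
    proof -
      note WX = mult_carrier_mat[OF W(1) X]
      have PWX: "P * (W * X) = W * X"
        using assoc_mult_mat[OF star_subalgebra_carrier[OF S P] W(1) X] unfolding PW by (rule sym)
      have "P * \<E> X = \<E> X"
        using assoc_mult_mat[OF star_subalgebra_carrier[OF S P] WX W'] unfolding PWX \<E>_def by (rule sym)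
      moreover have "\<E> X * P = \<E> X"
        unfolding \<E>_def using assoc_mult_mat[OF WX W', of P n] by (simp add: WP)
      ultimately show ?thesis by simp
    qed
    then have e: "mat_trace (R j * mat_adjoint (R i) * ?Z) = X $$ (i, j)" if "i < 2" "j < 2" for i j
      using tr[of "U j * mat_adjoint (U i)" "\<E> X"] \<E>X UWX[OF X that] unfolding RR
      by (simp add: star_subalgebra_mult[OF S] star_subalgebra_adjoint[OF S] US)
    \<comment> \<open>The two diagonal entries already account for the whole trace, so the
      correction term vanishes on encoded inputs.\<close>
    have "mat_trace ?Z = mat_trace X"
      using channel_trace[OF \<D> channel_carrier[OF ch \<E>X]] channel_trace[OF ch \<E>X] channel_trace[OF \<E> X] by simp
    also have "\<dots> = X $$ (0, 0) + X $$ (1, 1)" using X by (simp add: mat_trace_def numeral_2_eq_2)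
    finally have "mat_trace (G * ?Z) = 0" using sumR[OF Z] e[of 0 0] e[of 1 1] by simp
    then show ?thesis
      using mat_trace_sandwich[OF R R Z] mat_trace_sandwich[OF G(1) G(1) Z] e X
      by (intro eq_matI) (auto simp: T_def recovery_map_def G)
  qed
  then show ?thesis using \<E> channel_comp[OF \<D> T] by (intro exI[of _ \<E>] exI[of _ "T \<circ> \<D>"]) auto
qed

section \<open>Structure of correctable algebras in the absence of quantum codes\<close>

text \<open>The explicit dimension makes the empty sum the n by n zero matrix.\<close>

definition mat_sum :: "nat \<Rightarrow> nat \<Rightarrow> (nat \<Rightarrow> complex mat) \<Rightarrow> complex mat" where
  "mat_sum n k f = mat n n (\<lambda>ij. \<Sum>l<k. f l $$ ij)"

lemma mat_sum_carrier [simp]: "mat_sum n k f \<in> carrier_mat n n"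
  by (simp add: mat_sum_def)

lemma mat_sum_0 [simp]: "mat_sum n 0 f = 0\<^sub>m n n"
  by (rule eq_matI) (auto simp: mat_sum_def)

lemma mat_sum_Suc:
  "f k \<in> carrier_mat n n \<Longrightarrow> mat_sum n (Suc k) f = mat_sum n k f + f k"
  by (rule eq_matI) (auto simp: mat_sum_def)

lemma mat_sum_cong: "(\<And>l. l < k \<Longrightarrow> f l = g l) \<Longrightarrow> mat_sum n k f = mat_sum n k g"
  by (auto simp: mat_sum_def)

lemma mat_sum_single:
  assumes f: "\<And>l. l < k \<Longrightarrow> l \<noteq> j \<Longrightarrow> f l = 0\<^sub>m n n" and j: "j < k" "f j \<in> carrier_mat n n"
  shows "mat_sum n k f = f j"
proof (rule eq_matI)
  fix a b assume "a < dim_row (f j)" "b < dim_col (f j)"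
  then have ab: "a < n" "b < n" using j by auto
  have "(\<Sum>l<k. f l $$ (a, b)) = (\<Sum>l\<in>{j}. f l $$ (a, b))"
    using f j ab by (intro sum.mono_neutral_right) auto
  then show "mat_sum n k f $$ (a, b) = f j $$ (a, b)" using ab by (simp add: mat_sum_def)
qed (use j in \<open>auto simp: mat_sum_def\<close>)

lemma mat_sum_mult_left:
  assumes A: "A \<in> carrier_mat n n" and f: "\<And>l. l < k \<Longrightarrow> f l \<in> carrier_mat n n"
  shows "A * mat_sum n k f = mat_sum n k (\<lambda>l. A * f l)"
  using f
proof (induction k)
  case (Suc k)
  then show ?case using A by (simp add: mat_sum_Suc square_simps[where n = n])
qed (use A in simp)

lemma mat_sum_mult_right:
  assumes A: "A \<in> carrier_mat n n" and f: "\<And>l. l < k \<Longrightarrow> f l \<in> carrier_mat n n"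
  shows "mat_sum n k f * A = mat_sum n k (\<lambda>l. f l * A)"
  using f
proof (induction k)
  case (Suc k)
  then show ?case using A by (simp add: mat_sum_Suc square_simps[where n = n])
qed (use A in simp)

lemma mat_sum_adjoint:
  assumes f: "\<And>l. l < k \<Longrightarrow> f l \<in> carrier_mat n n"
  shows "mat_adjoint (mat_sum n k f) = mat_sum n k (\<lambda>l. mat_adjoint (f l))"
  using f
proof (induction k)
  case (Suc k)
  then show ?case by (simp add: mat_sum_Suc square_simps[where n = n])
qed simp

lemma star_subalgebra_mat_sum:
  assumes S: "star_subalgebra n S" and f: "\<And>l. l < k \<Longrightarrow> f l \<in> S"
  shows "mat_sum n k f \<in> S"
  using f
proof (induction k)
  case (Suc k)
  then show ?case
    using star_subalgebra_carrier[OF S, of "f k"] by (simp add: mat_sum_Suc star_subalgebra_add[OF S])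
qed (simp add: star_subalgebra_zero[OF S])

section \<open>Maximal families of orthogonal projections\<close>

lemma projection_familyD:
  assumes "projection_family n S k p" "i < k"
  shows "p i \<in> S" "mat_adjoint (p i) = p i" "p i * p i = p i" "p i \<noteq> 0\<^sub>m n n"
    "j < k \<Longrightarrow> i \<noteq> j \<Longrightarrow> p i * p j = 0\<^sub>m n n"
  using assms by (auto simp: projection_family_def)

lemma projection_family_extend:
  assumes p: "projection_family n S k p"
    and q: "q \<in> S" "mat_adjoint q = q" "q * q = q" "q \<noteq> 0\<^sub>m n n"
    and pq: "\<And>i. i < k \<Longrightarrow> p i * q = 0\<^sub>m n n" "\<And>i. i < k \<Longrightarrow> q * p i = 0\<^sub>m n n"
  shows "projection_family n S (Suc k) (p(k := q))"
  using assms by (auto simp: projection_family_def less_Suc_eq)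

text \<open>Contradictions in this context are of two kinds: a family with one more member, or a
  perfect qubit code. The quantum capacity enters only in \<open>off_diagonal\<close>.\<close>

locale correctable_classical =
  fixes n m :: nat and \<Phi> S P k p
  assumes n: "0 < n" and ch: "channel n m \<Phi>" and Q: "zero_error_quantum_capacity n m \<Phi> = 0"
    and corr: "correctable n m \<Phi> S" and P: "P \<in> S"
    and unit: "\<And>X. X \<in> S \<Longrightarrow> P * X = X" "\<And>X. X \<in> S \<Longrightarrow> X * P = X"
    and fam: "projection_family n S k p"
    and max: "\<And>q. \<not> projection_family n S (Suc k) q"
begin

lemma S: "star_subalgebra n S"
  using corr by (simp add: correctable_def)

lemma carrier [simp]: "X \<in> S \<Longrightarrow> X \<in> carrier_mat n n"
  by (rule star_subalgebra_carrier[OF S])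

lemmas p = projection_familyD[OF fam]

lemma p_carrier [simp]: "i < k \<Longrightarrow> p i \<in> carrier_mat n n"
  by (simp add: p)

text \<open>Otherwise the difference would be a nonzero projection in \<open>S\<close> orthogonal to
  all \<open>p i\<close>, and it could be appended to the family.\<close>

lemma unit_sum: "P = mat_sum n k p"
proof (rule ccontr)
  assume ne: "P \<noteq> mat_sum n k p"
  define E where "E = mat_sum n k p"
  have E: "E \<in> S" unfolding E_def by (rule star_subalgebra_mat_sum[OF S p(1)])
  have P_adj: "mat_adjoint P = P"
  proof -
    have "mat_adjoint P = P * mat_adjoint P" using unit(1)[OF star_subalgebra_adjoint[OF S P]] by simp
    then show ?thesis
      using mat_adjoint_mult[of P n n "mat_adjoint P" n] P by (metis carrier mat_adjoint_adjoint mat_adjoint_carrier)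
  qed
  have E_adj: "mat_adjoint E = E"
    unfolding E_def using p(2) by (subst mat_sum_adjoint) (auto intro: mat_sum_cong)
  have Ep: "E * p i = p i" if "i < k" for i
    unfolding E_def using that p
    by (subst mat_sum_mult_right) (auto simp: mat_sum_single[of k i "\<lambda>l. p l * p i"])
  have pE: "p i * E = p i" if "i < k" for i
    using arg_cong[OF Ep[OF that], of mat_adjoint] that E
    by (simp add: square_simps[where n = n] E_adj p(2))
  have EE: "E * E = E"
  proof -
    have "E * E = mat_sum n k (\<lambda>l. E * p l)" using E by (subst (2) E_def, subst mat_sum_mult_left) auto
    also have "\<dots> = E" unfolding E_def by (rule mat_sum_cong) (use Ep E_def in simp)
    finally show ?thesis .
  qed
  have "projection_family n S (Suc k) (p(k := P - E))"
  proof (rule projection_family_extend[OF fam])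
    show "P - E \<in> S" by (rule star_subalgebra_minus[OF S P E])
    show "mat_adjoint (P - E) = P - E" using P E by (simp add: square_simps[where n = n] P_adj E_adj)
    have "(P - E) * (P - E) = P - E - (E - E)"
      using P E by (simp add: square_simps[where n = n] minus_carrier_mat unit EE)
    also have "\<dots> = P - E" using carrier_matD[OF carrier[OF P]] carrier_matD[OF carrier[OF E]] by (intro eq_matI) auto
    finally show "(P - E) * (P - E) = P - E" .
    show "P - E \<noteq> 0\<^sub>m n n"
    proof
      assume 0: "P - E = 0\<^sub>m n n"
      have "P = (P - E) + E" using carrier_matD[OF carrier[OF P]] carrier_matD[OF carrier[OF E]] by (intro eq_matI) auto
      also have "\<dots> = E" unfolding 0 using E by simp
      finally show False using ne by (simp add: E_def)
    qed
    fix i assume i: "i < k"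
    have "p i - p i = 0\<^sub>m n n" using i by simp
    then show "p i * (P - E) = 0\<^sub>m n n" "(P - E) * p i = 0\<^sub>m n n"
      using P E i by (simp_all add: square_simps[where n = n] unit p pE Ep)
  qed
  then show False using max by blast
qed

text \<open>Otherwise \<open>p i\<close> could be replaced by the two projections \<open>q\<close>
  and \<open>p i - q\<close>.\<close>

lemma minimal:
  assumes i: "i < k" and q: "q \<in> S" "mat_adjoint q = q" "q * q = q" "q \<noteq> 0\<^sub>m n n" "p i * q = q"
  shows "q = p i"
proof (rule ccontr)
  assume ne: "q \<noteq> p i"
  note [simp] = p_carrier[OF i]
  have qp: "q * p i = q"
    using arg_cong[OF q(5), of mat_adjoint] q(1) by (simp add: square_simps[where n = n] q(2) p(2)[OF i])
  have q0: "q * p j = 0\<^sub>m n n" "p j * q = 0\<^sub>m n n" if j: "j < k" "j \<noteq> i" for j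
  proof -
    have "(q * p i) * p j = q * (p i * p j)" using j q(1) by (intro assoc_mult_square[of _ n]) auto
    then have "q * p j = q * (p i * p j)" by (simp only: qp)
    then show "q * p j = 0\<^sub>m n n" using j i q(1) by (simp add: p(5) square_simps[where n = n])
    have "p j * q = (p j * p i) * q" using j q(1) by (simp add: assoc_mult_square[of _ n] q(5))
    then show "p j * q = 0\<^sub>m n n" using j i q(1) by (simp add: p(5) square_simps[where n = n])
  qed
  define r where "r = p i - q"
  have r: "r \<in> S" unfolding r_def by (rule star_subalgebra_minus[OF S p(1)[OF i] q(1)])
  have z: "q - q = 0\<^sub>m n n" "p i - q - 0\<^sub>m n n = p i - q" "0\<^sub>m n n - 0\<^sub>m n n = (0\<^sub>m n n :: complex mat)"
    using carrier[OF q(1)] carrier_matD[OF p_carrier[OF i]] carrier_matD[OF carrier[OF q(1)]] by (auto intro!: eq_matI)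
  have fam': "projection_family n S k (p(i := q))"
    using p q q0 unfolding projection_family_def by auto
  have "projection_family n S (Suc k) ((p(i := q))(k := r))"
  proof (rule projection_family_extend[OF fam' r])
    show "mat_adjoint r = r" using q(1) i by (simp add: r_def square_simps[where n = n] p(2) q(2))
    show "r * r = r"
      unfolding r_def using q(1) i by (simp add: square_simps[where n = n] minus_carrier_mat p(3) q z qp)
    show "r \<noteq> 0\<^sub>m n n"
    proof
      assume 0: "r = 0\<^sub>m n n"
      have "p i = r + q" unfolding r_def
        using carrier_matD[OF p_carrier[OF i]] carrier_matD[OF carrier[OF q(1)]] by (intro eq_matI) auto
      then show False using ne q(1) by (simp add: 0)
    qed
    fix j assume j: "j < k"
    show "(p(i := q)) j * r = 0\<^sub>m n n" "r * (p(i := q)) j = 0\<^sub>m n n"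
      using j i q(1) p(5)[OF i j] p(5)[OF j i]
      by (auto simp: r_def square_simps[where n = n] q qp q0 z)
  qed
  then show False using max by blast
qed

lemma hermitian_scalar:
  assumes i: "i < k" and h: "h \<in> S" "mat_adjoint h = h" "h * p i = h" "p i * h = h"
  shows "\<exists>c. h = c \<cdot>\<^sub>m p i"
proof (rule ccontr)
  assume "\<not> ?thesis"
  from split_projection[OF S p(1)[OF i] p(4)[OF i] h this p(3)[OF i] p(2)[OF i]] minimal[OF i]
  show False by blast
qed

text \<open>The real and imaginary parts of an element of the corner are self-adjoint elements of
  the same corner, so each is a scalar by \<open>hermitian_scalar\<close>.\<close>

lemma corner_scalar:
  assumes i: "i < k" and x: "x \<in> S"
  shows "\<exists>c. p i * x * p i = c \<cdot>\<^sub>m p i"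
proof -
  note [simp] = p_carrier[OF i] carrier[OF x]
  define y where "y = p i * x * p i"
  have y: "y \<in> S" unfolding y_def using x i by (intro star_subalgebra_mult[OF S] p(1))
  have py: "p i * y = y"
  proof -
    have "p i * y = (p i * p i) * (x * p i)" by (simp add: y_def assoc_mult_square[of _ n])
    then show ?thesis by (simp add: y_def p(3)[OF i] assoc_mult_square[of _ n])
  qed
  have yp: "y * p i = y" by (simp add: y_def assoc_mult_square[of _ n] p(3)[OF i])
  have y'p: "mat_adjoint y * p i = mat_adjoint y"
    using arg_cong[OF py, of mat_adjoint] y by (simp add: square_simps[where n = n] p(2)[OF i])
  have py': "p i * mat_adjoint y = mat_adjoint y"
    using arg_cong[OF yp, of mat_adjoint] y by (simp add: square_simps[where n = n] p(2)[OF i])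
  have y': "mat_adjoint y \<in> S" by (rule star_subalgebra_adjoint[OF S y])
  have "\<exists>c. y + mat_adjoint y = c \<cdot>\<^sub>m p i"
    using y y' by (intro hermitian_scalar[OF i])
      (auto simp: square_simps[where n = n] py yp y'p py' star_subalgebra_add[OF S] comm_add_mat[of _ n n])
  then obtain c where c: "y + mat_adjoint y = c \<cdot>\<^sub>m p i" by blast
  define h where "h = \<i> \<cdot>\<^sub>m (y - mat_adjoint y)"
  have "\<exists>d. h = d \<cdot>\<^sub>m p i"
  proof (rule hermitian_scalar[OF i])
    show "h \<in> S" unfolding h_def by (intro star_subalgebra_smult[OF S] star_subalgebra_minus[OF S] y y')
    show "mat_adjoint h = h"
      unfolding h_def using carrier_matD[OF carrier[OF y]] by (intro eq_matI) (auto simp: algebra_simps)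
    show "h * p i = h" "p i * h = h"
      using y y' by (simp_all add: h_def square_simps[where n = n] minus_carrier_mat py yp y'p py')
  qed
  then obtain d where d: "h = d \<cdot>\<^sub>m p i" by blast
  have "y = (1 / 2) \<cdot>\<^sub>m ((y + mat_adjoint y) + (- \<i>) \<cdot>\<^sub>m h)"
    unfolding h_def using carrier_matD[OF carrier[OF y]] by (intro eq_matI) (auto simp: algebra_simps)
  also have "\<dots> = (1 / 2 * (c - \<i> * d)) \<cdot>\<^sub>m p i"
    unfolding c d by (intro eq_matI) (auto simp: algebra_simps)
  finally show ?thesis unfolding y_def by blast
qed

lemma off_diagonal:
  assumes i: "i < k" and j: "j < k" and ij: "i \<noteq> j" and x: "x \<in> S"
  shows "p i * x * p j = 0\<^sub>m n n"
proof (rule ccontr)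
  note [simp] = p_carrier[OF i] p_carrier[OF j] carrier[OF x]
  define y where "y = p i * x * p j"
  assume "p i * x * p j \<noteq> 0\<^sub>m n n"
  then have y0: "y \<noteq> 0\<^sub>m n n" by (simp add: y_def)
  have y: "y \<in> S" unfolding y_def using x i j by (intro star_subalgebra_mult[OF S] p(1))
  note y' = star_subalgebra_adjoint[OF S y]
  have yp: "y * p j = y" by (simp add: y_def assoc_mult_square[of _ n] p(3)[OF j])
  have py': "p j * mat_adjoint y = mat_adjoint y"
    using arg_cong[OF yp, of mat_adjoint] y by (simp add: square_simps[where n = n] p(2)[OF j])
  have py: "p j * y = 0\<^sub>m n n"
  proof -
    have "p j * y = (p j * p i) * (x * p j)" by (simp add: y_def assoc_mult_square[of _ n])
    then show ?thesis using p(5)[OF j i] ij by (simp add: square_simps[where n = n])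
  qed
  have "p j * (mat_adjoint y * y) * p j = (p j * mat_adjoint y) * (y * p j)"
    using y by (simp add: assoc_mult_square[of _ n])
  then obtain c where c: "mat_adjoint y * y = c \<cdot>\<^sub>m p j"
    using corner_scalar[OF j star_subalgebra_mult[OF S y' y]] unfolding py' yp by auto
  have tp: "0 < mat_trace (p j)" using p[OF j] by (intro mat_trace_projection_pos[of _ n]) auto
  have "mat_adjoint y \<noteq> 0\<^sub>m n n"
  proof
    assume "mat_adjoint y = 0\<^sub>m n n"
    then have "mat_adjoint (mat_adjoint y) = 0\<^sub>m n n" by (simp del: mat_adjoint_adjoint)
    then show False using y0 by simp
  qed
  then have "0 < mat_trace (mat_adjoint y * y)"
    using mat_trace_mult_adjoint_nonneg[of "mat_adjoint y" n n] mat_trace_mult_adjoint_eq_0[of "mat_adjoint y" n n]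
      y by (auto simp: order_less_le)
  \<comment> \<open>The trace of \<open>mat_adjoint y * y\<close> is a nonzero squared norm and that
    of \<open>p j\<close> is positive, so \<open>c\<close> is a positive real.\<close>
  then have "0 < c * mat_trace (p j)" unfolding c by (simp add: mat_trace_smult[of _ n])
  then have "0 < Re c" "Im c = 0" using tp
    by (auto simp: less_complex_def zero_less_mult_iff)
  \<comment> \<open>The factor that makes \<open>p j\<close> the initial projection of
    \<open>u\<close>.\<close>
  define t where "t = complex_of_real (1 / sqrt (Re c))"
  have t: "t * (cnj t * c) = 1"
    using \<open>0 < Re c\<close> \<open>Im c = 0\<close> by (simp add: t_def complex_eq_iff flip: of_real_mult)
  define u where "u = t \<cdot>\<^sub>m y"
  have u: "u \<in> S" unfolding u_def by (rule star_subalgebra_smult[OF S y])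
  have "mat_adjoint u * u = (t * (cnj t * c)) \<cdot>\<^sub>m p j"
    using y by (simp add: u_def square_simps[where n = n] c smult_smult_times)
  also have "\<dots> = p j" unfolding t by (rule eq_matI) auto
  finally have uu: "p j = mat_adjoint u * u" by simp
  have "\<exists>\<E> \<D>. channel 2 n \<E> \<and> channel m 2 \<D> \<and> (\<forall>X\<in>carrier_mat 2 2. \<D> (\<Phi> (\<E> X)) = X)"
    using y by (intro correctable_partial_isometry_code[OF n ch corr u uu p(4)[OF j] p(3)[OF j]])
      (simp_all add: u_def square_simps[where n = n] yp py)
  then show False using no_quantum_code[OF ch Q, of 2] by auto
qed

text \<open>Inserting \<open>P\<close> as the sum of the \<open>p i\<close> on the left of
  \<open>X * p j\<close> leaves only the diagonal term, a scalar multiple of \<open>p j\<close>;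
  inserting it on the right of \<open>X\<close> then adds up these terms.\<close>

lemma spanned:
  assumes X: "X \<in> S"
  shows "\<exists>c. X = mat_sum n k (\<lambda>j. c j \<cdot>\<^sub>m p j)"
proof -
  have "\<exists>c. X * p j = c \<cdot>\<^sub>m p j" if j: "j < k" for j
  proof -
    note [simp] = carrier[OF X] p_carrier[OF j]
    have "X * p j = P * (X * p j)"
      using unit(1)[OF star_subalgebra_mult[OF S X p(1)[OF j]]] by simp
    also have "\<dots> = mat_sum n k (\<lambda>i. p i * (X * p j))"
      unfolding unit_sum by (rule mat_sum_mult_right) auto
    also have "\<dots> = p j * (X * p j)"
      by (rule mat_sum_single) (use j off_diagonal[OF _ j _ X] in \<open>auto simp: assoc_mult_square[of _ n]\<close>)
    finally show ?thesis using corner_scalar[OF j X] by (simp add: assoc_mult_square[of _ n])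
  qed
  then obtain c where c: "\<And>j. j < k \<Longrightarrow> X * p j = c j \<cdot>\<^sub>m p j" by metis
  have "X = X * P" using unit(2)[OF X] by simp
  also have "\<dots> = mat_sum n k (\<lambda>j. X * p j)" unfolding unit_sum using X by (intro mat_sum_mult_left) auto
  also have "\<dots> = mat_sum n k (\<lambda>j. c j \<cdot>\<^sub>m p j)" by (rule mat_sum_cong[OF c])
  finally show ?thesis by blast
qed

end

lemma correctable_spanned_by_projections:
  assumes n: "0 < n" and ch: "channel n m \<Phi>" and Q: "zero_error_quantum_capacity n m \<Phi> = 0"
    and corr: "correctable n m \<Phi> S"
  shows "\<exists>k p. projection_family n S k p \<and> zero_error_code n m \<Phi> k \<and>
    (\<forall>X\<in>S. \<exists>c. X = mat_sum n k (\<lambda>j. c j \<cdot>\<^sub>m p j))"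
proof -
  define K where "K = {k. \<exists>p. projection_family n S k p}"
  \<comment> \<open>Every family gives a code of its own size. This bound makes a largest family
    exist, the empty one being a first candidate.\<close>
  have "K \<subseteq> {..m}"
    using correctable_projections_code[OF n ch corr] zero_error_code_le[OF ch] unfolding K_def by blast
  then have fin: "finite K" by (rule finite_subset) simp
  have "0 \<in> K" by (auto simp: K_def projection_family_def)
  then have "Max K \<in> K" using fin Max_in by blast
  then obtain p where fam0: "projection_family n S (Max K) p" by (auto simp: K_def)
  have "Suc (Max K) \<notin> K" using Max_ge[OF fin, of "Suc (Max K)"] by auto
  then have max: "\<not> projection_family n S (Suc (Max K)) q" for q by (auto simp: K_def)
  obtain P where "P \<in> S" "\<forall>X\<in>S. P * X = X \<and> X * P = X"
    using corr unfolding correctable_def by (elim conjE bexE) (rule that)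
  then interpret correctable_classical n m \<Phi> S P "Max K" p
    using n ch Q corr fam0 max by unfold_locales auto
  show ?thesis using fam0 correctable_projections_code[OF n ch corr fam0] spanned by blast
qed

section \<open>Classical algebras\<close>

lemma classical_algebra_simps [simp]:
  "carrier (classical_algebra N) = carrier_vec N" "monoid.mult (classical_algebra N) = component_mult"
  "one (classical_algebra N) = vec N (\<lambda>_. 1)" "zero (classical_algebra N) = 0\<^sub>v N"
  "add (classical_algebra N) = (+)" "module.smult (classical_algebra N) = (\<cdot>\<^sub>v)"
  "star (classical_algebra N) = conjugate"
  by (simp_all add: classical_algebra_def)

lemma op_algebra_simps [simp]:
  "carrier (op_algebra n) = carrier_mat n n" "monoid.mult (op_algebra n) = (*)"
  "one (op_algebra n) = 1\<^sub>m n" "zero (op_algebra n) = 0\<^sub>m n n"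
  "add (op_algebra n) = (+)" "module.smult (op_algebra n) = (\<cdot>\<^sub>m)" "star (op_algebra n) = mat_adjoint"
  by (simp_all add: op_algebra_def)

lemma component_mult_index [simp]:
  "v \<in> carrier_vec N \<Longrightarrow> w \<in> carrier_vec N \<Longrightarrow> i < N \<Longrightarrow> component_mult v w $ i = v $ i * w $ i"
  by (auto simp: component_mult_def)

lemma component_mult_carrier [simp]:
  "v \<in> carrier_vec N \<Longrightarrow> w \<in> carrier_vec N \<Longrightarrow> component_mult v w \<in> carrier_vec N"
  by (auto simp: component_mult_def)

section \<open>Homomorphisms and embeddings\<close>

lemma star_homD:
  assumes "star_hom A B \<pi>"
  shows "x \<in> carrier A \<Longrightarrow> \<pi> x \<in> carrier B"
    "x \<in> carrier A \<Longrightarrow> y \<in> carrier A \<Longrightarrow> \<pi> (x \<oplus>\<^bsub>A\<^esub> y) = \<pi> x \<oplus>\<^bsub>B\<^esub> \<pi> y"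
    "x \<in> carrier A \<Longrightarrow> \<pi> (c \<odot>\<^bsub>A\<^esub> x) = c \<odot>\<^bsub>B\<^esub> \<pi> x"
    "x \<in> carrier A \<Longrightarrow> y \<in> carrier A \<Longrightarrow> \<pi> (x \<otimes>\<^bsub>A\<^esub> y) = \<pi> x \<otimes>\<^bsub>B\<^esub> \<pi> y"
    "x \<in> carrier A \<Longrightarrow> \<pi> (star A x) = star B (\<pi> x)"
  using assms by (auto simp: star_hom_def)

lemma star_hom_comp:
  assumes "star_hom A B f" "star_hom B C g"
  shows "star_hom A C (g \<circ> f)"
  using assms by (auto simp: star_hom_def Pi_iff)

lemma star_embeds_trans:
  assumes "star_embeds A B" "star_embeds B C"
  shows "star_embeds A C"
proof -
  obtain f g where f: "star_hom A B f" "inj_on f (carrier A)" and g: "star_hom B C g" "inj_on g (carrier B)"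
    using assms by (auto simp: star_embeds_def)
  have "inj_on g (f ` carrier A)" using g(2) by (rule inj_on_subset) (use star_homD(1)[OF f(1)] in auto)
  then show ?thesis
    using star_hom_comp[OF f(1) g(1)] comp_inj_on[OF f(2)] unfolding star_embeds_def by blast
qed

lemma star_isomorphic_embeds: "star_isomorphic A B \<Longrightarrow> star_embeds A B"
  by (auto simp: star_isomorphic_def star_embeds_def bij_betw_def)

text \<open>Padding with zeros, which preserves the unit only for \<open>k = N\<close>; embeddings
  are allowed to be non-unital.\<close>

lemma classical_embeds_mono:
  assumes "k \<le> N"
  shows "star_embeds (classical_algebra k) (classical_algebra N)"
proof -
  define f where "f v = vec N (\<lambda>i. if i < k then v $ i else 0)" for v :: "complex vec"
  have "star_hom (classical_algebra k) (classical_algebra N) f"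
    by (auto simp: star_hom_def f_def component_mult_def intro!: eq_vecI)
  moreover have "inj_on f (carrier_vec k)"
  proof (rule inj_onI, rule eq_vecI)
    fix v w i assume v: "v \<in> carrier_vec k" and w: "w \<in> carrier_vec k" and eq: "f v = f w" and "i < dim_vec w"
    then have "i < k" by auto
    then show "v $ i = w $ i" using arg_cong[OF eq, of "\<lambda>x. x $ i"] assms by (simp add: f_def)
  qed auto
  ultimately show ?thesis by (auto simp: star_embeds_def)
qed

text \<open>The images of the \<open>N\<close> minimal projections have pairwise disjoint nonempty supports.\<close>

lemma classical_embeds_le:
  assumes "star_embeds (classical_algebra N) (classical_algebra k)"
  shows "N \<le> k"
proof -
  obtain f where f: "star_hom (classical_algebra N) (classical_algebra k) f" and inj: "inj_on f (carrier_vec N)"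
    using assms by (auto simp: star_embeds_def)
  note h = star_homD[OF f, simplified]
  have f0: "f (0\<^sub>v N) = 0\<^sub>v k"
  proof -
    have "f (0 \<cdot>\<^sub>v 0\<^sub>v N) = 0 \<cdot>\<^sub>v f (0\<^sub>v N)" by (rule h(3)) simp
    moreover have "0 \<cdot>\<^sub>v 0\<^sub>v N = (0\<^sub>v N :: complex vec)" by (rule eq_vecI) auto
    moreover have "0 \<cdot>\<^sub>v f (0\<^sub>v N) = 0\<^sub>v k" using h(1)[of "0\<^sub>v N"] by (intro eq_vecI) auto
    ultimately show ?thesis by simp
  qed
  have "\<exists>j<k. f (unit_vec N i) $ j \<noteq> 0" if i: "i < N" for i
  proof (rule ccontr)
    assume "\<not> ?thesis"
    then have "f (unit_vec N i) = 0\<^sub>v k" using h(1)[of "unit_vec N i"] by (intro eq_vecI) auto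
    then have "unit_vec N i = (0\<^sub>v N :: complex vec)"
      using inj_onD[OF inj, of "unit_vec N i" "0\<^sub>v N"] f0 by simp
    then have "unit_vec N i $ i = (0 :: complex)" using i by simp
    then show False using i by simp
  qed
  then obtain j where j: "\<And>i. i < N \<Longrightarrow> j i < k" "\<And>i. i < N \<Longrightarrow> f (unit_vec N i) $ j i \<noteq> 0" by metis
  have "inj_on j {..<N}"
  proof (rule inj_onI, rule ccontr)
    fix a b assume ab: "a \<in> {..<N}" "b \<in> {..<N}" "j a = j b" "a \<noteq> b"
    have "component_mult (unit_vec N a) (unit_vec N b) = (0\<^sub>v N :: complex vec)"
      using ab by (intro eq_vecI) (auto simp: component_mult_def)
    then have "component_mult (f (unit_vec N a)) (f (unit_vec N b)) = 0\<^sub>v k"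
      using h(4)[of "unit_vec N a" "unit_vec N b"] f0 by simp
    then have "f (unit_vec N a) $ j a * f (unit_vec N b) $ j a = 0"
      using component_mult_index[of "f (unit_vec N a)" k "f (unit_vec N b)" "j a"] h(1) j(1)[of a] ab by simp
    then show False using j(2)[of a] j(2)[of b] ab by simp
  qed
  then show ?thesis using card_inj_on_le[of j "{..<N}" "{..<k}"] j(1) by auto
qed

lemma projection_sum_mult:
  assumes S: "star_subalgebra n S" and p: "projection_family n S k p"
  shows "i < k \<Longrightarrow> mat_sum n k (\<lambda>j. a j \<cdot>\<^sub>m p j) * p i = a i \<cdot>\<^sub>m p i"
    "mat_sum n k (\<lambda>j. a j \<cdot>\<^sub>m p j) * mat_sum n k (\<lambda>j. b j \<cdot>\<^sub>m p j) = mat_sum n k (\<lambda>j. (a j * b j) \<cdot>\<^sub>m p j)"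
proof -
  have c [simp]: "p j \<in> carrier_mat n n" if "j < k" for j
    using projection_familyD(1)[OF p that] star_subalgebra_carrier[OF S] by blast
  have *: "mat_sum n k (\<lambda>j. a j \<cdot>\<^sub>m p j) * p i = a i \<cdot>\<^sub>m p i" if i: "i < k" for i
  proof -
    have "mat_sum n k (\<lambda>j. a j \<cdot>\<^sub>m p j) * p i = mat_sum n k (\<lambda>j. (a j \<cdot>\<^sub>m p j) * p i)"
      using i by (intro mat_sum_mult_right) auto
    also have "\<dots> = (a i \<cdot>\<^sub>m p i) * p i"
      using i projection_familyD[OF p] by (intro mat_sum_single) (auto simp: square_simps[where n = n])
    finally show ?thesis using i projection_familyD(3)[OF p] by (simp add: square_simps[where n = n])
  qed
  then show "i < k \<Longrightarrow> mat_sum n k (\<lambda>j. a j \<cdot>\<^sub>m p j) * p i = a i \<cdot>\<^sub>m p i" .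
  let ?A = "mat_sum n k (\<lambda>j. a j \<cdot>\<^sub>m p j)"
  have "?A * mat_sum n k (\<lambda>j. b j \<cdot>\<^sub>m p j) = mat_sum n k (\<lambda>j. ?A * (b j \<cdot>\<^sub>m p j))"
    by (intro mat_sum_mult_left) auto
  also have "\<dots> = mat_sum n k (\<lambda>j. (a j * b j) \<cdot>\<^sub>m p j)"
    by (rule mat_sum_cong) (simp add: mult_smult_distrib[of _ n n _ n] * smult_smult_times mult.commute)
  finally show "?A * mat_sum n k (\<lambda>j. b j \<cdot>\<^sub>m p j) = mat_sum n k (\<lambda>j. (a j * b j) \<cdot>\<^sub>m p j)" .
qed

text \<open>Coordinates with respect to the projections spanning the image of \<pi> give the
  isomorphism. It is onto because these projections belong to the image.\<close>

lemma transmittable_classical: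
  assumes n: "0 < n" and ch: "channel n m \<Phi>" and Q: "zero_error_quantum_capacity n m \<Phi> = 0"
    and B: "transmittable n m \<Phi> B"
  shows "\<exists>k. zero_error_code n m \<Phi> k \<and> star_isomorphic B (classical_algebra k)"
proof -
  obtain \<pi> where hom: "star_hom B (op_algebra n) \<pi>" and inj: "inj_on \<pi> (carrier B)"
    and corr: "correctable n m \<Phi> (\<pi> ` carrier B)" (is "correctable _ _ _ ?S")
    using B unfolding transmittable_def by blast
  note h = star_homD[OF hom, simplified]
  have S: "star_subalgebra n ?S" using corr by (simp add: correctable_def)
  obtain k p where p: "projection_family n ?S k p" and code: "zero_error_code n m \<Phi> k"
    and span: "\<forall>X\<in>?S. \<exists>c. X = mat_sum n k (\<lambda>j. c j \<cdot>\<^sub>m p j)"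
    using correctable_spanned_by_projections[OF n ch Q corr] by blast
  define D where "D a = mat_sum n k (\<lambda>j. a j \<cdot>\<^sub>m p j)" for a
  have c [simp]: "p j \<in> carrier_mat n n" if "j < k" for j
    using projection_familyD(1)[OF p that] star_subalgebra_carrier[OF S] by blast
  have DS: "D a \<in> ?S" for a
    unfolding D_def by (intro star_subalgebra_mat_sum[OF S] star_subalgebra_smult[OF S] projection_familyD(1)[OF p])
  have D_cong: "D a = D b" if "\<And>j. j < k \<Longrightarrow> a j = b j" for a b
    unfolding D_def by (rule mat_sum_cong) (simp add: that)
  have D_inj: "a j = b j" if eq: "D a = D b" and j: "j < k" for a b j
  proof -
    have "a j \<cdot>\<^sub>m p j = b j \<cdot>\<^sub>m p j"
      using arg_cong[OF eq, of "\<lambda>X. X * p j"] projection_sum_mult(1)[OF S p j] by (simp add: D_def)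
    then show ?thesis using projection_familyD(4)[OF p j] j by (intro smult_right_cancel_mat[of "p j" n n]) auto
  qed
  \<comment> \<open>Chosen coefficients are unique below \<open>k\<close> by \<open>D_inj\<close>
    and arbitrary beyond, so \<tau> below cuts them to a vector of length \<open>k\<close>.\<close>
  obtain C where C: "\<And>X. X \<in> ?S \<Longrightarrow> X = D (C X)"
    using span unfolding D_def by metis
  have CD: "C (D a) j = a j" if "j < k" for a j
    using D_inj[OF C[OF DS, symmetric] that] .
  have Ceq: "C X j = a j" if "X = D a" "j < k" for X a j using CD that by simp
  have D_add: "D a + D b = D (\<lambda>j. a j + b j)" for a b
    unfolding D_def mat_sum_def
    by (rule eq_matI) (use carrier_matD[OF c] in \<open>auto simp: algebra_simps sum.distrib\<close>)
  have D_smult: "t \<cdot>\<^sub>m D a = D (\<lambda>j. t * a j)" for t a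
    unfolding D_def mat_sum_def
    by (rule eq_matI) (use carrier_matD[OF c] in \<open>auto simp: algebra_simps sum_distrib_left\<close>)
  have D_mult: "D a * D b = D (\<lambda>j. a j * b j)" for a b
    unfolding D_def by (rule projection_sum_mult(2)[OF S p])
  have D_adj: "mat_adjoint (D a) = D (\<lambda>j. cnj (a j))" for a
    unfolding D_def using projection_familyD(2)[OF p]
    by (subst mat_sum_adjoint) (auto intro!: mat_sum_cong)
  define \<tau> where "\<tau> x = vec k (C (\<pi> x))" for x
  have \<pi>S: "\<pi> x \<in> ?S" if "x \<in> carrier B" for x using that by blast
  have \<tau>: "\<tau> x $ j = a j" if "\<pi> x = D a" "j < k" for x a j
    using Ceq[OF that] that(2) by (simp add: \<tau>_def)
  have \<tau>D: "\<pi> x = D (($) (\<tau> x))" if "x \<in> carrier B" for x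
    using C[OF \<pi>S[OF that]] by (subst C[OF \<pi>S[OF that]], intro D_cong) (simp add: \<tau>_def)
  have \<tau>c: "\<tau> x \<in> carrier_vec k" for x by (simp add: \<tau>_def)
  note [simp] = carrier_vecD[OF \<tau>c]
  have "star_hom B (classical_algebra k) \<tau>"
    unfolding star_hom_def classical_algebra_simps
  proof (intro conjI ballI allI funcsetI)
    fix x assume x: "x \<in> carrier B"
    show "\<tau> x \<in> carrier_vec k" by (rule \<tau>c)
    have "\<pi> (star B x) = D (\<lambda>j. cnj (\<tau> x $ j))" using h(5)[OF x] \<tau>D[OF x] D_adj by metis
    from \<tau>[OF this] show "\<tau> (star B x) = conjugate (\<tau> x)" by (intro eq_vecI) auto
    fix t
    have "\<pi> (t \<odot>\<^bsub>B\<^esub> x) = D (\<lambda>j. t * \<tau> x $ j)" using h(3)[OF x] \<tau>D[OF x] D_smult by metis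
    from \<tau>[OF this] show "\<tau> (t \<odot>\<^bsub>B\<^esub> x) = t \<cdot>\<^sub>v \<tau> x" by (intro eq_vecI) auto
  next
    fix x y assume x: "x \<in> carrier B" and y: "y \<in> carrier B"
    have "\<pi> (x \<oplus>\<^bsub>B\<^esub> y) = D (\<lambda>j. \<tau> x $ j + \<tau> y $ j)" using h(2)[OF x y] \<tau>D[OF x] \<tau>D[OF y] D_add by metis
    from \<tau>[OF this] show "\<tau> (x \<oplus>\<^bsub>B\<^esub> y) = \<tau> x + \<tau> y" by (intro eq_vecI) auto
    have "\<pi> (x \<otimes>\<^bsub>B\<^esub> y) = D (\<lambda>j. \<tau> x $ j * \<tau> y $ j)" using h(4)[OF x y] \<tau>D[OF x] \<tau>D[OF y] D_mult by metis
    from \<tau>[OF this] show "\<tau> (x \<otimes>\<^bsub>B\<^esub> y) = component_mult (\<tau> x) (\<tau> y)"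
      by (intro eq_vecI) (auto simp: component_mult_index[OF \<tau>c \<tau>c] carrier_vecD[OF component_mult_carrier[OF \<tau>c \<tau>c]])
  qed
  moreover have "bij_betw \<tau> (carrier B) (carrier_vec k)"
  proof (rule bij_betw_imageI)
    show "inj_on \<tau> (carrier B)"
    proof (rule inj_onI)
      fix x y assume x: "x \<in> carrier B" and y: "y \<in> carrier B" and eq: "\<tau> x = \<tau> y"
      have "\<pi> x = \<pi> y" using \<tau>D[OF x] \<tau>D[OF y] eq by simp
      then show "x = y" using inj x y by (auto dest: inj_onD)
    qed
    show "\<tau> ` carrier B = carrier_vec k"
    proof (intro equalityI subsetI)
      fix v :: "complex vec" assume v: "v \<in> carrier_vec k"
      obtain x where x: "x \<in> carrier B" "D (($) v) = \<pi> x" using DS[of "($) v"] by auto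
      have "\<tau> x = v" using \<tau>[OF x(2)[symmetric]] v by (intro eq_vecI) auto
      then show "v \<in> \<tau> ` carrier B" using x(1) by auto
    qed (use \<tau>c in auto)
  qed
  ultimately have "star_isomorphic B (classical_algebra k)" by (auto simp: star_isomorphic_def)
  then show ?thesis using code by blast
qed

text \<open>The supremum norm; \<open>0 < N\<close> keeps the set under \<open>Max\<close>
  nonempty.\<close>

lemma cstar_norm_classical_algebra:
  assumes N: "0 < N"
  shows "cstar_norm (classical_algebra N) (\<lambda>v. Max ((\<lambda>i. cmod (v $ i)) ` {..<N}))" (is "cstar_norm _ ?\<nu>")
proof -
  have le: "cmod (v $ i) \<le> ?\<nu> v" if "i < N" for v i using that by (intro Max_ge) auto
  have leI: "?\<nu> v \<le> t" if "\<And>i. i < N \<Longrightarrow> cmod (v $ i) \<le> t" for v t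
    using that N by (subst Max_le_iff) auto
  have att: "\<exists>i<N. ?\<nu> v = cmod (v $ i)" for v
  proof -
    have "?\<nu> v \<in> (\<lambda>i. cmod (v $ i)) ` {..<N}" using N by (intro Max_in) auto
    then show ?thesis by auto
  qed
  have nn: "0 \<le> ?\<nu> v" for v using att[of v] by auto
  show ?thesis
    unfolding cstar_norm_def classical_algebra_simps
  proof (intro conjI ballI allI)
    fix v :: "complex vec" assume v: "v \<in> carrier_vec N"
    show "0 \<le> ?\<nu> v" by (rule nn)
    show "?\<nu> v = 0 \<longleftrightarrow> v = 0\<^sub>v N"
    proof
      assume 0: "?\<nu> v = 0"
      have "v $ i = 0" if "i < N" for i using le[OF that, of v] unfolding 0 by simp
      then show "v = 0\<^sub>v N" using v by (intro eq_vecI) auto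
    next
      assume "v = 0\<^sub>v N"
      then show "?\<nu> v = 0" using att[of v] by auto
    qed
    show "?\<nu> (component_mult (conjugate v) v) = (?\<nu> v)\<^sup>2"
    proof (rule antisym)
      have e: "cmod (component_mult (conjugate v) v $ i) = (cmod (v $ i))\<^sup>2" if "i < N" for i
        using that v by (simp add: component_mult_def norm_mult power2_eq_square)
      show "?\<nu> (component_mult (conjugate v) v) \<le> (?\<nu> v)\<^sup>2"
        by (rule leI) (simp only: e power_mono[OF le norm_ge_zero])
      obtain i where i: "i < N" "?\<nu> v = cmod (v $ i)" using att by blast
      show "(?\<nu> v)\<^sup>2 \<le> ?\<nu> (component_mult (conjugate v) v)"
        using le[OF i(1), of "component_mult (conjugate v) v"] unfolding i(2) e[OF i(1)] .
    qed
    fix c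
    show "?\<nu> (c \<cdot>\<^sub>v v) = cmod c * ?\<nu> v"
    proof (rule antisym)
      have e: "cmod ((c \<cdot>\<^sub>v v) $ i) = cmod c * cmod (v $ i)" if "i < N" for i
        using that v by (simp add: norm_mult)
      show "?\<nu> (c \<cdot>\<^sub>v v) \<le> cmod c * ?\<nu> v"
        by (rule leI) (simp only: e mult_left_mono[OF le norm_ge_zero])
      obtain i where i: "i < N" "?\<nu> v = cmod (v $ i)" using att by blast
      show "cmod c * ?\<nu> v \<le> ?\<nu> (c \<cdot>\<^sub>v v)"
        using le[OF i(1), of "c \<cdot>\<^sub>v v"] unfolding i(2) e[OF i(1)] .
    qed
    fix w :: "complex vec" assume w: "w \<in> carrier_vec N"
    show "?\<nu> (v + w) \<le> ?\<nu> v + ?\<nu> w"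
    proof (rule leI)
      fix i assume i: "i < N"
      have "cmod ((v + w) $ i) \<le> cmod (v $ i) + cmod (w $ i)" using i v w by (simp add: norm_triangle_ineq)
      also have "\<dots> \<le> ?\<nu> v + ?\<nu> w" by (intro add_mono le i)
      finally show "cmod ((v + w) $ i) \<le> ?\<nu> v + ?\<nu> w" .
    qed
    show "?\<nu> (component_mult v w) \<le> ?\<nu> v * ?\<nu> w"
    proof (rule leI)
      fix i assume i: "i < N"
      have "cmod (component_mult v w $ i) = cmod (v $ i) * cmod (w $ i)" using i v w by (simp add: norm_mult)
      also have "\<dots> \<le> ?\<nu> v * ?\<nu> w" by (intro mult_mono le i nn norm_ge_zero)
      finally show "cmod (component_mult v w $ i) \<le> ?\<nu> v * ?\<nu> w" .
    qed
  qed
qed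

lemma fd_cstar_classical_algebra:
  assumes N: "0 < N"
  shows "fd_cstar_algebra (classical_algebra N)"
proof -
  let ?A = "classical_algebra N"
  have abg: "abelian_group ?A"
  proof (rule abelian_groupI)
    fix x assume "x \<in> carrier ?A"
    then show "\<exists>y\<in>carrier ?A. y \<oplus>\<^bsub>?A\<^esub> x = \<zero>\<^bsub>?A\<^esub>"
      by (intro bexI[of _ "- x"]) auto
  qed (auto intro!: eq_vecI)
  have mon: "Group.monoid ?A"
    by (rule Group.monoid.intro) (auto simp: component_mult_def intro!: eq_vecI)
  have rng: "ring ?A"
    by (rule ringI[OF abg mon]) (auto simp: component_mult_def algebra_simps intro!: eq_vecI)
  have md: "Module.module (class_ring :: complex ring) ?A"
    by (rule Module.module.intro[OF class_cring.cring_axioms abg], unfold_locales)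
       (auto simp: algebra_simps intro!: eq_vecI)
  have vs: "vectorspace (class_ring :: complex ring) ?A"
    by (rule vectorspace.intro[OF md class_field])
  interpret V: vec_space "TYPE(complex)" N .
  \<comment> \<open>The two vector spaces are different records on the same vectors, and finite
    dimension is carried over along the identity.\<close>
  have lin: "linear_map (class_ring :: complex ring) V.V ?A (\<lambda>x. x)"
    by (rule linear_map.intro[OF V.vectorspace_axioms vs mod_hom.intro[OF V.module_axioms md]], unfold_locales)
       (auto simp: LinearCombinations.module_hom_def module_vec_simps)
  have fin: "vectorspace.fin_dim (class_ring :: complex ring) ?A"
    by (rule linear_map.image_fin_dim[OF lin V.fin_dim]) (simp add: module_vec_simps)
  have sta: "star_algebra ?A"
    by (rule star_algebra.intro[OF rng vs], unfold_locales)
       (auto simp: component_mult_def conjugate_add_vec conjugate_smult_vec algebra_simps intro!: eq_vecI)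
  have nz: "\<one>\<^bsub>?A\<^esub> \<noteq> \<zero>\<^bsub>?A\<^esub>"
  proof
    assume "\<one>\<^bsub>?A\<^esub> = \<zero>\<^bsub>?A\<^esub>"
    then have "vec N (\<lambda>_. 1) $ 0 = (0\<^sub>v N $ 0 :: complex)" by simp
    then show False using N by simp
  qed
  show ?thesis
    by (rule fd_cstar_algebra.intro[OF sta], unfold_locales)
      (use fin nz cstar_norm_classical_algebra[OF N] in auto)
qed

section \<open>Transmitting the classical algebra\<close>

lemma mat_trace_mat_sum_mult:
  assumes X: "X \<in> carrier_mat n n" and f: "\<And>l. l < k \<Longrightarrow> f l \<in> carrier_mat n n"
  shows "mat_trace (mat_sum n k f * X) = (\<Sum>l<k. mat_trace (f l * X))"
  using f
proof (induction k)
  case (Suc k)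
  then show ?case using X by (simp add: mat_sum_Suc square_simps[where n = n] mat_trace_add[of _ n])
qed (use X in \<open>simp add: square_simps[where n = n]\<close>)

text \<open>Writing each support projection as a multiple of its state, on either side, carries the
  orthogonality of the states over to the projections, which then form one joint
  measurement.\<close>

lemma orthogonal_support_projections:
  assumes \<sigma>: "\<forall>i<N. state m (\<sigma> i)"
    and orth: "\<forall>i<N. \<forall>j<N. i \<noteq> j \<longrightarrow> \<sigma> i * \<sigma> j = 0\<^sub>m m m"
  obtains q where "\<forall>i<N. q i \<in> carrier_mat m m \<and> mat_adjoint (q i) = q i \<and> q i * q i = q i \<and>
      q i * \<sigma> i = \<sigma> i"
    "\<forall>i<N. \<forall>j<N. i \<noteq> j \<longrightarrow> q i * \<sigma> j = 0\<^sub>m m m \<and> q i * q j = 0\<^sub>m m m"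
proof -
  have psd: "psd m (\<sigma> i)" if "i < N" for i using \<sigma> that by (simp add: state_def)
  note c = psd_carrier[OF psd]
  have "\<exists>q g. q \<in> carrier_mat m m \<and> g \<in> carrier_mat m m \<and> mat_adjoint q = q \<and> q * q = q \<and>
      q = \<sigma> i * g \<and> q = g * \<sigma> i \<and> q * \<sigma> i = \<sigma> i" if "i < N" for i
    by (rule support_projection[OF c[OF that] psd_hermitian[OF psd[OF that]]])
  then obtain q g where qg: "\<forall>i<N. q i \<in> carrier_mat m m \<and> g i \<in> carrier_mat m m \<and>
      mat_adjoint (q i) = q i \<and> q i * q i = q i \<and>
      q i = \<sigma> i * g i \<and> q i = g i * \<sigma> i \<and> q i * \<sigma> i = \<sigma> i" by metis
  have q: "q i \<in> carrier_mat m m" "g i \<in> carrier_mat m m" "mat_adjoint (q i) = q i" "q i * q i = q i"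
    "q i * \<sigma> i = \<sigma> i" if "i < N" for i using qg[rule_format, OF that] by blast+
  have qg: "q i = g i * \<sigma> i" "q i = \<sigma> i * g i" if "i < N" for i using qg[rule_format, OF that] by blast+
  have q\<sigma>: "q i * \<sigma> j = 0\<^sub>m m m" if ij: "i < N" "j < N" "i \<noteq> j" for i j
  proof -
    have "q i * \<sigma> j = g i * (\<sigma> i * \<sigma> j)"
      unfolding qg(1)[OF ij(1)] using q[OF ij(1)] c ij by (intro assoc_mult_square[of _ m]) auto
    then show ?thesis using q[OF ij(1)] ij orth by (simp add: square_simps[where n = m])
  qed
  have qq: "q i * q j = 0\<^sub>m m m" if ij: "i < N" "j < N" "i \<noteq> j" for i j
  proof -
    have "q i * q j = (q i * \<sigma> j) * g j"
      unfolding qg(2)[OF ij(2)] using q[OF ij(1)] q[OF ij(2)] c ij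
      by (intro assoc_mult_square[of _ m, symmetric]) auto
    then show ?thesis using q[OF ij(2)] q\<sigma>[OF ij] by (simp add: square_simps[where n = m])
  qed
  show ?thesis by (rule that[of q]) (simp_all add: q q\<sigma> qq)
qed

lemma zero_smult_vec: "v \<in> carrier_vec n \<Longrightarrow> (0 :: complex) \<cdot>\<^sub>v v = 0\<^sub>v n"
  by (rule eq_vecI) auto

text \<open>For an isometry \<open>V\<close> the map \<open>M \<mapsto> V M V\<^sup>*\<close> is a
  star-homomorphism, with compression by \<open>V\<close> as left inverse. Applied to diagonal
  \<open>M\<close>, it embeds the classical algebra.\<close>

lemma diag_sandwich:
  fixes V :: "complex mat"
  assumes V: "V \<in> carrier_mat n N" and VV: "mat_adjoint V * V = 1\<^sub>m N" and M: "M \<in> carrier_mat N N"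
  shows "V * M * mat_adjoint V \<in> carrier_mat n n"
    "mat_adjoint (V * M * mat_adjoint V) = V * mat_adjoint M * mat_adjoint V"
    "mat_adjoint V * (V * M * mat_adjoint V) * V = M"
    "M' \<in> carrier_mat N N \<Longrightarrow> (V * M * mat_adjoint V) * (V * M' * mat_adjoint V) = V * (M * M') * mat_adjoint V"
    "M' \<in> carrier_mat N N \<Longrightarrow> V * M * mat_adjoint V + V * M' * mat_adjoint V = V * (M + M') * mat_adjoint V"
    "c \<cdot>\<^sub>m (V * M * mat_adjoint V) = V * (c \<cdot>\<^sub>m M) * mat_adjoint V"
proof -
  note V' = mat_adjoint_carrier[OF V]
  note VM = mult_carrier_mat[OF V M]
  have MV': "M * mat_adjoint V \<in> carrier_mat N n" by (rule mult_carrier_mat[OF M V'])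
  show c: "V * M * mat_adjoint V \<in> carrier_mat n n" by (rule mult_carrier_mat[OF VM V'])
  show "mat_adjoint (V * M * mat_adjoint V) = V * mat_adjoint M * mat_adjoint V"
    using mat_adjoint_mult[OF VM V'] mat_adjoint_mult[OF V M] assoc_mult_mat[OF V mat_adjoint_carrier[OF M] V'] by simp
  have l: "mat_adjoint V * (V * M) = M"
    using assoc_mult_mat[OF V' V M] unfolding VV left_mult_one_mat[OF M] by (rule sym)
  have l': "mat_adjoint V * (V * M * mat_adjoint V) = M * mat_adjoint V"
    using assoc_mult_mat[OF V' VM V'] unfolding l by (rule sym)
  show "mat_adjoint V * (V * M * mat_adjoint V) * V = M"
    unfolding l' using assoc_mult_mat[OF M V' V] unfolding VV right_mult_one_mat[OF M] .
  show "c \<cdot>\<^sub>m (V * M * mat_adjoint V) = V * (c \<cdot>\<^sub>m M) * mat_adjoint V"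
    by (simp only: mult_smult_distrib[OF V M] mult_smult_assoc_mat[OF VM V'])
  assume M': "M' \<in> carrier_mat N N"
  note VM' = mult_carrier_mat[OF V M']
  show "V * M * mat_adjoint V + V * M' * mat_adjoint V = V * (M + M') * mat_adjoint V"
    by (simp only: mult_add_distrib_mat[OF V M M'] add_mult_distrib_mat[OF VM VM' V'])
  have l2: "mat_adjoint V * (V * M') = M'"
    using assoc_mult_mat[OF V' V M'] unfolding VV left_mult_one_mat[OF M'] by (rule sym)
  have l2': "mat_adjoint V * (V * M' * mat_adjoint V) = M' * mat_adjoint V"
    using assoc_mult_mat[OF V' VM' V'] unfolding l2 by (rule sym)
  have "(V * M * mat_adjoint V) * (V * M' * mat_adjoint V) = V * M * (M' * mat_adjoint V)"
    using assoc_mult_mat[OF VM V' mult_carrier_mat[OF VM' V']] unfolding l2' .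
  also have "\<dots> = V * M * M' * mat_adjoint V" by (rule assoc_mult_mat[OF VM M' V', symmetric])
  also have "V * M * M' = V * (M * M')" by (rule assoc_mult_mat[OF V M M'])
  finally show "(V * M * mat_adjoint V) * (V * M' * mat_adjoint V) = V * (M * M') * mat_adjoint V" .
qed

lemma mat_trace_diag_mult:
  assumes "M \<in> carrier_mat N N"
  shows "mat_trace (mat_diag N f * M) = (\<Sum>i<N. f i * M $$ (i, i))"
  using assms by (simp add: mat_diag_mult_left[OF assms] mat_trace_def)

lemma classical_transmittable:
  assumes n: "0 < n" and ch: "channel n m \<Phi>" and code: "zero_error_code n m \<Phi> N" and N: "0 < N"
  shows "transmittable n m \<Phi> (classical_algebra N)"
proof -
  obtain \<rho> where states: "\<forall>i<N. state n (\<rho> i)" "\<forall>i<N. state m (\<Phi> (\<rho> i))"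
    "\<forall>i<N. \<forall>j<N. i \<noteq> j \<longrightarrow> \<Phi> (\<rho> i) * \<Phi> (\<rho> j) = 0\<^sub>m m m"
    by (rule zero_error_codeE[OF ch code])
  note \<rho> = states(1)[rule_format] and \<sigma> = states(2)[rule_format]
  obtain q where projs: "\<forall>i<N. q i \<in> carrier_mat m m \<and> mat_adjoint (q i) = q i \<and> q i * q i = q i \<and>
      q i * \<Phi> (\<rho> i) = \<Phi> (\<rho> i)"
    "\<forall>i<N. \<forall>j<N. i \<noteq> j \<longrightarrow> q i * \<Phi> (\<rho> j) = 0\<^sub>m m m \<and> q i * q j = 0\<^sub>m m m"
    by (rule orthogonal_support_projections[OF states(2,3)])
  have q: "q i \<in> carrier_mat m m" "mat_adjoint (q i) = q i" "q i * q i = q i"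
    and q\<sigma>: "q i * \<Phi> (\<rho> i) = \<Phi> (\<rho> i)" if "i < N" for i
    using projs(1) that by auto
  have q\<sigma>': "q i * \<Phi> (\<rho> j) = 0\<^sub>m m m" and qq: "q i * q j = 0\<^sub>m m m" if "i < N" "j < N" "i \<noteq> j" for i j
    using projs(2) that by auto
  note [simp] = q(1)
  have psd\<rho>: "psd n (\<rho> i)" if "i < N" for i using \<rho>[OF that] by (simp add: state_def)
  note \<rho>c = psd_carrier[OF psd\<rho>]
  \<comment> \<open>The output projections pulled back to the input side, where they separate the
    code states with certainty.\<close>
  define F where "F i = map_adjoint n m \<Phi> (q i)" for i
  have Fc: "F i \<in> carrier_mat n n" if "i < N" for i
    unfolding F_def by (rule map_adjoint_carrier[OF channel_linear[OF ch] q(1)[OF that]])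
  have F_tr: "mat_trace (F i * X) = mat_trace (q i * \<Phi> X)" if "i < N" "X \<in> carrier_mat n n" for i X
    unfolding F_def by (rule map_adjoint_trace[OF channel_linear[OF ch] q(1)[OF that(1)] that(2)])
  have F_tests: "psd n (F i)" "psd n (1\<^sub>m n - F i)" if "i < N" for i
    unfolding F_def by (rule map_adjoint_test_operator[OF ch q(1,2,3)[OF that]])+
  have F_tr': "mat_trace (F i * \<rho> j) = (if i = j then 1 else 0)" if ij: "i < N" "j < N" for i j
    using F_tr[OF ij(1) \<rho>c[OF ij(2)]] q\<sigma>[OF ij(1)] q\<sigma>'[OF ij] \<sigma>[OF ij(1)] by (auto simp: state_def)
  have F\<rho>: "F i * \<rho> i = \<rho> i" if i: "i < N" for i
  proof -
    \<comment> \<open>The zero matrix plays the operator that the test rejects, so the argument also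
      covers \<open>N = 1\<close>.\<close>
    have "mat_trace (F i * 0\<^sub>m n n) = 0" using Fc[OF i] by simp
    then show ?thesis
      using test_operators_orthogonal(1)[OF F_tests[OF i] \<rho>[OF i] psd_zero _ \<open>mat_trace (F i * 0\<^sub>m n n) = 0\<close>] F_tr'[OF i i] by simp
  qed
  have F\<rho>': "F i * \<rho> j = 0\<^sub>m n n" "\<rho> j * \<rho> i = 0\<^sub>m n n" if ij: "i < N" "j < N" "i \<noteq> j" for i j
    using test_operators_orthogonal(2,3)[OF F_tests[OF ij(1)] \<rho>[OF ij(1)] psd\<rho>[OF ij(2)]]
      F_tr'[OF ij(1,1)] F_tr'[OF ij(1,2)] ij(3) by simp_all
  have "\<exists>V\<in>carrier_mat n N. mat_adjoint V * V = 1\<^sub>m N \<and> (\<forall>i<N. \<exists>x\<in>carrier_vec n. col V i = \<rho> i *\<^sub>v x)"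
    by (rule orthonormal_range_vectors; rule \<rho>c psd_hermitian[OF psd\<rho>] state_nonzero[OF \<rho>] F\<rho>'(2)) auto
  then obtain V where V: "V \<in> carrier_mat n N" and VV: "mat_adjoint V * V = 1\<^sub>m N"
    and colV: "\<forall>i<N. \<exists>x\<in>carrier_vec n. col V i = \<rho> i *\<^sub>v x" by auto
  note V' = mat_adjoint_carrier[OF V]
  \<comment> \<open>The columns of \<open>V\<close> lie in the ranges of the code states;
    \<open>F i\<close> fixes the range of the i-th one and kills the others.\<close>
  have FV: "F i * V = V * mat_diag N (\<lambda>j. if j = i then 1 else 0)" if i: "i < N" for i
  proof -
    have "col (F i * V) j = (if j = i then 1 else 0) \<cdot>\<^sub>v col V j" if j: "j < N" for j
    proof -
      obtain x where x: "x \<in> carrier_vec n" "col V j = \<rho> j *\<^sub>v x" using colV j by blast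
      have "col (F i * V) j = (F i * \<rho> j) *\<^sub>v x"
        using col_mult2[OF Fc[OF i] V j] assoc_mult_mat_vec[OF Fc[OF i] \<rho>c[OF j] x(1)] by (simp add: x(2))
      then show ?thesis
        using F\<rho>[OF i] F\<rho>'(1)[OF i j] x mult_mat_vec_carrier[OF \<rho>c[OF j] x(1)]
        by (auto simp: zero_mult_vec zero_smult_vec[of _ n])
    qed
    note c = this
    have "(F i * V) $$ (a, j) = V $$ (a, j) * (if j = i then 1 else 0)" if "a < n" "j < N" for a j
      using arg_cong[OF c[OF that(2)], of "\<lambda>v. v $ a"] that V Fc[OF i] by auto
    then show ?thesis
      unfolding mat_diag_mult_right[OF V] using V Fc[OF i] by (intro eq_matI) (auto simp del: index_mult_mat(1))
  qed

  define \<pi> where "\<pi> x = V * mat_diag N (($) x) * mat_adjoint V" for x :: "complex vec"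
  note sw = diag_sandwich[OF V VV mat_diag_dim]
  have \<pi>c: "\<pi> x \<in> carrier_mat n n" for x unfolding \<pi>_def by (rule sw(1))
  have \<pi>_sand: "mat_adjoint V * \<pi> x * V = mat_diag N (($) x)" for x unfolding \<pi>_def by (rule sw(3))
  have \<pi>_add: "\<pi> x + \<pi> y = \<pi> (x + y)" if "x \<in> carrier_vec N" "y \<in> carrier_vec N" for x y
  proof -
    have "mat_diag N (($) x) + mat_diag N (($) y) = mat_diag N (($) (x + y))"
      by (rule eq_matI) (use that in \<open>auto simp: mat_diag_def\<close>)
    then show ?thesis unfolding \<pi>_def by (subst sw(5)) auto
  qed
  have \<pi>_smult: "c \<cdot>\<^sub>m \<pi> x = \<pi> (c \<cdot>\<^sub>v x)" if "x \<in> carrier_vec N" for x c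
  proof -
    have "c \<cdot>\<^sub>m mat_diag N (($) x) = mat_diag N (($) (c \<cdot>\<^sub>v x))"
      by (rule eq_matI) (use that in \<open>auto simp: mat_diag_def\<close>)
    then show ?thesis unfolding \<pi>_def by (subst sw(6)) auto
  qed
  have \<pi>_mult: "\<pi> x * \<pi> y = \<pi> (component_mult x y)" if "x \<in> carrier_vec N" "y \<in> carrier_vec N" for x y
  proof -
    have "mat_diag N (\<lambda>i. x $ i * y $ i) = mat_diag N (($) (component_mult x y))"
      using that by (intro mat_diag_cong) simp
    then show ?thesis unfolding \<pi>_def by (subst sw(4)) auto
  qed
  have \<pi>_adj: "mat_adjoint (\<pi> x) = \<pi> (conjugate x)" if "x \<in> carrier_vec N" for x
  proof -
    have "mat_diag N (\<lambda>i. cnj (x $ i)) = mat_diag N (($) (conjugate x))"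
      using that by (intro mat_diag_cong) simp
    then show ?thesis unfolding \<pi>_def by (subst sw(2)) (simp add: mat_adjoint_diag)
  qed
  have hom: "star_hom (classical_algebra N) (op_algebra n) \<pi>"
    by (auto simp: star_hom_def \<pi>c \<pi>_add \<pi>_smult \<pi>_mult \<pi>_adj)
  have inj: "inj_on \<pi> (carrier_vec N)"
  proof (rule inj_onI, rule eq_vecI)
    fix x y i assume x: "x \<in> carrier_vec N" and y: "y \<in> carrier_vec N" and eq: "\<pi> x = \<pi> y" and "i < dim_vec y"
    then have "i < N" by auto
    then show "x $ i = y $ i"
      using arg_cong[OF \<pi>_sand[of x, unfolded eq \<pi>_sand[of y]], of "\<lambda>M. M $$ (i, i)"] by (simp add: mat_diag_def)
  qed auto
  have zero: "0\<^sub>m n n = \<pi> (0\<^sub>v N)"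
    using \<pi>_smult[of "0\<^sub>v N" 0] zero_smult_mat[OF \<pi>c[of "0\<^sub>v N"]] by (simp add: zero_smult_vec[of _ N])
  have sub: "star_subalgebra n (\<pi> ` carrier_vec N)"
    unfolding star_subalgebra_def
    by (auto simp: \<pi>c \<pi>_add \<pi>_smult \<pi>_mult \<pi>_adj zero)
  \<comment> \<open>The range projection of \<open>V\<close> is the unit of the image, so
    \<open>V\<close> itself can serve as the inclusion of the code space.\<close>
  have \<pi>1: "V * mat_adjoint V = \<pi> (vec N (\<lambda>_. 1))"
  proof -
    have "mat_diag N (($) (vec N (\<lambda>_. 1))) = (mat_diag N (\<lambda>_. 1) :: complex mat)"
      by (intro mat_diag_cong) simp
    then show ?thesis using V by (simp add: \<pi>_def)
  qed
  define e where "e = mat_sum m N q"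
  have e: "e \<in> carrier_mat m m" "mat_adjoint e = e" "e * e = e"
  proof -
    show "e \<in> carrier_mat m m" by (simp add: e_def)
    show "mat_adjoint e = e" unfolding e_def using q(2) by (subst mat_sum_adjoint) (auto intro: mat_sum_cong)
    have "e * q i = q i" if i: "i < N" for i
      unfolding e_def using i q(3) qq
      by (subst mat_sum_mult_right) (auto simp: mat_sum_single[of N i "\<lambda>l. q l * q i"])
    then show "e * e = e" unfolding e_def by (subst mat_sum_mult_left) (auto intro: mat_sum_cong)
  qed
  \<comment> \<open>The outcome that none of the supports is found; \<open>recovery_map\<close>
    assigns it to index 0.\<close>
  define G where "G = 1\<^sub>m m - e"
  have G: "G \<in> carrier_mat m m" "mat_adjoint G = G" "G * G = G"
    unfolding G_def using e complement_projection[OF e(1,3)]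
    by (simp_all add: minus_carrier_mat square_simps[where n = m])
  define \<D> where "\<D> = recovery_map N q G"
  have qX: "mat_trace (mat_adjoint (q i) * X * q i) = mat_trace (q i * X)" if "i < N" "X \<in> carrier_mat m m" for i X
    using mat_trace_sandwich[OF q(1)[OF that(1)] q(1)[OF that(1)] that(2)] by (simp add: q that)
  have GX: "mat_trace (mat_adjoint G * X * G) = mat_trace X - (\<Sum>i<N. mat_trace (q i * X))" if X: "X \<in> carrier_mat m m" for X
  proof -
    have "mat_trace (mat_adjoint G * X * G) = mat_trace (G * X)"
      using mat_trace_sandwich[OF G(1) G(1) X] by (simp add: G)
    also have "\<dots> = mat_trace X - mat_trace (e * X)"
      unfolding G_def using e(1) X by (simp add: square_simps[where n = m] mat_trace_minus[of _ m])
    also have "mat_trace (e * X) = (\<Sum>i<N. mat_trace (q i * X))"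
      unfolding e_def by (rule mat_trace_mat_sum_mult[OF X]) simp
    finally show ?thesis .
  qed
  have \<D>: "channel m N \<D>"
    unfolding \<D>_def by (rule channel_recovery_map[OF N q(1) G(1)]) (simp_all add: qX GX)
  \<comment> \<open>Off-diagonal entries may be lost. The diagonal suffices, because the transmitted
    algebra is diagonal in the basis given by \<open>V\<close>.\<close>
  have diag: "\<D> (\<Phi> (V * Y * mat_adjoint V)) $$ (i, i) = Y $$ (i, i)" if Y: "Y \<in> carrier_mat N N" and i: "i < N" for Y i
  proof -
    let ?X = "V * Y * mat_adjoint V"
    have Xc: "?X \<in> carrier_mat n n" by (rule mult_three_carrier[OF V Y V'])
    note Zc = channel_carrier[OF ch Xc]
    have qZ: "mat_trace (q j * \<Phi> ?X) = Y $$ (j, j)" if j: "j < N" for j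
    proof -
      let ?E = "mat_diag N (\<lambda>a. if a = j then 1 else 0) :: complex mat"
      note FVc = mult_carrier_mat[OF Fc[OF j] V]
      have "F j * ?X = F j * V * Y * mat_adjoint V"
        using assoc_mult_mat[OF Fc[OF j] mult_carrier_mat[OF V Y] V'] assoc_mult_mat[OF Fc[OF j] V Y] by simp
      then have "mat_trace (q j * \<Phi> ?X) = mat_trace (F j * V * Y * mat_adjoint V)"
        using F_tr[OF j Xc] by simp
      also have "\<dots> = mat_trace (mat_adjoint V * (F j * V * Y))"
        by (rule mat_trace_comm[OF mult_carrier_mat[OF FVc Y] V'])
      also have "mat_adjoint V * (F j * V * Y) = ?E * Y"
        unfolding FV[OF j]
        using assoc_mult_mat[OF V' mult_carrier_mat[OF V mat_diag_dim] Y] assoc_mult_mat[OF V' V mat_diag_dim]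
        by (metis VV left_mult_one_mat mat_diag_dim)
      also have "mat_trace (?E * Y) = Y $$ (j, j)"
        unfolding mat_trace_diag_mult[OF Y] using j by (simp add: if_distrib if_distribR cong: if_cong)
      finally show ?thesis .
    qed
    \<comment> \<open>On the code space the outcomes \<open>q j\<close> exhaust the trace, so the
      correction term contributes nothing.\<close>
    have "mat_trace (\<Phi> ?X) = mat_trace Y"
      using channel_trace[OF ch Xc] channel_trace[OF channel_isometry[OF n V VV] Y] by simp
    also have "\<dots> = (\<Sum>j<N. mat_trace (q j * \<Phi> ?X))" using Y by (simp add: qZ mat_trace_def[of Y])
    finally have "mat_trace (mat_adjoint G * \<Phi> ?X * G) = 0" by (simp add: GX[OF Zc])
    then show ?thesis using i by (simp add: \<D>_def recovery_map_def qX[OF _ Zc] qZ)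
  qed
  have "correctable n m \<Phi> (\<pi> ` carrier_vec N)"
    unfolding correctable_def
  proof (intro conjI bexI exI ballI)
    show "star_subalgebra n (\<pi> ` carrier_vec N)" by (rule sub)
    show "V * mat_adjoint V \<in> \<pi> ` carrier_vec N" unfolding \<pi>1 by (rule imageI) simp
    fix X assume "X \<in> \<pi> ` carrier_vec N"
    then obtain x where x: "x \<in> carrier_vec N" and X: "X = \<pi> x" by blast
    have "component_mult (vec N (\<lambda>_. 1)) x = x" "component_mult x (vec N (\<lambda>_. 1)) = x"
      using x by (auto simp: component_mult_def)
    then show "V * mat_adjoint V * X = X" "X * (V * mat_adjoint V) = X"
      unfolding \<pi>1 X using \<pi>_mult x by simp_all
    show "map_adjoint N N (\<D> \<circ> restrict_code \<Phi> V) (mat_adjoint V * X * V) = mat_adjoint V * X * V"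
      unfolding X \<pi>_sand
    proof (rule map_adjoint_eqI)
      fix Y :: "complex mat" assume Y: "Y \<in> carrier_mat N N"
      have "\<D> (\<Phi> (V * Y * mat_adjoint V)) \<in> carrier_mat N N"
        by (intro channel_carrier[OF \<D>] channel_carrier[OF ch] mult_three_carrier[OF V Y V'])
      then show "mat_trace (mat_diag N (($) x) * (\<D> \<circ> restrict_code \<Phi> V) Y) = mat_trace (mat_diag N (($) x) * Y)"
        using Y by (simp add: restrict_code_def mat_trace_diag_mult diag)
    qed simp
  next
    show "V \<in> carrier_mat n N" by (rule V)
  qed (use VV \<D> in auto)
  then show ?thesis
    unfolding transmittable_def using hom inj by (intro exI[of _ \<pi>]) auto
qed

theorem theorem4p21:
  fixes n m :: nat and \<Phi> :: "complex mat \<Rightarrow> complex mat"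
  assumes "0 < n" and "channel n m \<Phi>"
    and "zero_error_quantum_capacity n m \<Phi> = 0"
  shows "\<exists>N::nat. real N = 2 powr zero_error_classical_capacity n m \<Phi> \<and>
    (\<exists>A. dominating_transmittable n m \<Phi> A) \<and>
    (\<forall>A. dominating_transmittable n m \<Phi> A \<longrightarrow> star_isomorphic A (classical_algebra N))"
proof -
  obtain N where N: "0 < N" "zero_error_code n m \<Phi> N"
    and max: "\<And>M. zero_error_code n m \<Phi> M \<Longrightarrow> M \<le> N"
    and cap: "real N = 2 powr zero_error_classical_capacity n m \<Phi>"
    by (rule zero_error_code_max[OF assms(2,1)]) blast
  \<comment> \<open>The classical algebra consists of vectors, while the universe of transmittable
    algebras consists of matrices; \<open>A0\<close> is its representative there.\<close>
  obtain A0 where A0: "A0 \<in> transmittable_algebras n m \<Phi>" "star_embeds (classical_algebra N) A0"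
    using transmittable_representative[OF fd_cstar_classical_algebra[OF N(1)]
        classical_transmittable[OF assms(1,2) N(2,1)]] star_isomorphic_embeds by blast
  have classical: "\<exists>k\<le>N. star_isomorphic B (classical_algebra k)" if "B \<in> transmittable_algebras n m \<Phi>" for B
    using transmittable_classical[OF assms] that max unfolding transmittable_algebras_def by blast
  have "star_embeds B A0" if B: "B \<in> transmittable_algebras n m \<Phi>" for B
  proof -
    obtain k where k: "k \<le> N" "star_isomorphic B (classical_algebra k)"
      using classical[OF B] by blast
    show ?thesis
      by (rule star_embeds_trans[OF star_isomorphic_embeds[OF k(2)]
            star_embeds_trans[OF classical_embeds_mono[OF k(1)] A0(2)]])
  qed
  then have "dominating_transmittable n m \<Phi> A0"
    using A0(1) unfolding dominating_transmittable_def by (intro conjI ballI)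
  moreover have "star_isomorphic A (classical_algebra N)" if A: "dominating_transmittable n m \<Phi> A" for A
  proof -
    obtain k where k: "k \<le> N" "star_isomorphic A (classical_algebra k)"
      using classical A unfolding dominating_transmittable_def by blast
    \<comment> \<open>Domination of \<open>A\<close> is used only against \<open>A0\<close>: it puts
      \<complex>^N inside \<complex>^k, the reverse of the inequality already known.\<close>
    have "star_embeds A0 A" using A A0(1) unfolding dominating_transmittable_def by blast
    then have "star_embeds (classical_algebra N) (classical_algebra k)"
      by (intro star_embeds_trans[OF A0(2) star_embeds_trans[OF _ star_isomorphic_embeds[OF k(2)]]])
    then have "N \<le> k" by (rule classical_embeds_le)
    then show ?thesis using k by simp
  qed
  ultimately show ?thesis using cap by blast
qed

end
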